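(* Let $n\ge1$, let $\varrho>0$ and $0<\zeta<\varrho+1$ be constants, and let $u_0:\mathbb{R}^n\to\mathbb{R}$ be a $C^2$ function satisfying $(-1+\zeta)I\le D^2u_0(x)\le\varrho I$ for all $x\in\mathbb{R}^n$. Assume that $$\lim_{r\to+\infty}r^{-2}u_0(rx)=U_0(x)$$ for some $U_0\in C^2(\mathbb{R}^n)$. Let $u(x,t)$ and $U(x,t)$ be the solutions of $$\frac{\partial v}{\partial t}=F_{\pi/4}(D^2v)\qquad(t>0,\ x\in\mathbb{R}^n)$$ with initial values $u_0(x)$ and $U_0(x)$ respectively. Then $$\lim_{t\to+\infty}t^{-1}u(\sqrt t\,x,t)=U(x,1),$$ where the convergence is uniform and smooth in any compact subset of $\mathbb{R}^n$, and $U(x,1)$ is a smooth self-expanding solution of the mean curvature flow, that is, $w=U(\cdot,1)$ is a smooth solution on $\mathbb{R}^n$ of $$F_{\pi/4}(D^2w)=w-\frac12\langle x,Dw\rangle .$$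
   Context: $I$ is the $n\times n$ identity matrix, $D$ and $D^2$ denote the gradient and Hessian in $x$, $\langle\cdot,\cdot\rangle$ is the standard inner product on $\mathbb{R}^n$, and matrix inequalities are in the sense of symmetric matrices. For a symmetric matrix with eigenvalues $\lambda_1,\dots,\lambda_n>-1$, $F_{\pi/4}=-\sqrt2\sum_{i=1}^n\frac1{1+\lambda_i}$. "Solution" means the unique solution $v\in C^\infty(\mathbb{R}^n\times(0,+\infty))\cap C(\mathbb{R}^n\times[0,+\infty))$ with the prescribed initial value and with $(-1+\zeta)I\le D^2v(x,t)\le\varrho I$ for all $x$ and $t>0$. In the paper, entire solutions $w$ of $F_{\tau}(D^2w)=w-\frac12\langle x,Dw\rangle$ are what is meant by self-expanding solutions of the Lagrangian mean curvature flow of graphs $\{(x,Dw(x))\}$ in pseudo-Euclidean space $\mathbb{R}^{2n}_n$. *)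

theory Defs
  imports
    "HOL-Analysis.Analysis"
    "HOL-Computational_Algebra.Computational_Algebra"
begin

text \<open>
  The class C^k on an open set, for maps on a finite-dimensional space: all iterated directional
  derivatives up to order k exist (as Frechet derivatives) and are continuous.
\<close>

fun Ck_on :: "nat \<Rightarrow> 'a::euclidean_space set \<Rightarrow> ('a \<Rightarrow> real) \<Rightarrow> bool" where
  "Ck_on 0 S f \<longleftrightarrow> continuous_on S f"
| "Ck_on (Suc k) S f \<longleftrightarrow>
     (\<forall>x\<in>S. f differentiable (at x)) \<and>
     (\<forall>v. Ck_on k S (\<lambda>x. frechet_derivative f (at x) v))"

definition smooth_on :: "'a::euclidean_space set \<Rightarrow> ('a \<Rightarrow> real) \<Rightarrow> bool" where
  "smooth_on S f \<longleftrightarrow> (\<forall>k. Ck_on k S f)"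

definition partial :: "'n \<Rightarrow> (real ^ 'n \<Rightarrow> real) \<Rightarrow> real ^ 'n \<Rightarrow> real" where
  "partial i f x = frechet_derivative f (at x) (axis i 1)"

definition gradient :: "(real ^ 'n \<Rightarrow> real) \<Rightarrow> real ^ 'n \<Rightarrow> real ^ 'n" where
  "gradient f x = (\<chi> i. partial i f x)"

definition hessian :: "(real ^ 'n \<Rightarrow> real) \<Rightarrow> real ^ 'n \<Rightarrow> real ^ 'n ^ 'n" where
  "hessian f x = (\<chi> i j. partial i (partial j f) x)"

text \<open>
  A list of indices encodes an iterated partial derivative of arbitrary order; the empty list
  gives the function itself.
\<close>

definition iter_partial :: "'n list \<Rightarrow> (real ^ 'n \<Rightarrow> real) \<Rightarrow> real ^ 'n \<Rightarrow> real" where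
  "iter_partial is f = foldr partial is f"

text \<open>
  The order on symmetric matrices. The library order on vectors of vectors is componentwise and
  is not the one meant here.
\<close>

definition loewner_le :: "real ^ 'n ^ 'n \<Rightarrow> real ^ 'n ^ 'n \<Rightarrow> bool" (infix "\<preceq>\<^sub>L" 50) where
  "A \<preceq>\<^sub>L B \<longleftrightarrow> (\<forall>x. x \<bullet> (A *v x) \<le> x \<bullet> (B *v x))"

definition charpoly :: "real ^ 'n ^ 'n \<Rightarrow> real poly" where
  "charpoly A = det (mat [:0, 1:] - (\<chi> i j. [:A $ i $ j:]))"

text \<open>
  The real eigenvalues with algebraic multiplicity; for a symmetric matrix these are all the
  eigenvalues, so the multiset has exactly as many elements as the matrix has rows.
\<close>

definition eigenvalues :: "real ^ 'n ^ 'n \<Rightarrow> real multiset" where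
  "eigenvalues A = proots (charpoly A)"

definition F_pi4 :: "real ^ 'n ^ 'n \<Rightarrow> real" where
  "F_pi4 A = - sqrt 2 * (\<Sum>l\<in>#eigenvalues A. 1 / (1 + l))"

definition hessian_bounds :: "real \<Rightarrow> real \<Rightarrow> (real ^ 'n \<Rightarrow> real) \<Rightarrow> bool" where
  "hessian_bounds \<zeta> \<rho> f \<longleftrightarrow> (\<forall>x. mat (- 1 + \<zeta>) \<preceq>\<^sub>L hessian f x \<and> hessian f x \<preceq>\<^sub>L mat \<rho>)"

text \<open>
  Solutions of the parabolic Cauchy problem with initial value v0, in the class in which the
  solution is unique. Only the values v x t with t at least 0 matter.
\<close>

definition is_solution ::
    "real \<Rightarrow> real \<Rightarrow> (real ^ 'n \<Rightarrow> real) \<Rightarrow> (real ^ 'n \<Rightarrow> real \<Rightarrow> real) \<Rightarrow> bool" where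
  "is_solution \<zeta> \<rho> v0 v \<longleftrightarrow>
     smooth_on (UNIV \<times> {0<..}) (\<lambda>(x, t). v x t) \<and>
     continuous_on (UNIV \<times> {0..}) (\<lambda>(x, t). v x t) \<and>
     (\<forall>x. v x 0 = v0 x) \<and>
     (\<forall>t>0. hessian_bounds \<zeta> \<rho> (\<lambda>x. v x t)) \<and>
     (\<forall>x. \<forall>t>0. ((\<lambda>s. v x s) has_real_derivative F_pi4 (hessian (\<lambda>y. v y t) x)) (at t))"

text \<open>
  Convergence that is uniform together with all partial derivatives on every compact subset.
\<close>

definition smooth_convergence_on_compacts ::
    "('b \<Rightarrow> real ^ 'n \<Rightarrow> real) \<Rightarrow> (real ^ 'n \<Rightarrow> real) \<Rightarrow> 'b filter \<Rightarrow> bool" where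
  "smooth_convergence_on_compacts f g F \<longleftrightarrow>
     (\<forall>K is. compact K \<longrightarrow> uniform_limit K (\<lambda>t. iter_partial is (f t)) (iter_partial is g) F)"

definition self_expander :: "(real ^ 'n \<Rightarrow> real) \<Rightarrow> bool" where
  "self_expander w \<longleftrightarrow>
     smooth_on UNIV w \<and>
     (\<forall>x. F_pi4 (hessian w x) = w x - 1 / 2 * (x \<bullet> gradient w x))"

end

theory Submission
  imports Defs
begin

text \<open>
  Since the operator is monotone and Lipschitz, comparison with the barrier \<open>2 \<epsilon> (|x|\<^sup>2 + K t) + C\<close> shows
  that solutions are unique and that \<open>|u\<^sub>0 - U\<^sub>0| \<le> \<epsilon> |x|\<^sup>2 + C\<close> propagates in time. The limit \<open>U\<^sub>0\<close> is homogeneous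
  of degree two, so \<open>U\<close> is self-similar (hence a self-expander), and after parabolic rescaling the
  comparison gives locally uniform convergence.

  For the derivatives, no theory of fully nonlinear equations is needed: the Legendre transform of
  \<open>u + |x|\<^sup>2 / 2\<close> solves the linear heat equation with diffusion constant \<open>sqrt 2\<close> and has bounded Hessian. Iterated
  interior gradient estimates bound all its derivatives of order at least two at time one by
  constants depending only on the class of solutions. Inverting the gradient map carries these bounds back to
  \<open>u\<close>, and they apply to every rescaling of \<open>u\<close>. Uniform convergence together with uniform bounds on second derivatives
  gives uniform convergence of first derivatives, and so on inductively.
\<close>

unbundle no Formal_Power_Series.fps_syntax

section \<open>Symmetric matrices\<close>

text \<open>The operator is given through roots of the characteristic polynomial, a form unsuited to
  inequalities. Diagonalization rewrites it as -sqrt 2 times the trace of (I + A)^-1. For positive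
  definite B, e . B^-1 e is the maximum of 2 (e . y) - y . B y over y; this yields order reversal
  and a Lipschitz bound. The Legendre transform, whose Hessian is the inverse one, turns the trace
  into a Laplacian.

  On the unbounded domain, the maximum of a difference of solutions is confined to a ball because
  the operator is bounded on the class: a solution departs from its initial value by at most a
  multiple of t.

  The transform is not shown to be jointly smooth in space and time, so its equation is never
  differentiated. Finite differences solve the same equation and carry the estimates; derivatives
  appear only as limits of differences at a fixed time. The induction on the order starts at two
  because the transform and its gradient need not be bounded, while its second differences are
  controlled by the lower Hessian bound alone.\<close>

lemma quadratic_nonneg_imp_zero:
  fixes b c :: real
  assumes "\<And>s. 2 * s * b \<le> s\<^sup>2 * c"
  shows "b = 0"
proof (rule ccontr)
  assume b: "b \<noteq> 0"
  \<comment> \<open>With this s the quadratic term is at most s * b, half of the linear term 2 * s *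
    b.\<close>
  define s where "s = b / (1 + \<bar>c\<bar>)"
  have 1: "2 * s * b \<le> s\<^sup>2 * c" by (rule assms)
  have "s\<^sup>2 * c \<le> s\<^sup>2 * (1 + \<bar>c\<bar>)" by (intro mult_left_mono) auto
  also have "\<dots> = s * b" unfolding s_def by (simp add: power2_eq_square add_nonneg_eq_0_iff)
  finally have "s * b \<le> 0" using 1 by linarith
  moreover have "s * b > 0" unfolding s_def using b
    by (metis add_pos_nonneg abs_ge_zero divide_pos_pos mult.commute not_real_square_gt_zero
        times_divide_eq_right zero_less_one)
  ultimately show False by simp
qed

lemma symmetric_inner:
  fixes A :: "real^'n^'n"
  assumes "transpose A = A"
  shows "x \<bullet> (A *v y) = (A *v x) \<bullet> y"
  by (metis assms dot_lmul_matrix vector_transpose_matrix)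

text \<open>A maximizer \<open>v\<close> of the Rayleigh quotient on the unit sphere of
  \<open>S\<close> is an eigenvector. The residual \<open>w\<close> lies in \<open>S\<close> by
  invariance, so \<open>v + s *\<^sub>R w\<close> is a competitor for every s. Its first-order gain
  2 s |w|^2 would have to be dominated by a multiple of s^2, which forces w = 0.\<close>

lemma symmetric_eigenvector_in_subspace:
  fixes A :: "real^'n^'n"
  assumes sym: "transpose A = A" and S: "subspace S" and inv: "\<And>x. x \<in> S \<Longrightarrow> A *v x \<in> S"
    and ne: "\<exists>x\<in>S. x \<noteq> 0"
  obtains v l where "v \<in> S" "norm v = 1" "A *v v = l *\<^sub>R v"
proof -
  define q where "q = (\<lambda>x. x \<bullet> (A *v x))"
  have comp: "compact (S \<inter> sphere 0 1)"
    by (simp add: S closed_subspace closed_Int_compact)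
  obtain x where x: "x \<in> S" "x \<noteq> 0" using ne by blast
  have "x /\<^sub>R norm x \<in> S \<inter> sphere 0 1" using x S by (auto simp: subspace_scale)
  then have "S \<inter> sphere 0 1 \<noteq> {}" by blast
  moreover have "continuous_on (S \<inter> sphere 0 1) q" unfolding q_def
    by (intro continuous_intros)
  ultimately obtain v where v: "v \<in> S \<inter> sphere 0 1" and mx: "\<And>y. y \<in> S \<inter> sphere 0 1 \<Longrightarrow> q y \<le> q v"
    using continuous_attains_sup[OF comp] by metis
  have hom: "q y \<le> q v * (y \<bullet> y)" if "y \<in> S" for y
  proof (cases "y = 0")
    case False
    have "q (y /\<^sub>R norm y) \<le> q v"
      using that False S by (intro mx) (auto simp: subspace_scale)
    moreover have "q (y /\<^sub>R norm y) = q y / (norm y)\<^sup>2"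
      unfolding q_def by (simp add: matrix_vector_mult_scaleR power2_eq_square field_simps)
    ultimately show ?thesis using False
      by (simp add: power2_norm_eq_inner divide_le_eq)
  qed (simp add: q_def)
  define w where "w = A *v v - q v *\<^sub>R v"
  have vS: "v \<in> S" and nv: "v \<bullet> v = 1" using v by (auto simp: dot_square_norm)
  have wS: "w \<in> S" unfolding w_def using vS inv S by (simp add: subspace_diff subspace_scale)
  have "w \<bullet> w = 0"
  proof (rule quadratic_nonneg_imp_zero)
    fix s :: real
    have 1: "q (v + s *\<^sub>R w) \<le> q v * ((v + s *\<^sub>R w) \<bullet> (v + s *\<^sub>R w))"
      using vS wS S by (intro hom) (simp add: subspace_add subspace_scale)
    have 2: "q (v + s *\<^sub>R w) = q v + 2 * s * (w \<bullet> (A *v v)) + s\<^sup>2 * q w"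
      unfolding q_def using symmetric_inner[OF sym, of v w]
      by (simp add: matrix_vector_right_distrib matrix_vector_mult_scaleR inner_left_distrib inner_right_distrib
         power2_eq_square algebra_simps inner_commute)
    have 3: "(v + s *\<^sub>R w) \<bullet> (v + s *\<^sub>R w) = 1 + 2 * s * (w \<bullet> v) + s\<^sup>2 * (w \<bullet> w)"
      using nv inner_commute[of v w] by (simp add: inner_left_distrib inner_right_distrib
         power2_eq_square distrib_left)
    have 4: "w \<bullet> (A *v v) = w \<bullet> w + q v * (w \<bullet> v)"
      unfolding w_def by (simp add: algebra_simps)
    have "q v + 2 * s * (w \<bullet> w + q v * (w \<bullet> v)) + s\<^sup>2 * q w
        \<le> q v * (1 + 2 * s * (w \<bullet> v) + s\<^sup>2 * (w \<bullet> w))"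
      using 1 unfolding 2 3 4 .
    then show "2 * s * (w \<bullet> w) \<le> s\<^sup>2 * (q v * (w \<bullet> w) - q w)"
      by (simp add: algebra_simps)
  qed
  then have "A *v v = q v *\<^sub>R v" unfolding w_def by simp
  moreover have "norm v = 1" using v by auto
  ultimately show thesis using that vS by blast
qed

text \<open>Induction on the dimension: after a unit eigenvector \<open>v\<close> is split off, the
  part of \<open>S\<close> orthogonal to \<open>v\<close> is again invariant, because v . A x = A v
  . x = l (v . x) = 0 there.\<close>

lemma symmetric_eigenbasis_of_subspace:
  fixes A :: "real^'n^'n"
  assumes sym: "transpose A = A" and "subspace S" and "\<And>x. x \<in> S \<Longrightarrow> A *v x \<in> S"
  shows "\<exists>B. B \<subseteq> S \<and> pairwise orthogonal B \<and> S \<subseteq> span B \<and>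
    (\<forall>v\<in>B. norm v = 1 \<and> (\<exists>l. A *v v = l *\<^sub>R v))"
  using assms(2,3)
proof (induction "dim S" arbitrary: S rule: less_induct)
  case less
  show ?case
  proof (cases "\<exists>x\<in>S. x \<noteq> 0")
    case False
    then show ?thesis by (intro exI[of _ "{}"]) auto
  next
    case True
    obtain v l where v: "v \<in> S" "norm v = 1" "A *v v = l *\<^sub>R v"
      using symmetric_eigenvector_in_subspace[OF sym less.prems True] by blast
    have vv: "v \<bullet> v = 1" using v by (simp add: dot_square_norm)
    define T where "T = S \<inter> {x. v \<bullet> x = 0}"
    have T: "subspace T" unfolding T_def using less.prems(1)
      by (simp add: subspace_Int subspace_hyperplane subspace_inter)
    have "T \<subset> S" unfolding T_def using v(1) vv by (metis (mono_tags, lifting) IntD2 Int_lower1 mem_Collect_eq psubsetI zero_neq_one)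
    then have "dim T < dim S" using less.prems(1) T
      by (metis dim_psubset span_eq_iff)
    moreover have "A *v x \<in> T" if "x \<in> T" for x
      using that less.prems(2) symmetric_inner[OF sym, of v x] v(3) unfolding T_def by auto
    ultimately obtain B where B: "B \<subseteq> T" "pairwise orthogonal B" "T \<subseteq> span B"
      "\<forall>v\<in>B. norm v = 1 \<and> (\<exists>l. A *v v = l *\<^sub>R v)"
      using less.hyps[of T] T by blast
    have "S \<subseteq> span (insert v B)"
    proof
      fix x assume "x \<in> S"
      then have "x - (v \<bullet> x) *\<^sub>R v \<in> T" unfolding T_def
        using v vv less.prems(1) by (auto simp: subspace_diff subspace_scale algebra_simps)
      then have "x - (v \<bullet> x) *\<^sub>R v \<in> span B" using B by blast
      then show "x \<in> span (insert v B)" unfolding span_breakdown_eq by blast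
    qed
    moreover have "pairwise orthogonal (insert v B)"
      using B(1,2) unfolding T_def
      by (auto simp: pairwise_insert orthogonal_def inner_commute)
    ultimately show ?thesis using B v unfolding T_def by (intro exI[of _ "insert v B"]) auto
  qed
qed

theorem symmetric_matrix_diagonalizable:
  fixes A :: "real^'n^'n"
  assumes sym: "transpose A = A"
  obtains P and d :: "'n \<Rightarrow> real"
  where "orthogonal_matrix P" "A ** P = P ** (\<chi> i j. if i = j then d i else 0)"
proof -
  obtain B where B: "pairwise orthogonal B" "span B = UNIV"
     "\<forall>v\<in>B. norm v = 1 \<and> (\<exists>l. A *v v = l *\<^sub>R v)"
    using symmetric_eigenbasis_of_subspace[OF sym, of UNIV] by auto
  have "0 \<notin> B" using B(3) by auto
  then have ind: "independent B" using pairwise_orthogonal_independent[OF B(1)] by blast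
  have "card B = CARD('n)"
    using dim_eq_card[OF _ ind, of UNIV] B(2) by simp
  then obtain f where f: "bij_betw f (UNIV::'n set) B"
    using finite_same_card_bij[of "UNIV :: 'n set" B] ind independent_imp_finite by fastforce
  have "\<exists>l. A *v f j = l *\<^sub>R f j" for j using f B(3) unfolding bij_betw_def by auto
  then obtain d where d: "\<And>j. A *v f j = d j *\<^sub>R f j" by metis
  define P where "P = (\<chi> i j. f j $ i)"
  have col: "column j P = f j" for j unfolding P_def column_def by vector
  have "orthogonal_matrix P"
    unfolding orthogonal_matrix_orthonormal_columns col
    using f B(1,3) unfolding bij_betw_def pairwise_def inj_on_def by (simp, metis rangeI)
  moreover have "A ** P = P ** (\<chi> i j. if i = j then d i else 0)"
  proof -
    have "(A ** P) $ i $ j = (P ** (\<chi> i j. if i = j then d i else 0)) $ i $ j" for i j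
    proof -
      have "(A ** P) $ i $ j = (A *v f j) $ i"
        unfolding P_def matrix_matrix_mult_def matrix_vector_mult_def by simp
      also have "\<dots> = d j * f j $ i" by (simp add: d)
      also have "\<dots> = (P ** (\<chi> i j. if i = j then d i else 0)) $ i $ j"
        unfolding P_def matrix_matrix_mult_def by (simp add: mult_delta_left mult_delta_right)
      finally show ?thesis .
    qed
    then show ?thesis by (simp add: vec_eq_iff)
  qed
  ultimately show thesis using that by blast
qed

text \<open>The similarity is transported to matrices of polynomials by the multiplicative map
  \<open>C\<close> onto constant entries. There det (C P) is nonzero because C (transpose P) ** C P
  = I, and it cancels since real polynomials form an integral domain.\<close>

lemma charpoly_diagonalized:
  fixes A P :: "real^'n^'n"
  assumes P: "orthogonal_matrix P" and AP: "A ** P = P ** (\<chi> i j. if i = j then d i else 0)"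
  shows "charpoly A = (\<Prod>i\<in>UNIV. [:- d i, 1:])"
proof -
  define C where "C = (\<lambda>M::real^'n^'n. (\<chi> i j. [:M $ i $ j:]))"
  let ?D = "(\<chi> i j. if i = j then d i else 0) :: real^'n^'n"
  have Cmul: "C (M ** N) = C M ** C N" for M N
  proof -
    have "[:\<Sum>k\<in>K. f k:] = (\<Sum>k\<in>K. [:f k:])" for f :: "'n \<Rightarrow> real" and K
    proof (induction K rule: infinite_finite_induct)
      case (insert k K)
      then show ?case by (simp flip: insert.IH)
    qed auto
    then show ?thesis unfolding C_def matrix_matrix_mult_def by (simp add: vec_eq_iff mult.commute)
  qed
  have comm: "mat [:0,1:] ** C P = C P ** mat [:0,1:]"
    unfolding matrix_matrix_mult_def mat_def C_def
    by (simp only: vec_eq_iff vec_lambda_beta mult_delta_left mult_delta_right sum.delta sum.delta' finite UNIV_I if_True mult.commute simp_thms)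
  have C1: "C (mat 1) = mat 1" unfolding C_def mat_def by (auto simp: vec_eq_iff one_pCons)
  have "det (C (transpose P)) * det (C P) = 1"
    using P C1 by (metis Cmul det_I det_mul orthogonal_matrix)
  then have nz: "det (C P) \<noteq> 0" by auto
  have sub: "(X - Y) ** Z = X ** Z - Y ** Z" "Z ** (X - Y) = Z ** X - Z ** Y" for X Y Z :: "real poly^'n^'n"
    unfolding matrix_matrix_mult_def by (simp_all add: vec_eq_iff sum_subtractf left_diff_distrib right_diff_distrib)
  have "(mat [:0,1:] - C A) ** C P = C P ** (mat [:0,1:] - C ?D)"
    unfolding sub comm Cmul[symmetric] AP ..
  from arg_cong[OF this, of det]
  have "det (mat [:0,1:] - C A) * det (C P) = det (C P) * det (mat [:0,1:] - C ?D)"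
    by (simp only: det_mul)
  then have "charpoly A = det (mat [:0,1:] - C ?D)" using nz unfolding charpoly_def C_def by simp
  also have "\<dots> = (\<Prod>i\<in>UNIV. [:- d i, 1:])"
    by (subst det_diagonal) (auto simp: C_def mat_def)
  finally show ?thesis .
qed

lemma eigenvalues_diagonalized:
  fixes A P :: "real^'n^'n"
  assumes "orthogonal_matrix P" "A ** P = P ** (\<chi> i j. if i = j then d i else 0)"
  shows "eigenvalues A = image_mset d (mset_set UNIV)"
proof -
  have "eigenvalues A = (\<Sum>i\<in>UNIV. {#d i#})"
    unfolding eigenvalues_def charpoly_diagonalized[OF assms]
    by (subst proots_prod) auto
  also have "\<dots> = image_mset d (mset_set UNIV)"
    by (metis (mono_tags, lifting) image_mset_cong sum_unfold_sum_mset sum_mset_singleton_mset)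
  finally show ?thesis .
qed

text \<open>In the eigenbasis, \<open>Q\<close> becomes \<open>R\<close> and (I + A) becomes
  diagonal, so the diagonal entries satisfy (1 + d i) * R_ii = 1. This identity also shows that no
  eigenvalue equals -1, so a right inverse \<open>Q\<close> is all that is assumed.\<close>

lemma F_pi4_eq_trace:
  fixes A Q :: "real^'n^'n"
  assumes sym: "transpose A = A" and Q: "(mat 1 + A) ** Q = mat 1"
  shows "F_pi4 A = - sqrt 2 * trace Q"
proof -
  obtain P d where P: "orthogonal_matrix P" and AP: "A ** P = P ** (\<chi> i j. if i = j then d i else 0)"
    by (rule symmetric_matrix_diagonalizable[OF sym])
  let ?D = "(\<chi> i j. if i = j then d i else 0) :: real^'n^'n"
  define E where "E = (\<chi> i j. if i = j then 1 + d i else 0 :: real^'n^'n)"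
  define R where "R = transpose P ** Q ** P"
  have PP: "transpose P ** P = mat 1" "P ** transpose P = mat 1" using P unfolding orthogonal_matrix_def by auto
  have E: "(mat 1 + A) ** P = P ** E"
  proof -
    have "(mat 1 + A) ** P = P + A ** P" by (simp add: matrix_matrix_mult_def vec_eq_iff sum.distrib distrib_right mat_def mult_delta_left)
    also have "\<dots> = P ** (mat 1 + ?D)" by (simp add: AP matrix_add_ldistrib)
    also have "mat 1 + ?D = E" unfolding E_def mat_def by vector
    finally show ?thesis .
  qed
  have "E ** R = transpose P ** (P ** E) ** transpose P ** Q ** P"
    unfolding R_def by (simp add: matrix_mul_assoc PP)
  also have "\<dots> = transpose P ** ((mat 1 + A) ** (P ** transpose P) ** Q) ** P"
    unfolding E[symmetric] by (simp add: matrix_mul_assoc)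
  also have "\<dots> = mat 1" by (simp add: PP Q)
  finally have ER: "E ** R = mat 1" .
  have "(1 + d i) * R $ i $ i = 1" for i
  proof -
    have "(E ** R) $ i $ i = 1" by (simp add: ER mat_def)
    then show ?thesis unfolding matrix_matrix_mult_def E_def by (simp add: mult_delta_left mult_delta_right)
  qed
  then have "R $ i $ i = 1 / (1 + d i)" for i
    by (metis mult_not_zero nonzero_eq_divide_eq mult.commute zero_neq_one)
  then have "trace R = (\<Sum>i\<in>UNIV. 1 / (1 + d i))" unfolding trace_def by simp
  moreover have "trace R = trace Q"
    unfolding R_def by (metis PP(2) matrix_mul_assoc matrix_mul_rid trace_mul_sym)
  ultimately show ?thesis
    unfolding F_pi4_def eigenvalues_diagonalized[OF P AP] by (simp add: sum_unfold_sum_mset image_mset.compositionality comp_def)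
qed

section \<open>Uniformly positive matrices and inequalities for the operator\<close>

definition pos_def :: "real \<Rightarrow> real^'n^'n \<Rightarrow> bool" where
  "pos_def z A \<longleftrightarrow> transpose A = A \<and> (\<forall>x. z * (x \<bullet> x) \<le> x \<bullet> (A *v x))"

lemma pos_def_inverse:
  fixes A :: "real^'n^'n"
  assumes z: "0 < z" and A: "pos_def z A"
  shows "A ** matrix_inv A = mat 1" "matrix_inv A ** A = mat 1"
    "A *v (matrix_inv A *v e) = e" "matrix_inv A *v (A *v e) = e"
proof -
  have "x = 0" if "A *v x = 0" for x
  proof -
    have "z * (x \<bullet> x) \<le> 0" using A that unfolding pos_def_def by (metis inner_zero_right)
    then show ?thesis using z by (metis inner_eq_zero_iff inner_ge_zero mult_le_0_iff not_less order_antisym)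
  qed
  then have "\<exists>B. B ** A = mat 1" unfolding matrix_left_invertible_ker by blast
  then have "invertible A" by (simp add: invertible_left_inverse)
  then show 1: "A ** matrix_inv A = mat 1" "matrix_inv A ** A = mat 1"
    unfolding matrix_inv_def invertible_def by (metis (mono_tags, lifting) someI_ex)+
  then show "A *v (matrix_inv A *v e) = e" "matrix_inv A *v (A *v e) = e"
    by (simp_all add: matrix_vector_mul_assoc)
qed

lemma pos_def_inverse_norm:
  fixes A :: "real^'n^'n"
  assumes z: "0 < z" and A: "pos_def z A"
  shows "norm (matrix_inv A *v e) \<le> norm e / z"
proof -
  define w where "w = matrix_inv A *v e"
  have "z * (w \<bullet> w) \<le> w \<bullet> e"
    using A pos_def_inverse(3)[OF z A, of e] unfolding pos_def_def w_def by metis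
  also have "\<dots> \<le> norm w * norm e" by (rule norm_cauchy_schwarz)
  finally have "norm w * (z * norm w) \<le> norm w * norm e"
    by (simp add: dot_square_norm power2_eq_square algebra_simps)
  then have "z * norm w \<le> norm e" by (cases "w = 0") auto
  then show ?thesis using z unfolding w_def by (simp add: field_simps)
qed

text \<open>Expand the nonnegative form of A at y - A^-1 e. Equality holds at y = A^-1 e, so the
  right side is a maximum over y; this makes inversion order reversing without square roots or
  simultaneous diagonalization.\<close>

lemma pos_def_inverse_variational:
  fixes A :: "real^'n^'n"
  assumes z: "0 < z" and A: "pos_def z A"
  shows "2 * (e \<bullet> y) - y \<bullet> (A *v y) \<le> e \<bullet> (matrix_inv A *v e)"
proof -
  define w where "w = matrix_inv A *v e"
  have Aw: "A *v w = e" unfolding w_def by (rule pos_def_inverse(3)[OF z A])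
  have "z * ((y - w) \<bullet> (y - w)) \<le> (y - w) \<bullet> (A *v (y - w))"
    using A unfolding pos_def_def by blast
  moreover have "0 \<le> z * ((y - w) \<bullet> (y - w))" using z by simp
  moreover have "w \<bullet> (A *v y) = e \<bullet> y"
    using A Aw symmetric_inner[of A w y] unfolding pos_def_def by simp
  ultimately show ?thesis unfolding w_def[symmetric]
    by (simp add: matrix_vector_mult_diff_distrib inner_diff_left inner_diff_right Aw inner_commute)
qed

lemma trace_eq_sum_axis:
  fixes Q :: "real^'n^'n"
  shows "trace Q = (\<Sum>i\<in>UNIV. axis i 1 \<bullet> (Q *v axis i 1))"
  unfolding trace_def by (simp add: inner_axis' matrix_vector_mult_basis column_def)

lemma pos_def_shift:
  fixes A :: "real^'n^'n"
  assumes "transpose A = A" "mat (- 1 + z) \<preceq>\<^sub>L A"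
  shows "pos_def z (mat 1 + A)"
proof -
  have m: "mat c *v x = c *\<^sub>R x" for c and x :: "real^'n"
    by (simp add: vec_eq_iff matrix_vector_mult_def mat_def mult_delta_left)
  have "transpose (mat 1 + A) = mat 1 + A" using assms(1)
    by (simp add: transpose_def vec_eq_iff mat_def)
  moreover have "z * (x \<bullet> x) \<le> x \<bullet> ((mat 1 + A) *v x)" for x
  proof -
    have "(- 1 + z) * (x \<bullet> x) \<le> x \<bullet> (A *v x)"
      using assms(2) unfolding loewner_le_def m by simp
    then show ?thesis by (simp add: matrix_vector_mult_add_rdistrib inner_add_right algebra_simps)
  qed
  ultimately show ?thesis unfolding pos_def_def by blast
qed

lemma F_pi4_eq_trace_inv:
  fixes A :: "real^'n^'n"
  assumes z: "0 < z" and A: "transpose A = A" "mat (- 1 + z) \<preceq>\<^sub>L A"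
  shows "F_pi4 A = - sqrt 2 * trace (matrix_inv (mat 1 + A))"
  by (rule F_pi4_eq_trace[OF A(1) pos_def_inverse(1)[OF z pos_def_shift[OF A]]])

text \<open>The inverse of I + A has diagonal entries between 0 (take y = 0 in the variational
  inequality) and 1/z. The resulting bound on the time derivative is what controls solutions at
  spatial infinity.\<close>

lemma F_pi4_bound:
  fixes A :: "real^'n^'n"
  assumes z: "0 < z" and A: "transpose A = A" "mat (- 1 + z) \<preceq>\<^sub>L A"
  shows "\<bar>F_pi4 A\<bar> \<le> sqrt 2 * CARD('n) / z"
proof -
  let ?Q = "matrix_inv (mat 1 + A)"
  note P = pos_def_shift[OF A]
  have 1: "0 \<le> axis i 1 \<bullet> (?Q *v axis i 1)" for i :: 'n
    using pos_def_inverse_variational[OF z P, of "axis i 1" 0] by simp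
  have 2: "axis i 1 \<bullet> (?Q *v axis i 1) \<le> 1 / z" for i :: 'n
    using norm_cauchy_schwarz[of "axis i 1" "?Q *v axis i 1"] pos_def_inverse_norm[OF z P, of "axis i 1"]
    by simp
  have "0 \<le> trace ?Q" unfolding trace_eq_sum_axis by (intro sum_nonneg 1)
  moreover have "trace ?Q \<le> CARD('n) / z"
    unfolding trace_eq_sum_axis using sum_bounded_above[of UNIV, OF 2] by simp
  ultimately show ?thesis unfolding F_pi4_eq_trace_inv[OF assms]
    using mult_left_mono[of "trace ?Q" "CARD('n) / z" "sqrt 2"] by (simp add: abs_mult)
qed

text \<open>The optimizer \<open>w\<close> of the variational formula for B is inserted as a
  competitor in the one for A. Since |w| <= 1/z, the shift s costs at most s / z^2 in each diagonal
  entry. The case s = 0 is monotonicity.\<close>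

lemma F_pi4_mono_shift:
  fixes A B :: "real^'n^'n"
  assumes z: "0 < z" and A: "transpose A = A" "mat (- 1 + z) \<preceq>\<^sub>L A"
    and B: "transpose B = B" "mat (- 1 + z) \<preceq>\<^sub>L B" and s: "0 \<le> s"
    and AB: "\<And>x. x \<bullet> (A *v x) \<le> x \<bullet> (B *v x) + s * (x \<bullet> x)"
  shows "F_pi4 A \<le> F_pi4 B + sqrt 2 * CARD('n) * s / z\<^sup>2"
proof -
  let ?P = "matrix_inv (mat 1 + A)" and ?Q = "matrix_inv (mat 1 + B)"
  note PA = pos_def_shift[OF A] and PB = pos_def_shift[OF B]
  have "axis i 1 \<bullet> (?Q *v axis i 1) - s / z\<^sup>2 \<le> axis i 1 \<bullet> (?P *v axis i 1)" for i :: 'n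
  proof -
    define e :: "real^'n" where "e = axis i 1"
    define w where "w = ?Q *v e"
    have Bw: "(mat 1 + B) *v w = e" unfolding w_def by (rule pos_def_inverse(3)[OF z PB])
    have "norm w \<le> 1 / z" using pos_def_inverse_norm[OF z PB, of e] unfolding w_def e_def by simp
    then have "w \<bullet> w \<le> (1 / z)\<^sup>2" unfolding dot_square_norm by (intro power_mono) auto
    then have sw: "s * (w \<bullet> w) \<le> s / z\<^sup>2" using mult_left_mono[OF _ s] by (fastforce simp: power_divide)
    have "w \<bullet> ((mat 1 + A) *v w) \<le> w \<bullet> ((mat 1 + B) *v w) + s * (w \<bullet> w)"
      using AB[of w] by (simp add: matrix_vector_mult_add_rdistrib inner_add_right)
    moreover have "2 * (e \<bullet> w) - w \<bullet> ((mat 1 + A) *v w) \<le> e \<bullet> (?P *v e)"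
      by (rule pos_def_inverse_variational[OF z PA])
    ultimately have "e \<bullet> w - s / z\<^sup>2 \<le> e \<bullet> (?P *v e)" using sw unfolding Bw by (simp add: inner_commute)
    then show ?thesis unfolding e_def w_def .
  qed
  from sum_mono[OF this, where K = UNIV]
  have "trace ?Q - CARD('n) * s / z\<^sup>2 \<le> trace ?P"
    unfolding trace_eq_sum_axis by (simp add: sum_subtractf)
  from mult_left_mono[OF this, of "sqrt 2"] show ?thesis
    unfolding F_pi4_eq_trace_inv[OF z A] F_pi4_eq_trace_inv[OF z B] by (simp add: algebra_simps)
qed

section \<open>Partial derivatives\<close>

lemma frechet_derivative_eq_gradient:
  assumes "f differentiable (at x)"
  shows "frechet_derivative f (at x) v = gradient f x \<bullet> v"
proof -
  have l: "linear (frechet_derivative f (at x))" by (rule linear_frechet_derivative[OF assms])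
  have "frechet_derivative f (at x) v = frechet_derivative f (at x) (\<Sum>i\<in>UNIV. (v $ i) *\<^sub>R axis i 1)"
    by (subst basis_expansion[of v, symmetric]) (simp add: scalar_mult_eq_scaleR)
  also have "\<dots> = (\<Sum>i\<in>UNIV. v $ i * partial i f x)"
    by (simp add: linear_sum[OF l] linear_cmul[OF l] partial_def)
  also have "\<dots> = gradient f x \<bullet> v" by (simp add: inner_vec_def gradient_def mult.commute)
  finally show ?thesis .
qed

lemma has_derivative_gradient:
  assumes "f differentiable (at x)"
  shows "(f has_derivative (\<lambda>v. gradient f x \<bullet> v)) (at x)"
  using frechet_derivative_works[THEN iffD1, OF assms] frechet_derivative_eq_gradient[OF assms]
  by (metis (no_types, lifting) ext)

lemma gradient_nth [simp]: "gradient f x $ i = partial i f x"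
  by (simp add: gradient_def)

lemma hessian_nth [simp]: "hessian f x $ i $ j = partial i (partial j f) x"
  by (simp add: hessian_def)

lemma has_real_derivative_along_line:
  assumes "f differentiable (at (x + s *\<^sub>R v))"
  shows "((\<lambda>s. f (x + s *\<^sub>R v)) has_real_derivative gradient f (x + s *\<^sub>R v) \<bullet> v) (at s)"
proof -
  have "((\<lambda>s. f (x + s *\<^sub>R v)) has_derivative (\<lambda>h. gradient f (x + s *\<^sub>R v) \<bullet> (h *\<^sub>R v))) (at s)"
    by (rule has_derivative_compose[where f = "\<lambda>s. x + s *\<^sub>R v", OF _ has_derivative_gradient[OF assms]])
       (auto intro!: derivative_eq_intros)
  moreover have "(\<lambda>h. gradient f (x + s *\<^sub>R v) \<bullet> (h *\<^sub>R v)) = (*) (gradient f (x + s *\<^sub>R v) \<bullet> v)"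
    by (auto simp: fun_eq_iff)
  ultimately show ?thesis unfolding has_field_derivative_def by (simp only:)
qed

lemma has_real_derivative_along_axis:
  assumes "f differentiable (at (x + s *\<^sub>R axis i 1))"
  shows "((\<lambda>s. f (x + s *\<^sub>R axis i 1)) has_real_derivative partial i f (x + s *\<^sub>R axis i 1)) (at s)"
  using has_real_derivative_along_line[OF assms] by (simp add: inner_axis)

lemma partial_eqI:
  assumes "(f has_derivative f') (at x)"
  shows "partial i f x = f' (axis i 1)"
  unfolding partial_def frechet_derivative_at[OF assms, symmetric] ..

lemma has_real_derivative_gradient_along_line:
  assumes "\<And>j. partial j f differentiable (at (x + s *\<^sub>R v))"
  shows "((\<lambda>s. gradient f (x + s *\<^sub>R v) \<bullet> v) has_real_derivative
      v \<bullet> (hessian f (x + s *\<^sub>R v) *v v)) (at s)"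
proof -
  have "((\<lambda>s. \<Sum>j\<in>UNIV. partial j f (x + s *\<^sub>R v) * v $ j) has_real_derivative
    (\<Sum>j\<in>UNIV. (gradient (partial j f) (x + s *\<^sub>R v) \<bullet> v) * v $ j)) (at s)"
    by (intro DERIV_sum DERIV_cmult_right has_real_derivative_along_line assms)
  moreover have "(\<Sum>j\<in>UNIV. (gradient (partial j f) (x + s *\<^sub>R v) \<bullet> v) * v $ j) =
     v \<bullet> (hessian f (x + s *\<^sub>R v) *v v)"
    unfolding inner_vec_def matrix_vector_mult_def
    by (simp add: sum_distrib_left sum_distrib_right) (subst sum.swap, simp add: mult_ac)
  ultimately show ?thesis by (simp add: inner_vec_def)
qed

lemma Ck_on_2D:
  assumes "Ck_on 2 UNIV f"
  shows "f differentiable (at x)" "partial j f differentiable (at x)" "continuous_on UNIV (partial i (partial j f))"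
  using assms unfolding numeral_2_eq_2 partial_def[abs_def] by auto

section \<open>Symmetry of second partial derivatives\<close>

lemma second_difference_mvt:
  fixes f :: "real^'n \<Rightarrow> real"
  assumes f: "\<And>x. f differentiable (at x)" and fj: "\<And>x. partial j f differentiable (at x)" and h: "0 < h"
  shows "\<exists>y. norm (y - x) \<le> 2 * h \<and>
    f (x + h *\<^sub>R axis i 1 + h *\<^sub>R axis j 1) - f (x + h *\<^sub>R axis j 1) - (f (x + h *\<^sub>R axis i 1) - f x)
     = h\<^sup>2 * partial i (partial j f) y"
proof -
  let ?i = "axis i 1 :: real^'n" and ?j = "axis j 1 :: real^'n"
  have "\<exists>t. 0 < t \<and> t < h \<and>
    (f (x + h *\<^sub>R ?i + h *\<^sub>R ?j) - f (x + h *\<^sub>R ?j)) - (f (x + h *\<^sub>R ?i + 0 *\<^sub>R ?j) - f (x + 0 *\<^sub>R ?j))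
     = (h - 0) * (partial j f (x + h *\<^sub>R ?i + t *\<^sub>R ?j) - partial j f (x + t *\<^sub>R ?j))"
    by (rule MVT2[OF h]) (intro DERIV_diff has_real_derivative_along_axis f)
  then obtain t where t: "0 < t" "t < h" and
    1: "(f (x + h *\<^sub>R ?i + h *\<^sub>R ?j) - f (x + h *\<^sub>R ?j)) - (f (x + h *\<^sub>R ?i) - f x)
     = h * (partial j f (x + h *\<^sub>R ?i + t *\<^sub>R ?j) - partial j f (x + t *\<^sub>R ?j))"
    by auto
  have "\<exists>s. 0 < s \<and> s < h \<and> partial j f (x + t *\<^sub>R ?j + h *\<^sub>R ?i) - partial j f (x + t *\<^sub>R ?j + 0 *\<^sub>R ?i)
     = (h - 0) * partial i (partial j f) (x + t *\<^sub>R ?j + s *\<^sub>R ?i)"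
    by (rule MVT2[OF h]) (intro has_real_derivative_along_axis fj)
  then obtain s where s: "0 < s" "s < h" and
    2: "partial j f (x + t *\<^sub>R ?j + h *\<^sub>R ?i) - partial j f (x + t *\<^sub>R ?j)
     = h * partial i (partial j f) (x + t *\<^sub>R ?j + s *\<^sub>R ?i)"
    by auto
  have "norm (t *\<^sub>R ?j + s *\<^sub>R ?i) \<le> 2 * h"
    using norm_triangle_ineq[of "t *\<^sub>R ?j" "s *\<^sub>R ?i"] s t by simp
  then show ?thesis using 1 2
    by (intro exI[of _ "x + t *\<^sub>R ?j + s *\<^sub>R ?i"]) (simp add: algebra_simps power2_eq_square)
qed

text \<open>The second difference is symmetric in i and j, so both mixed derivatives take a common
  value, at possibly different points within distance 2 h of x; continuity at x then excludes a gap
  between them.\<close>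

lemma partial_commute:
  fixes f :: "real^'n \<Rightarrow> real"
  assumes C2: "Ck_on 2 UNIV f"
  shows "partial i (partial j f) x = partial j (partial i f) x"
proof (rule ccontr)
  define e where "e = dist (partial i (partial j f) x) (partial j (partial i f) x)"
  assume "\<not> ?thesis"
  then have e: "e / 2 > 0" unfolding e_def by simp
  have "\<exists>d>0. \<forall>y. dist y x < d \<longrightarrow> dist (partial i (partial j f) y) (partial i (partial j f) x) < e / 2" for i j
    using Ck_on_2D(3)[OF C2, of i j] e unfolding continuous_on_iff by (metis UNIV_I)
  from this[of i j] this[of j i] obtain d1 d2 where d: "d1 > 0" "d2 > 0"
    and d1: "\<And>y. dist y x < d1 \<Longrightarrow> dist (partial i (partial j f) y) (partial i (partial j f) x) < e / 2"
    and d2: "\<And>y. dist y x < d2 \<Longrightarrow> dist (partial j (partial i f) y) (partial j (partial i f) x) < e / 2"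
    by metis
  define h where "h = min d1 d2 / 3"
  have h: "0 < h" "2 * h < d1" "2 * h < d2" using d unfolding h_def by (auto simp: min_def)
  note S = second_difference_mvt[OF Ck_on_2D(1)[OF C2] Ck_on_2D(2)[OF C2] h(1)]
  obtain y where y: "norm (y - x) \<le> 2 * h" "f (x + h *\<^sub>R axis i 1 + h *\<^sub>R axis j 1) - f (x + h *\<^sub>R axis j 1) - (f (x + h *\<^sub>R axis i 1) - f x)
     = h\<^sup>2 * partial i (partial j f) y" using S by blast
  obtain z where z: "norm (z - x) \<le> 2 * h" "f (x + h *\<^sub>R axis j 1 + h *\<^sub>R axis i 1) - f (x + h *\<^sub>R axis i 1) - (f (x + h *\<^sub>R axis j 1) - f x)
     = h\<^sup>2 * partial j (partial i f) z" using S by blast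
  have "h\<^sup>2 * partial i (partial j f) y = h\<^sup>2 * partial j (partial i f) z"
    using y(2) z(2) by (simp add: algebra_simps)
  then have eq: "partial i (partial j f) y = partial j (partial i f) z" using h(1) by simp
  show False
    using d1[of y] d2[of z] y(1) z(1) h eq unfolding e_def dist_norm by (simp add: abs_if split: if_splits)
qed

lemma hessian_symmetric:
  assumes "Ck_on 2 UNIV f"
  shows "transpose (hessian f x) = hessian f x"
  by (simp add: transpose_def vec_eq_iff partial_commute[OF assms])

text \<open>On an open set the derivative depends only on values in the set. This permits replacing
  \<open>frechet_derivative\<close> of a composite expression by its explicit formula inside
  \<open>Ck_on\<close>, the step on which the closure proofs below rest.\<close>

lemma Ck_on_cong_open:
  assumes "open T" and "\<And>x. x \<in> T \<Longrightarrow> f x = g x" and "Ck_on k T f"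
  shows "Ck_on k T g"
  using assms(2,3)
proof (induction k arbitrary: f g)
  case 0
  then show ?case using continuous_on_cong[of T T f g] by simp
next
  case (Suc k)
  have D: "(g has_derivative f') (at x)" if "x \<in> T" "(f has_derivative f') (at x)" for x f'
    using has_derivative_transform_within_open[OF that(2) assms(1) that(1)] Suc.prems(1) by blast
  have E: "(g has_derivative frechet_derivative f (at x)) (at x)" if "x \<in> T" for x
    using D[OF that] Suc.prems(2) that by (simp add: frechet_derivative_works)
  have F: "frechet_derivative f (at x) = frechet_derivative g (at x)" if "x \<in> T" for x
    using frechet_derivative_at[OF E[OF that]] .
  have "Ck_on k T (\<lambda>x. frechet_derivative g (at x) v)" for v
    by (rule Suc.IH[of "\<lambda>x. frechet_derivative f (at x) v"]) (use F Suc.prems(2) in auto)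
  then show ?case using E unfolding differentiable_def Ck_on.simps by blast
qed

text \<open>The induction must vary f: the derivative of the composite in direction v is the
  directional derivative of f in direction L v, composed with the same affine map. It serves both
  time slices and parabolic scaling.\<close>

lemma Ck_on_affine:
  assumes "open T" and L: "bounded_linear L" and "\<And>x. x \<in> T \<Longrightarrow> a + L x \<in> S" and "Ck_on k S f"
  shows "Ck_on k T (\<lambda>x. f (a + L x))"
  using assms(4)
proof (induction k arbitrary: f)
  case 0
  have "continuous_on T (\<lambda>x. a + L x)"
    by (intro continuous_intros linear_continuous_on L)
  then show ?case using 0 continuous_on_compose2[of S f T "\<lambda>x. a + L x"] assms(3) by auto
next
  case (Suc k)
  have D: "((\<lambda>x. f (a + L x)) has_derivative (\<lambda>v. frechet_derivative f (at (a + L x)) (L v))) (at x)" if "x \<in> T" for x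
  proof (rule has_derivative_compose[where f = "\<lambda>x. a + L x"])
    show "((\<lambda>x. a + L x) has_derivative L) (at x)"
      using bounded_linear_imp_has_derivative[OF L] by (auto intro!: derivative_eq_intros)
    show "(f has_derivative frechet_derivative f (at (a + L x))) (at (a + L x))"
      using Suc.prems assms(3)[OF that] frechet_derivative_works by auto
  qed
  have "Ck_on k T (\<lambda>x. frechet_derivative (\<lambda>x. f (a + L x)) (at x) v)" for v
  proof (rule Ck_on_cong_open[OF assms(1)])
    show "Ck_on k T (\<lambda>x. frechet_derivative f (at (a + L x)) (L v))"
      using Suc.prems by (intro Suc.IH) auto
    show "frechet_derivative f (at (a + L x)) (L v) = frechet_derivative (\<lambda>x. f (a + L x)) (at x) v" if "x \<in> T" for x
      using frechet_derivative_at[OF D[OF that]] by metis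
  qed
  then show ?case using D unfolding differentiable_def Ck_on.simps by blast
qed

lemma Ck_on_cmult:
  assumes "open T" and "Ck_on k T f"
  shows "Ck_on k T (\<lambda>x. c * f x)"
  using assms(2)
proof (induction k arbitrary: f)
  case 0
  then show ?case by (auto intro: continuous_intros)
next
  case (Suc k)
  have D: "((\<lambda>x. c * f x) has_derivative (\<lambda>v. c * frechet_derivative f (at x) v)) (at x)" if "x \<in> T" for x
    using Suc.prems that frechet_derivative_works by (auto intro!: derivative_eq_intros)
  have "Ck_on k T (\<lambda>x. frechet_derivative (\<lambda>x. c * f x) (at x) v)" for v
  proof (rule Ck_on_cong_open[OF assms(1)])
    show "Ck_on k T (\<lambda>x. c * frechet_derivative f (at x) v)"
      using Suc.prems by (intro Suc.IH) auto
    show "c * frechet_derivative f (at x) v = frechet_derivative (\<lambda>x. c * f x) (at x) v" if "x \<in> T" for x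
      using frechet_derivative_at[OF D[OF that]] by metis
  qed
  then show ?case using D unfolding differentiable_def Ck_on.simps by blast
qed

text \<open>Working notion of spatial smoothness: only coordinate directions occur, and continuity
  of every iterated partial is implied by its differentiability.\<close>

definition partials_differentiable :: "(real^'n \<Rightarrow> real) \<Rightarrow> bool" where
  "partials_differentiable f \<longleftrightarrow> (\<forall>is x. iter_partial is f differentiable (at x))"

lemma iter_partial_simps [simp]:
  "iter_partial [] f = f" "iter_partial (i # is) f = partial i (iter_partial is f)"
  by (simp_all add: iter_partial_def)

lemma iter_partial_append: "iter_partial (is @ js) f = iter_partial is (iter_partial js f)"
  by (simp add: iter_partial_def)

lemma smooth_on_partial:
  fixes f :: "real^'n \<Rightarrow> real"
  assumes "smooth_on UNIV f"
  shows "smooth_on UNIV (partial i f)"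
proof -
  have "Ck_on (Suc k) UNIV f" for k using assms unfolding smooth_on_def by blast
  then show ?thesis unfolding smooth_on_def partial_def[abs_def] by simp
qed

lemma smooth_on_iter_partial:
  fixes f :: "real^'n \<Rightarrow> real"
  shows "smooth_on UNIV f \<Longrightarrow> smooth_on UNIV (iter_partial is f)"
  by (induction "is") (auto intro: smooth_on_partial)

lemma smooth_on_imp_partials_differentiable:
  fixes f :: "real^'n \<Rightarrow> real"
  assumes "smooth_on UNIV f"
  shows "partials_differentiable f"
proof -
  have "Ck_on 1 UNIV (iter_partial is f)" for "is"
    using smooth_on_iter_partial[OF assms] unfolding smooth_on_def by blast
  then show ?thesis unfolding partials_differentiable_def by simp
qed

lemma partials_differentiableD:
  assumes "partials_differentiable f"
  shows "f differentiable (at x)" "partial i f differentiable (at x)" "partial i (partial j f) differentiable (at x)"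
  using assms unfolding partials_differentiable_def
  by (metis iter_partial_simps)+

lemma partial_add:
  assumes "f differentiable (at x)" "g differentiable (at x)"
  shows "partial i (\<lambda>x. f x + g x) x = partial i f x + partial i g x"
  using has_derivative_add[OF assms[unfolded frechet_derivative_works]]
  by (subst partial_eqI) (auto simp: partial_def)

lemma iter_partial_add:
  assumes "partials_differentiable f" "partials_differentiable g"
  shows "iter_partial is (\<lambda>x. f x + g x) = (\<lambda>x. iter_partial is f x + iter_partial is g x)"
proof (induction "is")
  case (Cons i "is")
  show ?case unfolding iter_partial_simps Cons
    using assms unfolding partials_differentiable_def by (intro ext partial_add) auto
qed simp

lemma partials_differentiable_add:
  assumes "partials_differentiable f" "partials_differentiable g"
  shows "partials_differentiable (\<lambda>x. f x + g x)"
  using assms unfolding partials_differentiable_def iter_partial_add[OF assms] by auto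

text \<open>Adding this function turns the lower bound -1 + \<zeta> on the Hessian into uniform
  convexity with constant \<zeta>. Its iterated partials of order at least two are the constants 0
  or 1, so it can be removed from derivative bounds at the cost of 1.\<close>

definition half_sq :: "real^'n \<Rightarrow> real" where "half_sq x = (x \<bullet> x) / 2"

lemma half_sq_has_derivative: "(half_sq has_derivative (\<lambda>v. x \<bullet> v)) (at x)"
  unfolding half_sq_def[abs_def] by (auto intro!: derivative_eq_intros simp: inner_commute)

lemma partial_half_sq:
  fixes i :: "'n::finite"
  shows "partial i half_sq = (\<lambda>x. x $ i)"
proof
  fix x :: "real^'n"
  show "partial i half_sq x = x $ i" using partial_eqI[OF half_sq_has_derivative, of i x] by (simp add: inner_axis)
qed

lemma partial_nth:
  fixes i :: "'n::finite"
  shows "partial i (\<lambda>x. x $ j) = (\<lambda>x. if i = j then 1 else 0)"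
proof
  fix x :: "real^'n"
  have "((\<lambda>x. x $ j) has_derivative (\<lambda>x. x $ j)) (at x)"
    by (rule bounded_linear_imp_has_derivative) (rule bounded_linear_vec_nth)
  then show "partial i (\<lambda>x. x $ j) x = (if i = j then 1 else 0)" using partial_eqI[of _ _ x i] by (fastforce simp: axis_def)
qed

lemma partial_const: "partial i (\<lambda>x. c) = (\<lambda>x. 0)"
  by (rule ext) (subst partial_eqI[OF has_derivative_const], simp)

lemma iter_partial_half_sq:
  fixes "is" :: "'n::finite list"
  assumes "2 \<le> length is"
  shows "\<exists>c\<in>{0,1}. iter_partial is half_sq = (\<lambda>x :: real^'n. c)"
  using assms
proof (induction "is")
  case (Cons i js)
  show ?case
  proof (cases "2 \<le> length js")
    case True
    then show ?thesis using Cons.IH by (auto simp: partial_const)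
  next
    case False
    then obtain j where "js = [j]" using Cons.prems by (cases js; cases "tl js") auto
    then show ?thesis by (auto simp: partial_half_sq partial_nth)
  qed
qed simp

lemma partials_differentiable_half_sq: "partials_differentiable (half_sq :: real^'n \<Rightarrow> real)"
  unfolding partials_differentiable_def
proof (intro allI)
  fix "is" :: "'n list" and x :: "real^'n"
  consider "is = []" | i where "is = [i]" | "2 \<le> length is"
    by (cases "is"; cases "tl is") auto
  then show "iter_partial is half_sq differentiable (at x)"
  proof cases
    case 1
    then show ?thesis using half_sq_has_derivative unfolding differentiable_def by auto
  next
    case 2
    then show ?thesis using bounded_linear_imp_differentiable[OF bounded_linear_vec_nth]
      by (auto simp: partial_half_sq)
  next
    case 3
    then show ?thesis using iter_partial_half_sq[OF 3] by auto
  qed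
qed

section \<open>Comparison principle and self-similar solutions\<close>

text \<open>If d > 0, then f' is positive just to the right of 0 and f increases there. Since f' is
  required to be differentiable at 0 only, no continuity of second derivatives is needed when this
  is applied along lines.\<close>

lemma second_derivative_at_max:
  fixes f :: "real \<Rightarrow> real"
  assumes f: "\<And>s. \<bar>s\<bar> < \<delta> \<Longrightarrow> (f has_real_derivative f' s) (at s)" and f': "(f' has_real_derivative d) (at 0)"
    and \<delta>: "0 < \<delta>" and mx: "\<And>s. \<bar>s\<bar> < \<delta> \<Longrightarrow> f s \<le> f 0"
  shows "d \<le> 0"
proof (rule ccontr)
  assume "\<not> d \<le> 0"
  then obtain e where e: "e > 0" "\<And>h. 0 < h \<Longrightarrow> h < e \<Longrightarrow> f' 0 < f' (0 + h)"
    using DERIV_pos_inc_right[OF f'] by auto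
  have "f' 0 = 0"
    by (rule DERIV_local_max[OF f[of 0] \<delta>]) (use \<delta> mx in auto)
  define h where "h = min e \<delta> / 2"
  have h: "0 < h" "h < e" "h < \<delta>" using e(1) \<delta> unfolding h_def by (auto simp: min_def)
  obtain z where z: "0 < z" "z < h" "f h - f 0 = (h - 0) * f' z"
    using MVT2[of 0 h f f'] f h by fastforce
  have "f' z > 0" using e(2)[of z] z h \<open>f' 0 = 0\<close> by simp
  then have "f h > f 0" using z h by (metis diff_0_right diff_gt_0_iff_gt mult_pos_pos)
  then show False using mx[of h] h by simp
qed

text \<open>A one-sided condition, because a space-time maximum may sit at the final time.\<close>

lemma derivative_at_left_max:
  fixes f :: "real \<Rightarrow> real"
  assumes f: "(f has_real_derivative d) (at t)" and \<delta>: "0 < \<delta>"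
    and mx: "\<And>s. t - \<delta> < s \<Longrightarrow> s \<le> t \<Longrightarrow> f s \<le> f t"
  shows "0 \<le> d"
proof (rule ccontr)
  assume "\<not> 0 \<le> d"
  then obtain e where e: "e > 0" "\<And>h. 0 < h \<Longrightarrow> h < e \<Longrightarrow> f t < f (t - h)"
    using DERIV_neg_dec_left[OF f] by auto
  define h where "h = min e \<delta> / 2"
  have h: "0 < h" "h < e" "h < \<delta>" using e(1) \<delta> unfolding h_def by (auto simp: min_def)
  show False using e(2)[of h] mx[of "t - h"] h by simp
qed

lemma parabolic_maximum:
  fixes \<phi> :: "'a::euclidean_space \<Rightarrow> real \<Rightarrow> real"
  assumes K: "compact K" and c: "continuous_on (K \<times> {a..b}) (\<lambda>(x,t). \<phi> x t)"
    and x0: "x0 \<in> K" "a \<le> t0" "t0 \<le> b"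
  obtains x t where "x \<in> K" "a \<le> t" "t \<le> b" "\<phi> x0 t0 \<le> \<phi> x t"
    "\<And>y s. y \<in> K \<Longrightarrow> a \<le> s \<Longrightarrow> s \<le> b \<Longrightarrow> \<phi> y s \<le> \<phi> x t"
proof -
  have "compact (K \<times> {a..b})" by (intro compact_Times K compact_Icc)
  moreover have "K \<times> {a..b} \<noteq> {}" using x0 by auto
  ultimately obtain p where p: "p \<in> K \<times> {a..b}" "\<And>q. q \<in> K \<times> {a..b} \<Longrightarrow> (\<lambda>(x,t). \<phi> x t) q \<le> (\<lambda>(x,t). \<phi> x t) p"
    using continuous_attains_sup[OF _ _ c] by metis
  show thesis
    by (rule that[of "fst p" "snd p"]) (use p(1) p(2)[of "(_, _)"] x0 in \<open>auto simp: case_prod_unfold\<close>)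
qed

section \<open>Slices, time regularity and parabolic rescaling of solutions\<close>

lemma partial_scale:
  fixes f :: "real^'n \<Rightarrow> real"
  assumes "f differentiable (at (r *\<^sub>R x))"
  shows "partial i (\<lambda>x. c * f (r *\<^sub>R x)) x = c * r * partial i f (r *\<^sub>R x)"
proof -
  have "((\<lambda>x. f (r *\<^sub>R x)) has_derivative (\<lambda>v. gradient f (r *\<^sub>R x) \<bullet> (r *\<^sub>R v))) (at x)"
    by (rule has_derivative_compose[where f = "\<lambda>x. r *\<^sub>R x", OF _ has_derivative_gradient[OF assms]])
       (auto intro!: derivative_eq_intros)
  from has_derivative_mult_right[OF this, of c] show ?thesis
    using partial_eqI[of _ _ x i] by (fastforce simp: inner_axis mult.assoc)
qed

lemma hessian_scale:
  fixes f :: "real^'n \<Rightarrow> real"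
  assumes f: "partials_differentiable f" and r: "r \<noteq> 0"
  shows "hessian (\<lambda>x. f (r *\<^sub>R x) / r\<^sup>2) x = hessian f (r *\<^sub>R x)"
proof -
  have 1: "partial j (\<lambda>x. f (r *\<^sub>R x) / r\<^sup>2) = (\<lambda>x. (1 / r) * partial j f (r *\<^sub>R x))" for j
    using partial_scale[OF partials_differentiableD(1)[OF f], of j "1 / r\<^sup>2" r] r
    by (auto simp: power2_eq_square)
  have "partial i (\<lambda>x. (1 / r) * partial j f (r *\<^sub>R x)) x = (1 / r) * r * partial i (partial j f) (r *\<^sub>R x)" for i j
    by (rule partial_scale[OF partials_differentiableD(2)[OF f]])
  then show ?thesis using r by (simp only: vec_eq_iff hessian_nth 1) simp
qed

lemma is_solution_slice_smooth:
  assumes "is_solution \<zeta> \<rho> v0 v" "0 < t"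
  shows "smooth_on UNIV (\<lambda>x. v x t)"
  unfolding smooth_on_def
proof
  fix k
  have "Ck_on k (UNIV \<times> {0<..}) (\<lambda>(x, t). v x t)"
    using assms(1) unfolding is_solution_def smooth_on_def by blast
  from Ck_on_affine[OF open_UNIV _ _ this, of "\<lambda>x. (x, 0)" "(0, t)"] assms(2)
  show "Ck_on k UNIV (\<lambda>x. v x t)"
    by (simp add: bounded_linear_Pair bounded_linear_ident bounded_linear_zero)
qed

lemma is_solutionD:
  fixes v :: "real^'n \<Rightarrow> real \<Rightarrow> real"
  assumes "is_solution \<zeta> \<rho> v0 v"
  shows is_solution_partials: "0 < t \<Longrightarrow> partials_differentiable (\<lambda>x. v x t)"
    and is_solution_C2: "0 < t \<Longrightarrow> Ck_on 2 UNIV (\<lambda>x. v x t)"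
    and is_solution_sym: "0 < t \<Longrightarrow> transpose (hessian (\<lambda>x. v x t) x) = hessian (\<lambda>x. v x t) x"
    and is_solution_lower: "0 < t \<Longrightarrow> mat (- 1 + \<zeta>) \<preceq>\<^sub>L hessian (\<lambda>x. v x t) x"
    and is_solution_upper: "0 < t \<Longrightarrow> hessian (\<lambda>x. v x t) x \<preceq>\<^sub>L mat \<rho>"
    and is_solution_time: "0 < t \<Longrightarrow> ((\<lambda>s. v x s) has_real_derivative F_pi4 (hessian (\<lambda>y. v y t) x)) (at t)"
    and is_solution_initial: "v x 0 = v0 x"
    and is_solution_continuous: "continuous_on (UNIV \<times> {0..}) (\<lambda>(x, t). v x t)"
proof -
  note sm = is_solution_slice_smooth[OF assms]
  show "partials_differentiable (\<lambda>x. v x t)" if "0 < t"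
    by (rule smooth_on_imp_partials_differentiable[OF sm[OF that]])
  show C2: "Ck_on 2 UNIV (\<lambda>x. v x t)" if "0 < t"
    using sm[OF that] unfolding smooth_on_def by blast
  show "transpose (hessian (\<lambda>x. v x t) x) = hessian (\<lambda>x. v x t) x" if "0 < t"
    by (rule hessian_symmetric[OF C2[OF that]])
qed (use assms in \<open>auto simp: is_solution_def hessian_bounds_def\<close>)

text \<open>The mean value theorem with the bound on the operator. It reaches s = 0 because only
  continuity is needed at the initial time.\<close>

lemma is_solution_time_bound:
  fixes v :: "real^'n \<Rightarrow> real \<Rightarrow> real"
  assumes sol: "is_solution \<zeta> \<rho> v0 v" and \<zeta>: "0 < \<zeta>" and st: "0 \<le> s" "s \<le> t"
  shows "\<bar>v x t - v x s\<bar> \<le> sqrt 2 * CARD('n) / \<zeta> * (t - s)"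
proof (cases "s = t")
  case False
  then have st': "s < t" using st by simp
  have "continuous_on {s..t} (\<lambda>t. (\<lambda>(x, t). v x t) (x, t))"
    by (rule continuous_on_compose2[OF is_solution_continuous[OF sol]])
       (use st in \<open>auto intro!: continuous_intros\<close>)
  then have "\<exists>l z. s < z \<and> z < t \<and> ((\<lambda>t. v x t) has_real_derivative l) (at z) \<and> v x t - v x s = (t - s) * l"
    using is_solution_time[OF sol] st
    by (intro MVT[OF st']) (auto simp: real_differentiable_def, meson order_le_less_trans)
  then obtain l z where z: "s < z" "((\<lambda>t. v x t) has_real_derivative l) (at z)" "v x t - v x s = (t - s) * l"
    by blast
  have "l = F_pi4 (hessian (\<lambda>y. v y z) x)"
    using DERIV_unique[OF z(2) is_solution_time[OF sol]] z(1) st by auto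
  then have "\<bar>l\<bar> \<le> sqrt 2 * CARD('n) / \<zeta>"
    using F_pi4_bound[OF \<zeta> is_solution_sym[OF sol] is_solution_lower[OF sol]] z(1) st by auto
  from mult_left_mono[OF this, of "t - s"] show ?thesis
    unfolding z(3) using st by (simp add: abs_mult mult.commute)
qed simp

text \<open>Parabolic scaling leaves the values of the Hessian unchanged, so both the equation and
  the Hessian bounds persist with the same \<zeta> and \<rho>.\<close>

lemma is_solution_scale:
  fixes v :: "real^'n \<Rightarrow> real \<Rightarrow> real"
  assumes sol: "is_solution \<zeta> \<rho> v0 v" and r: "0 < r"
  shows "is_solution \<zeta> \<rho> (\<lambda>x. v0 (r *\<^sub>R x) / r\<^sup>2) (\<lambda>x t. v (r *\<^sub>R x) (r\<^sup>2 * t) / r\<^sup>2)"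
proof -
  define L :: "(real^'n) \<times> real \<Rightarrow> (real^'n) \<times> real" where "L = (\<lambda>p. (r *\<^sub>R fst p, r\<^sup>2 * snd p))"
  have L: "bounded_linear L" unfolding L_def
    by (intro bounded_linear_Pair bounded_linear_const_scaleR bounded_linear_const_mult bounded_linear_fst bounded_linear_snd)
  have r2: "0 < r\<^sup>2" using r by simp
  have eq: "(\<lambda>(x, t). v (r *\<^sub>R x) (r\<^sup>2 * t) / r\<^sup>2) = (\<lambda>p. (1 / r\<^sup>2) * (\<lambda>(x, t). v x t) (0 + L p))"
    unfolding L_def by (auto simp: fun_eq_iff)
  have 1: "smooth_on (UNIV \<times> {0<..}) (\<lambda>(x, t). v (r *\<^sub>R x) (r\<^sup>2 * t) / r\<^sup>2)"
    unfolding smooth_on_def eq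
  proof
    fix k
    show "Ck_on k (UNIV \<times> {0<..}) (\<lambda>p. (1 / r\<^sup>2) * (\<lambda>(x, t). v x t) (0 + L p))"
    proof (intro Ck_on_cmult Ck_on_affine[where S = "UNIV \<times> {0<..}"] open_Times open_UNIV open_greaterThan L)
      show "Ck_on k (UNIV \<times> {0<..}) (\<lambda>(x, t). v x t)"
        using sol unfolding is_solution_def smooth_on_def by blast
    qed (use r2 in \<open>auto simp: L_def\<close>)
  qed
  have 2: "continuous_on (UNIV \<times> {0..}) (\<lambda>(x, t). v (r *\<^sub>R x) (r\<^sup>2 * t) / r\<^sup>2)"
  proof -
    have "continuous_on (UNIV \<times> {0..}) (\<lambda>p. (\<lambda>(x, t). v x t) (L p))"
      by (rule continuous_on_compose2[OF is_solution_continuous[OF sol] linear_continuous_on[OF L]])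
         (use r2 in \<open>auto simp: L_def\<close>)
    from continuous_on_mult_left[OF this, of "1 / r\<^sup>2"] show ?thesis unfolding eq by simp
  qed
  have H: "hessian (\<lambda>x. v (r *\<^sub>R x) (r\<^sup>2 * t) / r\<^sup>2) x = hessian (\<lambda>x. v x (r\<^sup>2 * t)) (r *\<^sub>R x)" if "t > 0" for t x
    using hessian_scale[OF is_solution_partials[OF sol]] r r2 that by simp
  have 3: "((\<lambda>s. v (r *\<^sub>R x) (r\<^sup>2 * s) / r\<^sup>2) has_real_derivative
      F_pi4 (hessian (\<lambda>y. v (r *\<^sub>R y) (r\<^sup>2 * t) / r\<^sup>2) x)) (at t)" if "t > 0" for t x
  proof -
    have 1: "((\<lambda>s. r\<^sup>2 * s) has_real_derivative r\<^sup>2) (at t)" by (auto intro!: derivative_eq_intros)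
    have "((\<lambda>s. v (r *\<^sub>R x) (r\<^sup>2 * s)) has_real_derivative
        F_pi4 (hessian (\<lambda>y. v y (r\<^sup>2 * t)) (r *\<^sub>R x)) * r\<^sup>2) (at t)"
      by (rule DERIV_chain2[OF is_solution_time[OF sol] 1]) (use that r2 in auto)
    from DERIV_cdivide[OF this, of "r\<^sup>2"] show ?thesis unfolding H[OF that] using r by simp
  qed
  have 4: "mat (- 1 + \<zeta>) \<preceq>\<^sub>L hessian (\<lambda>x. v (r *\<^sub>R x) (r\<^sup>2 * t) / r\<^sup>2) x
      \<and> hessian (\<lambda>x. v (r *\<^sub>R x) (r\<^sup>2 * t) / r\<^sup>2) x \<preceq>\<^sub>L mat \<rho>" if "t > 0" for t x
    unfolding H[OF that] using is_solution_lower[OF sol] is_solution_upper[OF sol] r2 that by simp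
  show ?thesis unfolding is_solution_def hessian_bounds_def
    using 1 2 3 4 by (intro conjI allI impI) (simp_all add: is_solution_initial[OF sol])
qed

text \<open>Of the spatial barrier 2 \<epsilon> |x|^2, one half absorbs the initial difference and
  the other half beats the time drift of both solutions far out. A positive value of \<phi> would
  thus produce an interior positive maximum, where the barrier's growth in time exceeds what the
  operator can compensate.\<close>

lemma is_solution_comparison:
  fixes v w :: "real^'n \<Rightarrow> real \<Rightarrow> real"
  assumes v: "is_solution \<zeta> \<rho> v0 v" and w: "is_solution \<zeta> \<rho> w0 w" and \<zeta>: "0 < \<zeta>"
    and \<epsilon>: "0 < \<epsilon>" and init: "\<And>x. v0 x - w0 x \<le> \<epsilon> * (x \<bullet> x) + C"
    and t1: "0 \<le> t1"
  shows "v x1 t1 - w x1 t1 \<le> 2 * \<epsilon> * (x1 \<bullet> x1 + (2 * sqrt 2 * CARD('n) / \<zeta>\<^sup>2 + 1) * t1) + C"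
proof (rule ccontr)
  \<comment> \<open>A Hessian shift by 4 \<epsilon> changes the operator by at most 2 \<epsilon> (K
    - 1); the extra 1 gives the strict inequality used at the end.\<close>
  define K where "K = 2 * sqrt 2 * CARD('n) / \<zeta>\<^sup>2 + 1"
  define M where "M = sqrt 2 * CARD('n) / \<zeta>"
  define \<phi> where "\<phi> = (\<lambda>x t. v x t - w x t - 2 * \<epsilon> * (x \<bullet> x + K * t) - C)"
  assume "\<not> ?thesis"
  then have pos: "\<phi> x1 t1 > 0" unfolding \<phi>_def K_def by simp
  have M: "M \<ge> 0" and K: "K > 0" unfolding M_def K_def using \<zeta> by (auto intro: add_nonneg_pos)
  \<comment> \<open>The ball contains x1, and as R >= 1 one has R^2 >= R >= 2 M t1 / \<epsilon>, so
    \<phi> is not positive outside the ball.\<close>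
  define R where "R = norm x1 + 1 + 2 * M * t1 / \<epsilon>"
  have growth: "\<phi> x t \<le> 2 * M * t1 - \<epsilon> * (x \<bullet> x)" if "0 \<le> t" "t \<le> t1" for x t
  proof -
    have 1: "\<bar>v x t - v x 0\<bar> \<le> M * t" "\<bar>w x t - w x 0\<bar> \<le> M * t"
      using is_solution_time_bound[OF v \<zeta> order_refl that(1)] is_solution_time_bound[OF w \<zeta> order_refl that(1)]
      unfolding M_def by simp_all
    have 2: "M * t \<le> M * t1" using that M by (intro mult_left_mono)
    have 3: "v x 0 - w x 0 \<le> \<epsilon> * (x \<bullet> x) + C"
      using init is_solution_initial[OF v] is_solution_initial[OF w] by simp
    have 4: "0 \<le> \<epsilon> * (K * t)" using \<epsilon> K that by simp
    have "2 * \<epsilon> * (x \<bullet> x + K * t) = 2 * (\<epsilon> * (x \<bullet> x)) + 2 * (\<epsilon> * (K * t))"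
      by (simp add: distrib_left)
    then show ?thesis using 1 2 3 4 unfolding \<phi>_def by linarith
  qed
  have outside: "\<phi> x t \<le> 0" if "0 \<le> t" "t \<le> t1" "norm x \<ge> R" for x t
  proof -
    have R: "R \<ge> 1" "R \<ge> 2 * M * t1 / \<epsilon>" unfolding R_def using M \<epsilon> t1 by auto
    have "2 * M * t1 / \<epsilon> \<le> R * R" using R mult_mono[of 1 R R R] by linarith
    also have "\<dots> \<le> norm x * norm x" using that R by (intro mult_mono) auto
    finally have "2 * M * t1 \<le> \<epsilon> * (x \<bullet> x)" using \<epsilon> by (simp add: dot_square_norm power2_eq_square field_simps)
    then show ?thesis using growth[OF that(1,2), of x] by simp
  qed
  have initial: "\<phi> x 0 \<le> 0" for x
  proof -
    have "0 \<le> \<epsilon> * (x \<bullet> x)" using \<epsilon> by simp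
    then show ?thesis
      using init[of x] unfolding \<phi>_def is_solution_initial[OF v] is_solution_initial[OF w] by simp
  qed
  have cont: "continuous_on (cball 0 R \<times> {0..t1}) (\<lambda>(x,t). \<phi> x t)"
  proof -
    have "continuous_on (cball 0 R \<times> {0..t1}) (\<lambda>(x, t). v x t)" "continuous_on (cball 0 R \<times> {0..t1}) (\<lambda>(x, t). w x t)"
      using is_solution_continuous[OF v] is_solution_continuous[OF w] by (auto elim: continuous_on_subset)
    then show ?thesis unfolding \<phi>_def case_prod_unfold by (intro continuous_intros)
  qed
  have "x1 \<in> cball 0 R" unfolding R_def using M \<epsilon> t1 by simp
  then obtain x t where xt: "x \<in> cball 0 R" "0 \<le> t" "t \<le> t1" "\<phi> x1 t1 \<le> \<phi> x t"
    and mx: "\<And>y s. y \<in> cball 0 R \<Longrightarrow> 0 \<le> s \<Longrightarrow> s \<le> t1 \<Longrightarrow> \<phi> y s \<le> \<phi> x t"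
    using parabolic_maximum[OF compact_cball cont _ t1 order_refl] by blast
  have px: "\<phi> x t > 0" using xt(4) pos by simp
  have t: "0 < t" using initial[of x] px xt(2) by (cases "t = 0") auto
  have xR: "norm x < R" using outside[OF xt(2,3), of x] px by force
  \<comment> \<open>Second derivative test along the line in direction e through the interior
    maximum; 4 \<epsilon> I is the Hessian of the barrier.\<close>
  have Q: "e \<bullet> (hessian (\<lambda>x. v x t) x *v e) \<le> e \<bullet> (hessian (\<lambda>x. w x t) x *v e) + 4 * \<epsilon> * (e \<bullet> e)" for e
  proof -
    let ?g = "\<lambda>s. gradient (\<lambda>x. v x t) (x + s *\<^sub>R e) \<bullet> e - gradient (\<lambda>x. w x t) (x + s *\<^sub>R e) \<bullet> e - 4 * \<epsilon> * ((x + s *\<^sub>R e) \<bullet> e)"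
    have sq: "((\<lambda>s. 2 * \<epsilon> * ((x + s *\<^sub>R e) \<bullet> (x + s *\<^sub>R e) + K * t)) has_real_derivative 4 * \<epsilon> * ((x + s *\<^sub>R e) \<bullet> e)) (at s)" for s
      unfolding inner_add_left inner_add_right inner_scaleR_left inner_scaleR_right
      by (auto intro!: derivative_eq_intros simp: inner_commute algebra_simps)
    have d1: "((\<lambda>s. \<phi> (x + s *\<^sub>R e) t) has_real_derivative ?g s - 0) (at s)" for s
      unfolding \<phi>_def
      by (intro DERIV_diff DERIV_const sq has_real_derivative_along_line
          partials_differentiableD(1)[OF is_solution_partials[OF v t]] partials_differentiableD(1)[OF is_solution_partials[OF w t]])
    have d2: "(?g has_real_derivative e \<bullet> (hessian (\<lambda>x. v x t) (x + 0 *\<^sub>R e) *v e) - e \<bullet> (hessian (\<lambda>x. w x t) (x + 0 *\<^sub>R e) *v e)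
       - 4 * \<epsilon> * (e \<bullet> e)) (at 0)"
    proof (intro DERIV_diff has_real_derivative_gradient_along_line
          partials_differentiableD(2)[OF is_solution_partials[OF v t]] partials_differentiableD(2)[OF is_solution_partials[OF w t]])
      show "((\<lambda>s. 4 * \<epsilon> * ((x + s *\<^sub>R e) \<bullet> e)) has_real_derivative 4 * \<epsilon> * (e \<bullet> e)) (at 0)"
        unfolding inner_add_left inner_scaleR_left by (auto intro!: derivative_eq_intros)
    qed
    define \<delta> where "\<delta> = (R - norm x) / (norm e + 1)"
    have ne: "norm e + 1 > 0" by (simp add: add_nonneg_pos)
    have "\<delta> > 0" unfolding \<delta>_def using xR ne by simp
    have near: "\<phi> (x + s *\<^sub>R e) t \<le> \<phi> (x + 0 *\<^sub>R e) t" if "\<bar>s\<bar> < \<delta>" for s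
    proof -
      have "\<bar>s\<bar> * norm e \<le> \<delta> * (norm e + 1)" using that by (intro mult_mono) auto
      also have "\<dots> = R - norm x" unfolding \<delta>_def using ne by simp
      finally have "norm (x + s *\<^sub>R e) \<le> R" using norm_triangle_ineq[of x "s *\<^sub>R e"] by simp
      then show ?thesis using mx[of "x + s *\<^sub>R e" t] xt by simp
    qed
    from second_derivative_at_max[OF d1 _ \<open>\<delta> > 0\<close> near, of "e \<bullet> (hessian (\<lambda>x. v x t) (x + 0 *\<^sub>R e) *v e) - e \<bullet> (hessian (\<lambda>x. w x t) (x + 0 *\<^sub>R e) *v e)
       - 4 * \<epsilon> * (e \<bullet> e)"] d2
    show ?thesis by simp
  qed
  have "F_pi4 (hessian (\<lambda>x. v x t) x) \<le> F_pi4 (hessian (\<lambda>x. w x t) x) + sqrt 2 * CARD('n) * (4 * \<epsilon>) / \<zeta>\<^sup>2"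
    by (rule F_pi4_mono_shift[OF \<zeta> is_solution_sym[OF v t] is_solution_lower[OF v t] is_solution_sym[OF w t] is_solution_lower[OF w t] _ Q])
       (use \<epsilon> in simp)
  also have "\<dots> = F_pi4 (hessian (\<lambda>x. w x t) x) + 2 * \<epsilon> * (K - 1)" unfolding K_def by simp
  finally have 1: "F_pi4 (hessian (\<lambda>x. v x t) x) - F_pi4 (hessian (\<lambda>x. w x t) x) - 2 * \<epsilon> * K < 0"
    using \<epsilon> by (simp add: algebra_simps)
  have "((\<lambda>s. \<phi> x s) has_real_derivative F_pi4 (hessian (\<lambda>x. v x t) x) - F_pi4 (hessian (\<lambda>x. w x t) x) - 2 * \<epsilon> * K - 0) (at t)"
    unfolding \<phi>_def
    by (intro DERIV_diff DERIV_const is_solution_time[OF v t] is_solution_time[OF w t]) (auto intro!: derivative_eq_intros)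
  then have "0 \<le> F_pi4 (hessian (\<lambda>x. v x t) x) - F_pi4 (hessian (\<lambda>x. w x t) x) - 2 * \<epsilon> * K - 0"
    by (rule derivative_at_left_max[OF _ t]) (use mx xt in auto)
  then show False using 1 by simp
qed

lemma is_solution_unique:
  fixes v w :: "real^'n \<Rightarrow> real \<Rightarrow> real"
  assumes v: "is_solution \<zeta> \<rho> v0 v" and w: "is_solution \<zeta> \<rho> v0 w" and \<zeta>: "0 < \<zeta>" and t: "0 \<le> t"
  shows "v x t = w x t"
proof -
  have le: "v x t \<le> w x t" if v: "is_solution \<zeta> \<rho> v0 v" and w: "is_solution \<zeta> \<rho> v0 w" for v w
  proof (rule field_le_epsilon)
    fix e :: real assume e: "0 < e"
    define B where "B = x \<bullet> x + (2 * sqrt 2 * CARD('n) / \<zeta>\<^sup>2 + 1) * t"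
    have B: "B \<ge> 0" unfolding B_def using \<zeta> t by (intro add_nonneg_nonneg mult_nonneg_nonneg) auto
    define \<epsilon> where "\<epsilon> = e / (2 * (B + 1))"
    have \<epsilon>: "\<epsilon> > 0" unfolding \<epsilon>_def using e B by simp
    have "v x t - w x t \<le> 2 * \<epsilon> * B + 0"
      unfolding B_def using is_solution_comparison[OF v w \<zeta> \<epsilon> _ t, of 0 x] \<epsilon> by simp
    also have "2 * \<epsilon> * B \<le> e"
      unfolding \<epsilon>_def using e B by (simp add: field_simps)
    finally show "v x t \<le> w x t + e" by simp
  qed
  show ?thesis using le[OF v w] le[OF w v] by simp
qed

text \<open>By homogeneity every parabolic rescaling of U has the initial value of U, so uniqueness
  makes U self-similar. The expander equation is then Euler's identity for this scaling combined
  with the evolution equation.\<close>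

lemma self_expander_of_homogeneous:
  fixes U :: "real^'n \<Rightarrow> real \<Rightarrow> real"
  assumes U: "is_solution \<zeta> \<rho> U0 U" and \<zeta>: "0 < \<zeta>"
    and hom: "\<And>r x. 0 < r \<Longrightarrow> U0 (r *\<^sub>R x) = r\<^sup>2 * U0 x"
  shows self_similar: "\<And>r x t. 0 < r \<Longrightarrow> 0 \<le> t \<Longrightarrow> U (r *\<^sub>R x) (r\<^sup>2 * t) = r\<^sup>2 * U x t"
    and "self_expander (\<lambda>x. U x 1)"
proof -
  show ss: "U (r *\<^sub>R x) (r\<^sup>2 * t) = r\<^sup>2 * U x t" if "0 < r" "0 \<le> t" for r x t
  proof -
    have "is_solution \<zeta> \<rho> U0 (\<lambda>x t. U (r *\<^sub>R x) (r\<^sup>2 * t) / r\<^sup>2)"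
      using is_solution_scale[OF U that(1)] that(1) by (simp add: hom)
    from is_solution_unique[OF this U \<zeta> that(2), of x] show ?thesis using that(1) by (simp add: field_simps)
  qed
  have "F_pi4 (hessian (\<lambda>x. U x 1) x) = U x 1 - 1 / 2 * (x \<bullet> gradient (\<lambda>x. U x 1) x)" for x
  proof -
    let ?w = "\<lambda>x. U x 1"
    \<comment> \<open>Self-similarity says U x s = s * ?w (x / sqrt s). Differentiating at s = 1 by
      the product and chain rules gives the right side of the expander equation; the factor -1/2 is
      the derivative of 1 / sqrt s there.\<close>
    have "((\<lambda>s. s * ?w ((1 / sqrt s) *\<^sub>R x)) has_real_derivative
        1 * ?w ((1 / sqrt 1) *\<^sub>R x) + (gradient ?w ((1 / sqrt 1) *\<^sub>R x) \<bullet> ((- 1 / 2) *\<^sub>R x)) * 1) (at 1)"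
    proof (rule DERIV_mult)
      have inner: "((\<lambda>s. (1 / sqrt s) *\<^sub>R x) has_vector_derivative (- 1 / 2) *\<^sub>R x) (at 1)"
        by (intro has_vector_derivative_scaleR[where g = "\<lambda>_. x" and g' = 0, simplified]) (auto intro!: derivative_eq_intros)
      show "((\<lambda>s. ?w ((1 / sqrt s) *\<^sub>R x)) has_real_derivative gradient ?w ((1 / sqrt 1) *\<^sub>R x) \<bullet> ((- 1 / 2) *\<^sub>R x)) (at 1)"
        using vector_derivative_diff_chain_within[OF inner, of ?w "\<lambda>v. gradient ?w ((1 / sqrt 1) *\<^sub>R x) \<bullet> v"]
          has_derivative_gradient[OF partials_differentiableD(1)[OF is_solution_partials[OF U zero_less_one]], of "(1 / sqrt 1) *\<^sub>R x"]
        by (simp add: has_real_derivative_iff_has_vector_derivative comp_def has_derivative_at_withinI)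
    qed (rule DERIV_ident)
    moreover have "((\<lambda>s. s * ?w ((1 / sqrt s) *\<^sub>R x)) has_real_derivative F_pi4 (hessian ?w x)) (at 1)"
    proof (rule has_field_derivative_transform_within_open[OF is_solution_time[OF U zero_less_one]])
      show "U x s = s * ?w ((1 / sqrt s) *\<^sub>R x)" if "s \<in> {0<..}" for s
        using ss[of "sqrt s" 1 "(1 / sqrt s) *\<^sub>R x"] that by simp
    qed auto
    ultimately have "F_pi4 (hessian ?w x) = 1 * ?w ((1 / sqrt 1) *\<^sub>R x) + (gradient ?w ((1 / sqrt 1) *\<^sub>R x) \<bullet> ((- 1 / 2) *\<^sub>R x)) * 1"
      by (rule DERIV_unique[symmetric])
    then show ?thesis by (simp add: inner_commute)
  qed
  then show "self_expander (\<lambda>x. U x 1)"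
    using is_solution_slice_smooth[OF U zero_less_one] unfolding self_expander_def by simp
qed

section \<open>Gradient estimates for the heat equation\<close>

text \<open>Only joint continuity, the pure second derivatives along the axes and the time
  derivative are demanded, without regularity of these derivatives. That is enough for maximum
  arguments, and it is what can be verified directly for the Legendre transform.\<close>

definition heat_solution :: "real \<Rightarrow> (real^'n \<Rightarrow> real \<Rightarrow> real) \<Rightarrow> bool" where
  "heat_solution c h \<longleftrightarrow> continuous_on (UNIV \<times> {0<..}) (\<lambda>(x,t). h x t) \<and>
    (\<exists>p q. \<forall>x. \<forall>t>0. (\<forall>i. ((\<lambda>s. h (x + s *\<^sub>R axis i 1) t) has_real_derivative p i x t) (at 0) \<and>
        ((\<lambda>s. p i (x + s *\<^sub>R axis i 1) t) has_real_derivative q i x t) (at 0)) \<and>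
      ((\<lambda>s. h x s) has_real_derivative c * (\<Sum>i\<in>UNIV. q i x t)) (at t))"

text \<open>Linearity and translation invariance: differences solve the same equation, so a
  first-order estimate can be iterated without differentiating the equation.\<close>

lemma heat_solution_difference:
  assumes "heat_solution c h"
  shows "heat_solution c (\<lambda>x t. h (x + a) t - h x t)"
proof -
  obtain p q where cont: "continuous_on (UNIV \<times> {0<..}) (\<lambda>(x,t). h x t)" and
    pq: "\<And>x t i. 0 < t \<Longrightarrow> ((\<lambda>s. h (x + s *\<^sub>R axis i 1) t) has_real_derivative p i x t) (at 0)"
    "\<And>x t i. 0 < t \<Longrightarrow> ((\<lambda>s. p i (x + s *\<^sub>R axis i 1) t) has_real_derivative q i x t) (at 0)"
    "\<And>x t. 0 < t \<Longrightarrow> ((\<lambda>s. h x s) has_real_derivative c * (\<Sum>i\<in>UNIV. q i x t)) (at t)"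
    using assms unfolding heat_solution_def by blast
  have "continuous_on (UNIV \<times> {0<..}) (\<lambda>z. (\<lambda>(x,t). h x t) (fst z + a, snd z))"
    by (rule continuous_on_compose2[OF cont]) (auto intro!: continuous_intros)
  then have 1: "continuous_on (UNIV \<times> {0<..}) (\<lambda>(x,t). h (x + a) t - h x t)"
    using cont by (simp add: case_prod_unfold continuous_on_diff)
  have 2: "((\<lambda>s. h (x + s *\<^sub>R axis i 1 + a) t - h (x + s *\<^sub>R axis i 1) t) has_real_derivative p i (x + a) t - p i x t) (at 0)"
    "((\<lambda>s. p i (x + s *\<^sub>R axis i 1 + a) t - p i (x + s *\<^sub>R axis i 1) t) has_real_derivative q i (x + a) t - q i x t) (at 0)"
    "((\<lambda>s. h (x + a) s - h x s) has_real_derivative c * (\<Sum>i\<in>UNIV. q i (x + a) t - q i x t)) (at t)"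
    if "0 < t" for x t i
    using DERIV_diff[OF pq(1)[OF that, of "x + a" i] pq(1)[OF that, of x i]]
      DERIV_diff[OF pq(2)[OF that, where x = "x + a" and i = i] pq(2)[OF that, where x = x and i = i]]
      DERIV_diff[OF pq(3)[OF that, of "x + a"] pq(3)[OF that, of x]]
    by (simp_all add: add_ac sum_subtractf right_diff_distrib)
  show ?thesis unfolding heat_solution_def
    by (intro conjI exI[of _ "\<lambda>i x t. p i (x + a) t - p i x t"] exI[of _ "\<lambda>i x t. q i (x + a) t - q i x t"] allI impI 1 2)
qed

lemma heat_solution_minus:
  assumes "heat_solution c h"
  shows "heat_solution c (\<lambda>x t. - h x t)"
proof -
  obtain p q where cont: "continuous_on (UNIV \<times> {0<..}) (\<lambda>(x,t). h x t)" and
    pq: "\<And>x t i. 0 < t \<Longrightarrow> ((\<lambda>s. h (x + s *\<^sub>R axis i 1) t) has_real_derivative p i x t) (at 0)"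
    "\<And>x t i. 0 < t \<Longrightarrow> ((\<lambda>s. p i (x + s *\<^sub>R axis i 1) t) has_real_derivative q i x t) (at 0)"
    "\<And>x t. 0 < t \<Longrightarrow> ((\<lambda>s. h x s) has_real_derivative c * (\<Sum>i\<in>UNIV. q i x t)) (at t)"
    using assms unfolding heat_solution_def by blast
  have 1: "continuous_on (UNIV \<times> {0<..}) (\<lambda>(x,t). - h x t)"
    using cont by (simp add: case_prod_unfold continuous_on_minus)
  have 2: "((\<lambda>s. - h (x + s *\<^sub>R axis i 1) t) has_real_derivative - p i x t) (at 0)"
    "((\<lambda>s. - p i (x + s *\<^sub>R axis i 1) t) has_real_derivative - q i x t) (at 0)"
    "((\<lambda>s. - h x s) has_real_derivative c * (\<Sum>i\<in>UNIV. - q i x t)) (at t)"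
    if "0 < t" for x t i
    using DERIV_minus[OF pq(1)[OF that, of x i]]
      DERIV_minus[OF pq(2)[OF that, where x = x and i = i]]
      DERIV_minus[OF pq(3)[OF that, of x]]
    by (simp_all add: sum_negf)
  show ?thesis unfolding heat_solution_def
    by (intro conjI exI[of _ "\<lambda>i x t. - p i x t"] exI[of _ "\<lambda>i x t. - q i x t"] allI impI 1 2)
qed

definition reflect :: "'n \<Rightarrow> real^'n \<Rightarrow> real^'n" where
  "reflect i z = z - (2 * z $ i) *\<^sub>R axis i 1"

lemma reflect_add_axis:
  "reflect i (z + s *\<^sub>R axis j 1) = reflect i z + ((if j = i then - 1 else 1) * s) *\<^sub>R axis j 1"
  by (auto simp: reflect_def vec_eq_iff axis_def algebra_simps)

text \<open>
  Odd reflection turns the gradient estimate into a boundary estimate on the slab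
  \<open>0 \<le> z $ i \<le> 1\<close>, where a quadratic polynomial decreasing linearly in time is a barrier.
\<close>

lemma heat_solution_reflection_bound:
  fixes h :: "real^'n \<Rightarrow> real \<Rightarrow> real"
  assumes h: "heat_solution c h" and c: "0 < c" and \<tau>: "0 < \<tau>" and t0: "0 < t0"
    and bd: "\<And>x t. t0 \<le> t \<Longrightarrow> \<bar>h x t\<bar> \<le> M" and A: "A = 1 + 1 / (2 * c * \<tau>)"
    and z1: "0 \<le> z1 $ i" "z1 $ i \<le> 1" and t1: "t1 = t0 + \<tau>"
  shows "h (b + z1) t1 - h (b + reflect i z1) t1 \<le> 2 * M * (A * (2 * z1 $ i - (z1 $ i)\<^sup>2))"
proof (rule ccontr)
  define g where "g = (\<lambda>z t. h (b + z) t - h (b + reflect i z) t)"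
  \<comment> \<open>The bound 2 M on g is dominated by B at the initial time and on the face
    \<open>z $ i = 1\<close> (as A >= 1), while g = 0 on the face \<open>z $ i = 0\<close>. The
    summand 1 / (2 c \<tau>) of A makes B a supersolution: its Laplacian pays for the decrease in
    time at rate 2 M / \<tau>. At t1 the time part is gone.\<close>
  define B where "B = (\<lambda>z t. 2 * M * ((t1 - t) / \<tau> + A * (2 * z $ i - (z $ i)\<^sup>2)))"
  \<comment> \<open>N exceeds by one the quantity 2 n c, that is c times the Laplacian of |z|^2;
    hence the penalty \<delta> (|z|^2 + N (t - t0)) is a strict supersolution.\<close>
  define N where "N = 2 * CARD('n) * c + 1"
  assume "\<not> ?thesis"
  then have "g z1 t1 - B z1 t1 > 0" unfolding g_def B_def by simp
  moreover have N0: "N > 0" unfolding N_def using c by (simp add: add_nonneg_pos)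
  \<comment> \<open>So small that the penalty at (z1, t1) uses less than the amount by which the
    claim is violated.\<close>
  moreover define \<delta> where "\<delta> = (g z1 t1 - B z1 t1) / (2 * (z1 \<bullet> z1 + N * \<tau> + 1))"
  have zz: "z1 \<bullet> z1 + N * \<tau> + 1 > 0" using N0 \<tau> by (simp add: add_nonneg_pos)
  ultimately have \<delta>: "\<delta> > 0" unfolding \<delta>_def by simp
  have "\<delta> * (z1 \<bullet> z1 + N * \<tau>) < \<delta> * (2 * (z1 \<bullet> z1 + N * \<tau> + 1))"
  proof -
    have "X < 2 * (X + 1)" if "0 \<le> X" for X :: real using that by simp
    moreover have "0 \<le> z1 \<bullet> z1 + N * \<tau>" using N0 \<tau> by simp
    ultimately show ?thesis using \<delta> by (intro mult_strict_left_mono) blast+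
  qed
  also have "\<dots> = g z1 t1 - B z1 t1" unfolding \<delta>_def using zz by simp
  finally have small: "\<delta> * (z1 \<bullet> z1 + N * \<tau>) < g z1 t1 - B z1 t1" .
  define \<phi> where "\<phi> = (\<lambda>z t. g z t - B z t - \<delta> * (z \<bullet> z + N * (t - t0)))"
  have pos: "\<phi> z1 t1 > 0" using small unfolding \<phi>_def t1 by simp
  have A1: "A \<ge> 1" unfolding A using c \<tau> by simp
  have M: "M \<ge> 0" using bd[OF order_refl, of 0] by simp
  have gM: "g z t \<le> 2 * M" if "t0 \<le> t" for z t
    using bd[OF that, of "b + z"] bd[OF that, of "b + reflect i z"] unfolding g_def by simp
  have sl: "0 \<le> 2 * z $ i - (z $ i)\<^sup>2" if "0 \<le> z $ i" "z $ i \<le> 1" for z :: "real^'n"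
    using that mult_left_mono[OF that(2) that(1)] by (simp add: power2_eq_square)
  define R where "R = norm z1 + 1 + 2 * M / \<delta>"
  define K where "K = cball (0 :: real^'n) R \<inter> {z. 0 \<le> z $ i \<and> z $ i \<le> 1}"
  have "closed {z :: real^'n. 0 \<le> z $ i \<and> z $ i \<le> 1}"
    by (intro closed_Collect_conj closed_Collect_le continuous_intros)
  then have K: "compact K" unfolding K_def by (intro compact_Int_closed compact_cball)
  obtain p q where cont: "continuous_on (UNIV \<times> {0<..}) (\<lambda>(x,t). h x t)" and
    pq: "\<And>x t i. 0 < t \<Longrightarrow> ((\<lambda>s. h (x + s *\<^sub>R axis i 1) t) has_real_derivative p i x t) (at 0)"
    "\<And>x t i. 0 < t \<Longrightarrow> ((\<lambda>s. p i (x + s *\<^sub>R axis i 1) t) has_real_derivative q i x t) (at 0)"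
    "\<And>x t. 0 < t \<Longrightarrow> ((\<lambda>s. h x s) has_real_derivative c * (\<Sum>i\<in>UNIV. q i x t)) (at t)"
    using h unfolding heat_solution_def by blast
  have cg: "continuous_on (K \<times> {t0..t1}) (\<lambda>(z,t). \<phi> z t)"
  proof -
    have "continuous_on (K \<times> {t0..t1}) (\<lambda>w. (\<lambda>(x,t). h x t) (b + fst w, snd w))"
      "continuous_on (K \<times> {t0..t1}) (\<lambda>w. (\<lambda>(x,t). h x t) (b + reflect i (fst w), snd w))"
      unfolding reflect_def
      by (rule continuous_on_compose2[OF cont]; use t0 in \<open>auto intro!: continuous_intros\<close>)+
    then show ?thesis unfolding \<phi>_def g_def B_def case_prod_unfold using \<tau>
      by (auto intro!: continuous_intros)
  qed
  have z1K: "z1 \<in> K" unfolding K_def R_def using z1 M \<delta> by simp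
  have t01: "t0 \<le> t1" using t1 \<tau> by simp
  obtain z t where zt: "z \<in> K" "t0 \<le> t" "t \<le> t1" "\<phi> z1 t1 \<le> \<phi> z t"
    and mx: "\<And>y s. y \<in> K \<Longrightarrow> t0 \<le> s \<Longrightarrow> s \<le> t1 \<Longrightarrow> \<phi> y s \<le> \<phi> z t"
    using parabolic_maximum[OF K cg z1K t01 order_refl] by blast
  have px: "\<phi> z t > 0" using zt(4) pos by simp
  have t': "0 < t" using t0 zt by simp
  have zi: "0 \<le> z $ i" "z $ i \<le> 1" using zt(1) unfolding K_def by auto
  have Nt: "0 \<le> \<delta> * (z \<bullet> z + N * (t - t0))" using \<delta> N0 zt by simp
  have gB: "g z t - B z t > \<delta> * (z \<bullet> z)"
  proof -
    have "0 \<le> \<delta> * (N * (t - t0))" using \<delta> N0 zt by simp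
    then show ?thesis using px unfolding \<phi>_def by (simp add: distrib_left)
  qed
  have gB0: "g z t > B z t" using px Nt unfolding \<phi>_def by linarith
  have Bge: "B z t \<ge> 2 * M * ((t1 - t) / \<tau>)" "B z t \<ge> 2 * M * (A * (2 * z $ i - (z $ i)\<^sup>2))"
  proof -
    have "0 \<le> A * (2 * z $ i - (z $ i)\<^sup>2)" using A1 sl[OF zi] by (intro mult_nonneg_nonneg) auto
    moreover have "0 \<le> (t1 - t) / \<tau>" using \<tau> zt by simp
    ultimately show "B z t \<ge> 2 * M * ((t1 - t) / \<tau>)" "B z t \<ge> 2 * M * (A * (2 * z $ i - (z $ i)\<^sup>2))"
      unfolding B_def using M by (auto intro!: mult_left_mono simp del: times_divide_eq_right)
  qed
  have tgt: "t0 < t"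
  proof (rule ccontr)
    assume "\<not> t0 < t"
    then have "(t1 - t) / \<tau> = 1" using zt t1 \<tau> by simp
    then show False using Bge(1) gB0 gM[OF zt(2), of z] by simp
  qed
  have zi0: "0 < z $ i"
  proof (rule ccontr)
    assume "\<not> 0 < z $ i"
    then have "z $ i = 0" using zi by simp
    then have "g z t = 0" unfolding g_def reflect_def by simp
    moreover have "0 \<le> 2 * M * ((t1 - t) / \<tau>)" using M zt \<tau> by simp
    ultimately show False using Bge(1) gB0 by simp
  qed
  have zi1: "z $ i < 1"
  proof (rule ccontr)
    assume "\<not> z $ i < 1"
    then have "z $ i = 1" using zi by simp
    then have "2 * M * A \<le> B z t" using Bge(2) by simp
    moreover have "2 * M * 1 \<le> 2 * M * A" using A1 M by (intro mult_left_mono) auto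
    ultimately show False using gB0 gM[OF zt(2), of z] by simp
  qed
  have zR: "norm z < R"
  proof (rule ccontr)
    assume "\<not> norm z < R"
    moreover have R: "R \<ge> 1" "R \<ge> 2 * M / \<delta>" unfolding R_def using M \<delta> by auto
    ultimately have "R * 1 \<le> norm z * norm z" by (intro mult_mono) auto
    then have "2 * M / \<delta> \<le> z \<bullet> z" using R by (simp add: dot_square_norm power2_eq_square)
    then have "2 * M \<le> \<delta> * (z \<bullet> z)" using \<delta> by (simp add: field_simps)
    moreover have "0 \<le> 2 * M * ((t1 - t) / \<tau>)" using M zt \<tau> by simp
    then have "0 \<le> B z t" using Bge(1) by linarith
    ultimately show False using gB gM[OF zt(2), of z] by simp
  qed
  \<comment> \<open>Along axis j the reflected point moves with sign \<sigma>. The sign enters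
    squared in the second derivative, so the reflected term keeps its form. The barrier contributes
    only for j = i.\<close>
  have second: "q j (b + z) t - q j (b + reflect i z) t + (if j = i then 4 * M * A else 0) - 2 * \<delta> \<le> 0" for j
  proof -
    define \<sigma> :: real where "\<sigma> = (if j = i then - 1 else 1)"
    define \<kappa> :: real where "\<kappa> = (if j = i then 1 else 0)"
    have \<sigma>2: "\<sigma> * \<sigma> = 1" unfolding \<sigma>_def by simp
    let ?e = "axis j 1 :: real^'n"
    have line: "\<phi> (z + s *\<^sub>R ?e) t = h (b + z + s *\<^sub>R ?e) t - h (b + reflect i z + (\<sigma> * s) *\<^sub>R ?e) t
      - 2 * M * ((t1 - t) / \<tau> + A * (2 * (z $ i + \<kappa> * s) - (z $ i + \<kappa> * s)\<^sup>2))
      - \<delta> * (z \<bullet> z + 2 * s * z $ j + s\<^sup>2 + N * (t - t0))" for s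
    proof -
      have 1: "(z + s *\<^sub>R ?e) \<bullet> (z + s *\<^sub>R ?e) = z \<bullet> z + 2 * s * z $ j + s\<^sup>2"
        by (simp add: inner_add_left inner_add_right inner_axis inner_axis' power2_eq_square distrib_left)
      have 2: "(z + s *\<^sub>R ?e) $ i = z $ i + \<kappa> * s"
        by (simp add: \<kappa>_def axis_def)
      show ?thesis
        unfolding \<phi>_def g_def B_def reflect_add_axis 1 2 \<sigma>_def[symmetric] by (simp only: add.assoc)
    qed
    have D1: "((\<lambda>s. h (y + (a * s) *\<^sub>R ?e) t) has_real_derivative a * p j (y + (a * s) *\<^sub>R ?e) t) (at s)" for y s a
    proof -
      have "((\<lambda>r. h (y + (a * s) *\<^sub>R ?e + r *\<^sub>R ?e) t) has_real_derivative p j (y + (a * s) *\<^sub>R ?e) t) (at 0)"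
        by (rule pq(1)[OF t'])
      then have "((\<lambda>r. h (y + r *\<^sub>R ?e) t) has_real_derivative p j (y + (a * s) *\<^sub>R ?e) t) (at (0 + a * s))"
        by (subst DERIV_shift) (simp add: algebra_simps)
      then have 1: "((\<lambda>r. h (y + r *\<^sub>R ?e) t) has_real_derivative p j (y + (a * s) *\<^sub>R ?e) t) (at (a * s))" by simp
      have "((\<lambda>s. a * s) has_real_derivative a) (at s)" by (auto intro!: derivative_eq_intros)
      from DERIV_chain2[OF 1 this] show ?thesis by (simp add: mult.commute)
    qed
    have D2: "((\<lambda>s. a * p j (y + (a * s) *\<^sub>R ?e) t) has_real_derivative a * (q j y t * a)) (at 0)" for y a
    proof -
      have 1: "((\<lambda>s. p j (y + s *\<^sub>R ?e) t) has_real_derivative q j y t) (at (a * 0))"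
        using pq(2)[OF t'] by simp
      have 2: "((\<lambda>s. a * s) has_real_derivative a) (at 0)" by (auto intro!: derivative_eq_intros)
      show ?thesis by (intro DERIV_cmult DERIV_chain2[OF 1 2])
    qed
    let ?f' = "\<lambda>s. 1 * p j (b + z + (1 * s) *\<^sub>R ?e) t - \<sigma> * p j (b + reflect i z + (\<sigma> * s) *\<^sub>R ?e) t
      - 2 * M * (A * (2 * \<kappa> - 2 * \<kappa> * (z $ i + \<kappa> * s))) - \<delta> * (2 * z $ j + 2 * s)"
    have d1: "((\<lambda>s. \<phi> (z + s *\<^sub>R ?e) t) has_real_derivative ?f' s) (at s)" for s
      unfolding line
    proof (intro DERIV_diff)
      show "((\<lambda>s. h (b + z + s *\<^sub>R ?e) t) has_real_derivative 1 * p j (b + z + (1 * s) *\<^sub>R ?e) t) (at s)"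
        using D1[of "b + z" 1 s] by simp
      show "((\<lambda>s. 2 * M * ((t1 - t) / \<tau> + A * (2 * (z $ i + \<kappa> * s) - (z $ i + \<kappa> * s)\<^sup>2))) has_real_derivative
        2 * M * (A * (2 * \<kappa> - 2 * \<kappa> * (z $ i + \<kappa> * s)))) (at s)"
        by (auto intro!: derivative_eq_intros simp: algebra_simps)
      show "((\<lambda>s. \<delta> * (z \<bullet> z + 2 * s * z $ j + s\<^sup>2 + N * (t - t0))) has_real_derivative \<delta> * (2 * z $ j + 2 * s)) (at s)"
        by (auto intro!: derivative_eq_intros)
    qed (rule D1)
    have d2: "(?f' has_real_derivative 1 * (q j (b + z) t * 1) - \<sigma> * (q j (b + reflect i z) t * \<sigma>)
       - 2 * M * (A * (- 2 * \<kappa> * \<kappa>)) - \<delta> * 2) (at 0)"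
    proof (intro DERIV_diff D2)
      show "((\<lambda>s. 2 * M * (A * (2 * \<kappa> - 2 * \<kappa> * (z $ i + \<kappa> * s)))) has_real_derivative 2 * M * (A * (- 2 * \<kappa> * \<kappa>))) (at 0)"
        by (auto intro!: derivative_eq_intros)
      show "((\<lambda>s. \<delta> * (2 * z $ j + 2 * s)) has_real_derivative \<delta> * 2) (at 0)"
        by (auto intro!: derivative_eq_intros)
    qed
    define \<eta> where "\<eta> = min (R - norm z) (min (z $ i) (1 - z $ i))"
    have \<eta>: "0 < \<eta>" unfolding \<eta>_def using zR zi0 zi1 by simp
    have near: "\<phi> (z + s *\<^sub>R ?e) t \<le> \<phi> (z + 0 *\<^sub>R ?e) t" if "\<bar>s\<bar> < \<eta>" for s
    proof -
      have "norm (z + s *\<^sub>R ?e) \<le> R"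
        using norm_triangle_ineq[of z "s *\<^sub>R ?e"] that unfolding \<eta>_def by simp
      moreover have "0 \<le> (z + s *\<^sub>R ?e) $ i \<and> (z + s *\<^sub>R ?e) $ i \<le> 1"
        using that zi unfolding \<eta>_def axis_def by (auto simp: abs_less_iff)
      ultimately have "z + s *\<^sub>R ?e \<in> K" unfolding K_def by simp
      then show ?thesis using mx zt by simp
    qed
    have "1 * (q j (b + z) t * 1) - \<sigma> * (q j (b + reflect i z) t * \<sigma>)
       - 2 * M * (A * (- 2 * \<kappa> * \<kappa>)) - \<delta> * 2 \<le> 0"
      by (rule second_derivative_at_max[OF d1 d2 \<eta> near])
    then show ?thesis unfolding \<sigma>_def \<kappa>_def by (simp split: if_splits)
  qed
  have "(\<Sum>j\<in>UNIV. q j (b + z) t - q j (b + reflect i z) t + (if j = i then 4 * M * A else 0) - 2 * \<delta>) \<le> 0"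
    by (rule sum_nonpos) (use second in blast)
  then have S: "(\<Sum>j\<in>UNIV. q j (b + z) t - q j (b + reflect i z) t) + 4 * M * A - 2 * \<delta> * CARD('n) \<le> 0"
    by (simp add: sum.distrib sum_subtractf mult.commute mult.left_commute)
  have "((\<lambda>s. \<phi> z s) has_real_derivative
     c * (\<Sum>j\<in>UNIV. q j (b + z) t) - c * (\<Sum>j\<in>UNIV. q j (b + reflect i z) t) - 2 * M * (- 1 / \<tau>) - \<delta> * N) (at t)"
    unfolding \<phi>_def g_def
  proof (intro DERIV_diff pq(3)[OF t'])
    show "((\<lambda>s. B z s) has_real_derivative 2 * M * (- 1 / \<tau>)) (at t)"
      unfolding B_def using \<tau> by (auto intro!: derivative_eq_intros)
    show "((\<lambda>s. \<delta> * (z \<bullet> z + N * (s - t0))) has_real_derivative \<delta> * N) (at t)"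
      by (auto intro!: derivative_eq_intros)
  qed
  then have "0 \<le> c * (\<Sum>j\<in>UNIV. q j (b + z) t) - c * (\<Sum>j\<in>UNIV. q j (b + reflect i z) t) - 2 * M * (- 1 / \<tau>) - \<delta> * N"
    by (rule derivative_at_left_max[of _ _ _ "t - t0"]) (use tgt mx zt in auto)
  then have "0 \<le> c * (\<Sum>j\<in>UNIV. q j (b + z) t - q j (b + reflect i z) t) + 2 * M / \<tau> - \<delta> * N"
    by (simp add: sum_subtractf right_diff_distrib)
  moreover have "c * (\<Sum>j\<in>UNIV. q j (b + z) t - q j (b + reflect i z) t) \<le> c * (2 * \<delta> * CARD('n) - 4 * M * A)"
    using S c by (intro mult_left_mono) auto
  moreover have "c * (4 * M * A) \<ge> 2 * M / \<tau>"
  proof -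
    have "c * (4 * M * A) = 4 * M * c + 2 * M / \<tau>" unfolding A using c \<tau> by (simp add: field_simps)
    then show ?thesis using M c by simp
  qed
  ultimately show False using \<delta> unfolding N_def by (simp add: algebra_simps)
qed

text \<open>The two points are placed symmetrically about their midpoint x + z, so that one is the
  reflection of the other. The slab has width one, which covers steps a <= 2; for larger a the bound
  2 M <= M a suffices. The reflection estimate is started at time t - \<tau>, which is at least
  t0.\<close>

lemma heat_solution_lipschitz:
  fixes h :: "real^'n \<Rightarrow> real \<Rightarrow> real"
  assumes h: "heat_solution c h" and c: "0 < c" and \<tau>: "0 < \<tau>" and t0: "0 < t0"
    and bd: "\<And>x t. t0 \<le> t \<Longrightarrow> \<bar>h x t\<bar> \<le> M" and t: "t0 + \<tau> \<le> t"
  shows "\<bar>h (x + a *\<^sub>R axis i 1) t - h x t\<bar> \<le> 2 * (1 + 1 / (2 * c * \<tau>)) * M * \<bar>a\<bar>"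
proof -
  define A where "A = 1 + 1 / (2 * c * \<tau>)"
  have A1: "A \<ge> 1" unfolding A_def using c \<tau> by simp
  have M: "M \<ge> 0" using bd[OF order_refl, of 0] by simp
  have half: "h (x + a *\<^sub>R axis i 1) t - h x t \<le> 2 * A * M * a"
    if h: "heat_solution c h" and bd: "\<And>x t. t0 \<le> t \<Longrightarrow> \<bar>h x t\<bar> \<le> M" and a: "0 \<le> a" for h x a
  proof (cases "a \<le> 2")
    case True
    define z where "z = (a / 2) *\<^sub>R (axis i 1 :: real^'n)"
    have zi: "z $ i = a / 2" unfolding z_def by simp
    have "t0 \<le> t - \<tau>" using t by simp
    then have "h ((x + z) + z) t - h ((x + z) + reflect i z) t \<le> 2 * M * (A * (2 * z $ i - (z $ i)\<^sup>2))"
      using t t0 bd a True by (intro heat_solution_reflection_bound[OF h c \<tau>, of "t - \<tau>" M A]) (auto simp: A_def zi)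
    moreover have zz: "z + z = a *\<^sub>R axis i 1" unfolding z_def by (metis field_sum_of_halves scaleR_add_left)
    have "(x + z) + z = x + a *\<^sub>R axis i 1" by (simp only: add.assoc zz)
    moreover have "(x + z) + reflect i z = x + (z + z) - (2 * (a / 2)) *\<^sub>R axis i 1"
      unfolding reflect_def zi by (simp only: add_diff_eq add.assoc)
    then have "(x + z) + reflect i z = x" unfolding zz by simp
    ultimately have "h (x + a *\<^sub>R axis i 1) t - h x t \<le> 2 * M * (A * (2 * z $ i - (z $ i)\<^sup>2))" by simp
    also have "\<dots> \<le> 2 * M * (A * a)"
      using M A1 by (intro mult_left_mono) (auto simp: zi)
    finally show ?thesis by (simp add: algebra_simps)
  next
    case False
    have "h (x + a *\<^sub>R axis i 1) t - h x t \<le> M * 2"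
      using bd[of t "x + a *\<^sub>R axis i 1"] bd[of t x] t \<tau> by simp
    also have "\<dots> \<le> M * a" using False M by (intro mult_left_mono) auto
    also have "\<dots> \<le> (2 * A) * (M * a)" using A1 M a mult_right_mono[of 1 "2 * A" "M * a"] by simp
    finally show ?thesis by (simp add: mult.assoc)
  qed
  have both: "\<bar>h (x + a *\<^sub>R axis i 1) t - h x t\<bar> \<le> 2 * A * M * a" if "0 \<le> a" for x a
    using half[OF h bd that, of x] half[OF heat_solution_minus[OF h] _ that, of x] bd by (simp add: abs_le_iff)
  show ?thesis
  proof (cases "0 \<le> a")
    case True
    then show ?thesis using both[OF True, of x] unfolding A_def by simp
  next
    case False
    then show ?thesis using both[of "- a" "x + a *\<^sub>R axis i 1"] unfolding A_def by (simp add: abs_minus_commute)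
  qed
qed

text \<open>A pair holds an axis and a step length. The difference is not divided by the step, so
  iterated differences are plain folds and the bounds carry the product of the step lengths.\<close>

definition fdiff :: "'n \<times> real \<Rightarrow> (real^'n \<Rightarrow> real) \<Rightarrow> real^'n \<Rightarrow> real" where
  "fdiff d f = (\<lambda>x. f (x + snd d *\<^sub>R axis (fst d) 1) - f x)"

lemma fdiff_apply: "fdiff d f x = f (x + snd d *\<^sub>R axis (fst d) 1) - f x"
  by (simp add: fdiff_def)

lemma heat_solution_foldr_fdiff:
  "heat_solution c h \<Longrightarrow> heat_solution c (\<lambda>x t. foldr fdiff ds (\<lambda>x. h x t) x)"
proof (induction ds)
  case (Cons d ds)
  then show ?case
    using heat_solution_difference[of c "\<lambda>x t. foldr fdiff ds (\<lambda>x. h x t) x" "snd d *\<^sub>R axis (fst d) 1"]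
    by (simp add: fdiff_apply[of d])
qed simp

text \<open>C is chosen before h and depends only on c, L, \<tau> and k. Each further order spends
  half of the waiting time: the bound of order k + 2 holds from \<tau> / 2 on, and the Lipschitz
  estimate for these differences needs another \<tau> / 2.\<close>

lemma heat_solution_iterated_difference_bound:
  fixes c L :: real
  assumes c: "0 < c" and L: "0 \<le> L" and "0 < \<tau>"
  shows "\<exists>C\<ge>0. \<forall>h :: real^'n \<Rightarrow> real \<Rightarrow> real. heat_solution c h \<longrightarrow>
     (\<forall>t>0. \<forall>x d e. \<bar>foldr fdiff [d, e] (\<lambda>x. h x t) x\<bar> \<le> L * \<bar>snd d\<bar> * \<bar>snd e\<bar>) \<longrightarrow>
     (\<forall>t\<ge>\<tau>. \<forall>x ds. length ds = k + 2 \<longrightarrow> \<bar>foldr fdiff ds (\<lambda>x. h x t) x\<bar> \<le> C * (\<Prod>d\<leftarrow>ds. \<bar>snd d\<bar>))"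
  using assms(3)
proof (induction k arbitrary: \<tau>)
  case 0
  have "\<exists>d e. ds = [d, e]" if "length ds = 0 + 2" for ds :: "('n \<times> real) list"
    using that by (auto simp: length_Suc_conv numeral_2_eq_2)
  then show ?case using L 0 by (intro exI[of _ L]) (fastforce simp: mult.assoc)
next
  case (Suc k)
  then have \<tau>: "0 < \<tau> / 2" by simp
  obtain C where C0: "C \<ge> 0" and C: "\<And>h t x ds. heat_solution c h \<Longrightarrow>
     (\<forall>t>0. \<forall>x d e. \<bar>foldr fdiff [d, e] (\<lambda>x. (h :: real^'n \<Rightarrow> real \<Rightarrow> real) x t) x\<bar> \<le> L * \<bar>snd d\<bar> * \<bar>snd e\<bar>) \<Longrightarrow>
     \<tau> / 2 \<le> t \<Longrightarrow> length ds = k + 2 \<Longrightarrow> \<bar>foldr fdiff ds (\<lambda>x. h x t) x\<bar> \<le> C * (\<Prod>d\<leftarrow>ds. \<bar>snd d\<bar>)"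
    using Suc.IH[OF \<tau>] by metis
  define C' where "C' = 2 * (1 + 1 / (2 * c * (\<tau> / 2))) * C"
  have "C' \<ge> 0" unfolding C'_def using c \<tau> C0 by simp
  moreover have "\<bar>foldr fdiff ds (\<lambda>x. h x t) x\<bar> \<le> C' * (\<Prod>d\<leftarrow>ds. \<bar>snd d\<bar>)"
    if h: "heat_solution c h" and bd: "\<forall>t>0. \<forall>x d e. \<bar>foldr fdiff [d, e] (\<lambda>x. h x t) x\<bar> \<le> L * \<bar>snd d\<bar> * \<bar>snd e\<bar>"
      and t: "\<tau> \<le> t" and ds: "length ds = Suc k + 2" for h t x and ds :: "('n \<times> real) list"
  proof -
    obtain d es where ds': "ds = d # es" "length es = k + 2" using ds by (cases ds) auto
    have "\<bar>foldr fdiff es (\<lambda>x. h x t) (x + snd d *\<^sub>R axis (fst d) 1) - foldr fdiff es (\<lambda>x. h x t) x\<bar>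
       \<le> 2 * (1 + 1 / (2 * c * (\<tau> / 2))) * (C * (\<Prod>d\<leftarrow>es. \<bar>snd d\<bar>)) * \<bar>snd d\<bar>"
      by (rule heat_solution_lipschitz[OF heat_solution_foldr_fdiff[OF h] c \<tau> \<tau> C[OF h bd _ ds'(2)]])
         (use t in auto)
    then show ?thesis unfolding ds' C'_def by (simp add: fdiff_def algebra_simps)
  qed
  ultimately show ?case by blast
qed

lemma tendsto_foldr_fdiff:
  assumes "\<And>x. ((\<lambda>a. G a x) \<longlongrightarrow> g x) F"
  shows "((\<lambda>a. foldr fdiff ds (G a) x) \<longlongrightarrow> foldr fdiff ds g x) F"
  by (induction ds arbitrary: x) (auto simp: fdiff_def intro!: tendsto_diff assms)

lemma foldr_fdiff_divide:
  "foldr fdiff ds (\<lambda>x. f x / a) x = foldr fdiff ds f x / a"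
  by (induction ds arbitrary: x) (auto simp: fdiff_def diff_divide_distrib)

text \<open>Differences are exchanged for derivatives one at a time, whence the generalization to
  mixed expressions with \<open>ds\<close> and \<open>is\<close>. The new difference in direction i
  with step a acts innermost; dividing by a removes its factor from the bound and a tends to
  0.\<close>

lemma iter_partial_bound_of_differences:
  fixes f :: "real^'n \<Rightarrow> real"
  assumes f: "partials_differentiable f"
    and bd: "\<And>ds x. length ds = k \<Longrightarrow> \<bar>foldr fdiff ds f x\<bar> \<le> C * (\<Prod>d\<leftarrow>ds. \<bar>snd d\<bar>)"
  shows "length is = k \<Longrightarrow> \<bar>iter_partial is f x\<bar> \<le> C"
proof -
  have "\<bar>foldr fdiff ds (iter_partial is f) x\<bar> \<le> C * (\<Prod>d\<leftarrow>ds. \<bar>snd d\<bar>)"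
    if "length ds + length is = k" for ds "is" x
    using that
  proof (induction "is" arbitrary: ds x)
    case Nil
    then show ?case using bd by simp
  next
    case (Cons i js)
    let ?g = "iter_partial js f"
    have "((\<lambda>a. foldr fdiff ds (\<lambda>x. (?g (x + a *\<^sub>R axis i 1) - ?g x) / a) x) \<longlongrightarrow> foldr fdiff ds (partial i ?g) x) (at 0)"
    proof (rule tendsto_foldr_fdiff)
      fix x
      have "?g differentiable (at (x + 0 *\<^sub>R axis i 1))" using f unfolding partials_differentiable_def by blast
      from has_real_derivative_along_axis[OF this]
      show "((\<lambda>a. (?g (x + a *\<^sub>R axis i 1) - ?g x) / a) \<longlongrightarrow> partial i ?g x) (at 0)"
        by (simp add: DERIV_def)
    qed
    then have "((\<lambda>a. \<bar>foldr fdiff ds (\<lambda>x. (?g (x + a *\<^sub>R axis i 1) - ?g x) / a) x\<bar>) \<longlongrightarrow> \<bar>foldr fdiff ds (partial i ?g) x\<bar>) (at 0)"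
      by (rule tendsto_rabs)
    moreover have "\<forall>\<^sub>F a in at 0. \<bar>foldr fdiff ds (\<lambda>x. (?g (x + a *\<^sub>R axis i 1) - ?g x) / a) x\<bar> \<le> C * (\<Prod>d\<leftarrow>ds. \<bar>snd d\<bar>)"
    proof (rule eventually_at_filter[THEN iffD2], rule always_eventually, intro allI impI)
      fix a :: real assume a: "a \<noteq> 0"
      have "\<bar>foldr fdiff (ds @ [(i, a)]) ?g x\<bar> \<le> C * (\<Prod>d\<leftarrow>ds @ [(i, a)]. \<bar>snd d\<bar>)"
        using Cons.prems by (intro Cons.IH) auto
      moreover have "foldr fdiff ds (\<lambda>x. (?g (x + a *\<^sub>R axis i 1) - ?g x) / a) x = foldr fdiff (ds @ [(i, a)]) ?g x / a"
        unfolding foldr_fdiff_divide by (simp add: fdiff_def)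
      ultimately show "\<bar>foldr fdiff ds (\<lambda>x. (?g (x + a *\<^sub>R axis i 1) - ?g x) / a) x\<bar> \<le> C * (\<Prod>d\<leftarrow>ds. \<bar>snd d\<bar>)"
        using a by (simp add: divide_le_eq mult.assoc)
    qed
    ultimately have "\<bar>foldr fdiff ds (partial i ?g) x\<bar> \<le> C * (\<Prod>d\<leftarrow>ds. \<bar>snd d\<bar>)"
      by (rule tendsto_upperbound) simp
    then show ?case by simp
  qed
  from this[of "[]" "is"] show "length is = k \<Longrightarrow> \<bar>iter_partial is f x\<bar> \<le> C" by simp
qed

section \<open>Derivatives of inverse gradient maps\<close>

lemma partial_mult:
  assumes "f differentiable (at x)" "g differentiable (at x)"
  shows "partial i (\<lambda>x. f x * g x) x = partial i f x * g x + f x * partial i g x"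
  using partial_eqI[OF has_derivative_mult[OF assms[unfolded frechet_derivative_works]], of i]
  by (simp add: partial_def)

lemma partial_minus:
  assumes "f differentiable (at x)"
  shows "partial i (\<lambda>x. - f x) x = - partial i f x"
  using partial_eqI[OF has_derivative_minus[OF assms[unfolded frechet_derivative_works]], of i]
  by (simp add: partial_def)

lemma partial_sum:
  assumes "\<And>k. k \<in> K \<Longrightarrow> f k differentiable (at x)"
  shows "partial i (\<lambda>x. \<Sum>k\<in>K. f k x) x = (\<Sum>k\<in>K. partial i (f k) x)"
  using partial_eqI[OF has_derivative_sum[OF assms[unfolded frechet_derivative_works]], where i = i]
  by (simp add: partial_def)

lemma partial_compose:
  fixes f :: "real^'n \<Rightarrow> real" and Y :: "real^'n \<Rightarrow> real^'n"
  assumes Y: "(Y has_derivative (\<lambda>h. \<chi> a. \<Sum>c\<in>UNIV. q a c * h $ c)) (at y)"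
    and f: "f differentiable (at (Y y))"
  shows "(\<lambda>y. f (Y y)) differentiable (at y)"
    and "partial i (\<lambda>y. f (Y y)) y = (\<Sum>a\<in>UNIV. partial a f (Y y) * q a i)"
proof -
  note D = has_derivative_compose[OF Y has_derivative_gradient[OF f]]
  show "(\<lambda>y. f (Y y)) differentiable (at y)" using D unfolding differentiable_def by blast
  have "(\<Sum>c\<in>UNIV. q a c * axis i 1 $ c) = q a i" for a
    by (simp add: axis_def mult_delta_right)
  then show "partial i (\<lambda>y. f (Y y)) y = (\<Sum>a\<in>UNIV. partial a f (Y y) * q a i)"
    using partial_eqI[OF D, of i] by (simp add: inner_vec_def)
qed

lemma differentiable_det:
  fixes A :: "real^'m \<Rightarrow> real^'n^'n"
  assumes "\<And>i j. (\<lambda>y. A y $ i $ j) differentiable (at y)"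
  shows "(\<lambda>y. det (A y)) differentiable (at y)"
proof -
  have "(\<lambda>y. \<Prod>i\<in>K. A y $ i $ p i) differentiable (at y)" for p and K :: "'n set"
    by (induction K rule: infinite_finite_induct) (auto intro!: differentiable_mult assms)
  then show ?thesis unfolding det_def by (intro differentiable_sum differentiable_mult) auto
qed

text \<open>
  Here \<open>q\<close> is the inverse of the Hessian of \<open>f\<close> along \<open>Y\<close>, and \<open>Y\<close> is the local inverse of the
  gradient of \<open>f\<close>. The algebra generated by the entries of \<open>q\<close> and by the derivatives of \<open>f\<close> of
  order at least two along \<open>Y\<close> is closed under partial derivatives, because
  \<open>\<partial>\<^sub>d q = - q (\<partial>\<^sub>d (D\<^sup>2 f \<circ> Y)) q\<close>. Index families are used to obtain uniform bounds.
\<close>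

locale inverse_hessian_family =
  fixes I :: "'v set" and f :: "'v \<Rightarrow> real^'n \<Rightarrow> real" and Y :: "'v \<Rightarrow> real^'n \<Rightarrow> real^'n"
    and q :: "'v \<Rightarrow> 'n \<Rightarrow> 'n \<Rightarrow> real^'n \<Rightarrow> real"
  assumes smooth: "v \<in> I \<Longrightarrow> partials_differentiable (f v)"
    and Y_derivative: "v \<in> I \<Longrightarrow> (Y v has_derivative (\<lambda>h. \<chi> a. \<Sum>c\<in>UNIV. q v a c y * h $ c)) (at y)"
    and q_differentiable: "v \<in> I \<Longrightarrow> q v a b differentiable (at y)"
    and left_inverse: "v \<in> I \<Longrightarrow> (\<Sum>a\<in>UNIV. q v e a y * partial a (partial b (f v)) (Y v y)) = (if e = b then 1 else 0)"
    and right_inverse: "v \<in> I \<Longrightarrow> (\<Sum>b\<in>UNIV. partial a (partial b (f v)) (Y v y) * q v b c y) = (if a = c then 1 else 0)"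
begin

inductive alg :: "('v \<Rightarrow> real^'n \<Rightarrow> real) \<Rightarrow> bool" where
  alg_q: "alg (\<lambda>v. q v a b)"
| alg_f: "2 \<le> length is \<Longrightarrow> alg (\<lambda>v y. iter_partial is (f v) (Y v y))"
| alg_zero: "alg (\<lambda>v y. 0)"
| alg_add: "alg g \<Longrightarrow> alg h \<Longrightarrow> alg (\<lambda>v y. g v y + h v y)"
| alg_minus: "alg g \<Longrightarrow> alg (\<lambda>v y. - g v y)"
| alg_mult: "alg g \<Longrightarrow> alg h \<Longrightarrow> alg (\<lambda>v y. g v y * h v y)"

lemma alg_sum: "(\<And>k. k \<in> K \<Longrightarrow> alg (g k)) \<Longrightarrow> alg (\<lambda>v y. \<Sum>k\<in>K. g k v y)"
  by (induction K rule: infinite_finite_induct) (auto intro: alg_zero alg_add)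

lemma partial_f:
  assumes "v \<in> I"
  shows "(\<lambda>y. iter_partial js (f v) (Y v y)) differentiable (at y)"
    "partial i (\<lambda>y. iter_partial js (f v) (Y v y)) y = (\<Sum>a\<in>UNIV. iter_partial (a # js) (f v) (Y v y) * q v a i y)"
  using partial_compose[OF Y_derivative[OF assms]] smooth[OF assms] unfolding partials_differentiable_def by auto

text \<open>Differentiate M q = I, the right inverse identity, then multiply by q from the left and
  cancel with the left inverse identity.\<close>

lemma partial_q:
  assumes v: "v \<in> I"
  shows "partial d (q v e c) y = - (\<Sum>a\<in>UNIV. \<Sum>b\<in>UNIV. q v e a y *
      (\<Sum>k\<in>UNIV. iter_partial [k, a, b] (f v) (Y v y) * q v k d y) * q v b c y)"
proof -
  define M where "M = (\<lambda>a b y. partial a (partial b (f v)) (Y v y))"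
  have M: "M a b differentiable (at y)"
    and dM: "partial d (M a b) y = (\<Sum>k\<in>UNIV. iter_partial [k, a, b] (f v) (Y v y) * q v k d y)" for a b
    using partial_f[OF v, where js = "[a, b]"] unfolding M_def by simp_all
  note qd = q_differentiable[OF v]
  have 0: "(\<Sum>b\<in>UNIV. partial d (M a b) y * q v b c y + M a b y * partial d (q v b c) y) = 0" for a
  proof -
    have "(\<lambda>y. \<Sum>b\<in>UNIV. M a b y * q v b c y) = (\<lambda>y. if a = c then 1 else 0)"
      unfolding M_def by (rule ext) (rule right_inverse[OF v])
    then have "partial d (\<lambda>y. \<Sum>b\<in>UNIV. M a b y * q v b c y) y = 0" by (simp add: partial_const)
    moreover have "partial d (\<lambda>y. \<Sum>b\<in>UNIV. M a b y * q v b c y) y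
       = (\<Sum>b\<in>UNIV. partial d (\<lambda>y. M a b y * q v b c y) y)"
      by (rule partial_sum) (intro differentiable_mult M qd)
    ultimately show ?thesis by (simp add: partial_mult[OF M qd])
  qed
  have "0 = (\<Sum>a\<in>UNIV. q v e a y * (\<Sum>b\<in>UNIV. partial d (M a b) y * q v b c y + M a b y * partial d (q v b c) y))"
    unfolding 0 by simp
  also have "\<dots> = (\<Sum>a\<in>UNIV. \<Sum>b\<in>UNIV. q v e a y * partial d (M a b) y * q v b c y)
     + (\<Sum>a\<in>UNIV. \<Sum>b\<in>UNIV. q v e a y * M a b y * partial d (q v b c) y)"
    by (simp add: sum_distrib_left sum.distrib distrib_left mult.assoc)
  also have "(\<Sum>a\<in>UNIV. \<Sum>b\<in>UNIV. q v e a y * M a b y * partial d (q v b c) y)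
     = (\<Sum>b\<in>UNIV. (\<Sum>a\<in>UNIV. q v e a y * M a b y) * partial d (q v b c) y)"
    by (subst sum.swap) (simp add: sum_distrib_right)
  also have "\<dots> = (\<Sum>b\<in>UNIV. (if e = b then 1 else 0) * partial d (q v b c) y)"
    unfolding M_def left_inverse[OF v] ..
  also have "\<dots> = partial d (q v e c) y" by (simp add: mult_delta_left)
  finally show ?thesis unfolding dM by simp
qed

text \<open>The derivative is matched with a member g' of the algebra instead of being shown to be
  one itself: the chain rule and the formula for the derivative of q are available only for indices
  in I.\<close>

lemma alg_partial:
  assumes "alg g"
  shows "\<exists>g'. alg g' \<and> (\<forall>v\<in>I. (\<forall>y. g v differentiable (at y)) \<and> partial i (g v) = g' v)"
  using assms
proof induction
  case (alg_q e c)
  have "alg (\<lambda>v y. - (\<Sum>a\<in>UNIV. \<Sum>b\<in>UNIV. q v e a y *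
      (\<Sum>k\<in>UNIV. iter_partial [k, a, b] (f v) (Y v y) * q v k i y) * q v b c y))"
    by (intro alg_minus alg_sum alg_mult alg.alg_q alg_f) simp
  then show ?case using partial_q q_differentiable by (intro exI conjI) (assumption, auto)
next
  case (alg_f "is")
  then have "alg (\<lambda>v y. \<Sum>a\<in>UNIV. iter_partial (a # is) (f v) (Y v y) * q v a i y)"
    by (intro alg_sum alg_mult alg.alg_q alg.alg_f) simp
  then show ?case using partial_f by (intro exI conjI) (assumption, auto)
next
  case alg_zero
  show ?case by (intro exI conjI) (rule alg.alg_zero, auto simp: partial_const)
next
  case (alg_add g h)
  then obtain g' h' where *: "alg g'" "alg h'" "\<And>v y. v \<in> I \<Longrightarrow> g v differentiable (at y)" "\<And>v y. v \<in> I \<Longrightarrow> h v differentiable (at y)"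
     "\<And>v. v \<in> I \<Longrightarrow> partial i (g v) = g' v" "\<And>v. v \<in> I \<Longrightarrow> partial i (h v) = h' v" by metis
  have "alg (\<lambda>v y. g' v y + h' v y)" using * by (intro alg.intros)
  then show ?case using * by (intro exI conjI) (assumption, auto simp: partial_add fun_eq_iff)
next
  case (alg_minus g)
  then obtain g' where *: "alg g'" "\<And>v y. v \<in> I \<Longrightarrow> g v differentiable (at y)"
     "\<And>v. v \<in> I \<Longrightarrow> partial i (g v) = g' v" by metis
  have "alg (\<lambda>v y. - g' v y)" using * by (intro alg.intros)
  then show ?case using * by (intro exI conjI) (assumption, auto simp: partial_minus fun_eq_iff)
next
  case (alg_mult g h)
  then obtain g' h' where *: "alg g'" "alg h'" "\<And>v y. v \<in> I \<Longrightarrow> g v differentiable (at y)" "\<And>v y. v \<in> I \<Longrightarrow> h v differentiable (at y)"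
     "\<And>v. v \<in> I \<Longrightarrow> partial i (g v) = g' v" "\<And>v. v \<in> I \<Longrightarrow> partial i (h v) = h' v" by metis
  have "alg (\<lambda>v y. g' v y * h v y + g v y * h' v y)" using * alg_mult by (intro alg.intros)
  then show ?case using * by (intro exI conjI) (assumption, auto simp: partial_mult fun_eq_iff)
qed

lemma alg_iter_partial:
  assumes "alg g"
  shows "\<exists>g'. alg g' \<and> (\<forall>v\<in>I. iter_partial is (g v) = g' v)"
proof (induction "is")
  case Nil
  then show ?case using assms by auto
next
  case (Cons i "is")
  then obtain g' where g': "alg g'" "\<forall>v\<in>I. iter_partial is (g v) = g' v" by blast
  show ?case using alg_partial[OF g'(1), of i] g'(2) by auto
qed

lemma alg_partials_differentiable:
  assumes "alg g" "v \<in> I"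
  shows "partials_differentiable (g v)"
  unfolding partials_differentiable_def
proof (intro allI)
  fix "is" x
  obtain g' where g': "alg g'" "\<forall>v\<in>I. iter_partial is (g v) = g' v" using alg_iter_partial[OF assms(1)] by blast
  show "iter_partial is (g v) differentiable (at x)" using alg_partial[OF g'(1)] g'(2) assms(2) by auto
qed

lemma alg_bounded:
  assumes q: "\<And>a b. \<exists>C. \<forall>v\<in>I. \<forall>y. \<bar>q v a b y\<bar> \<le> C"
    and f: "\<And>is. 2 \<le> length is \<Longrightarrow> \<exists>C. \<forall>v\<in>I. \<forall>y. \<bar>iter_partial is (f v) (Y v y)\<bar> \<le> C"
    and g: "alg g"
  shows "\<exists>C. \<forall>v\<in>I. \<forall>y. \<bar>g v y\<bar> \<le> C"
  using g
proof induction
  case (alg_q a b)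
  then show ?case by (rule q)
next
  case (alg_f "is")
  then show ?case by (rule f)
next
  case alg_zero
  then show ?case by auto
next
  case (alg_add g h)
  then obtain C D where "\<forall>v\<in>I. \<forall>y. \<bar>g v y\<bar> \<le> C" "\<forall>v\<in>I. \<forall>y. \<bar>h v y\<bar> \<le> D" by blast
  then show ?case by (intro exI[of _ "C + D"]) (meson abs_triangle_ineq add_mono order_trans)
next
  case (alg_minus g)
  then show ?case by simp
next
  case (alg_mult g h)
  then obtain C D where "\<forall>v\<in>I. \<forall>y. \<bar>g v y\<bar> \<le> C" "\<forall>v\<in>I. \<forall>y. \<bar>h v y\<bar> \<le> D" by blast
  then have "\<forall>v\<in>I. \<forall>y. \<bar>g v y * h v y\<bar> \<le> C * D"
    unfolding abs_mult by (meson abs_ge_zero mult_mono order_trans)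
  then show ?case by blast
qed

lemma iter_partial_q_bounded:
  assumes "\<And>a b. \<exists>C. \<forall>v\<in>I. \<forall>y. \<bar>q v a b y\<bar> \<le> C"
    and "\<And>is. 2 \<le> length is \<Longrightarrow> \<exists>C. \<forall>v\<in>I. \<forall>y. \<bar>iter_partial is (f v) (Y v y)\<bar> \<le> C"
  shows "\<exists>C. \<forall>v\<in>I. \<forall>y. \<bar>iter_partial is (q v a b) y\<bar> \<le> C"
  using alg_iter_partial[OF alg_q, of "is" a b] alg_bounded[OF assms] by fastforce

end

section \<open>Legendre transform\<close>

text \<open>For uniformly convex W this choice is the two-sided inverse of the gradient map.\<close>

definition grad_inv :: "(real^'n \<Rightarrow> real) \<Rightarrow> real^'n \<Rightarrow> real^'n" where
  "grad_inv W y = (SOME x. gradient W x = y)"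

text \<open>The value at the critical point, in place of a supremum, lets the chain rule give
  differentiability directly; \<open>legendre_ge\<close> recovers the supremum property.\<close>

definition legendre :: "(real^'n \<Rightarrow> real) \<Rightarrow> real^'n \<Rightarrow> real" where
  "legendre W y = y \<bullet> grad_inv W y - W (grad_inv W y)"

lemma pos_def_inverse_symmetric:
  fixes A :: "real^'n^'n"
  assumes z: "0 < z" and A: "pos_def z A"
  shows "matrix_inv A $ i $ j = matrix_inv A $ j $ i"
proof -
  have "transpose (matrix_inv A) ** transpose A = mat 1"
    using pos_def_inverse(1)[OF assms] by (metis matrix_transpose_mul transpose_mat)
  then have "transpose (matrix_inv A) ** A = mat 1" using A unfolding pos_def_def by simp
  then have "transpose (matrix_inv A) = matrix_inv A"
    by (metis pos_def_inverse(1)[OF assms] matrix_mul_assoc matrix_mul_lid matrix_mul_rid)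
  then have "transpose (matrix_inv A) $ i $ j = matrix_inv A $ i $ j" by simp
  then show ?thesis by (simp add: transpose_def)
qed

locale uniformly_convex =
  fixes z :: real and W :: "real^'n \<Rightarrow> real"
  assumes z_pos: "0 < z" and smooth: "partials_differentiable W" and convex: "pos_def z (hessian W x)"
begin

lemma hessian_sym: "partial i (partial j W) x = partial j (partial i W) x"
proof -
  have "transpose (hessian W x) $ i $ j = hessian W x $ i $ j" using convex[of x] unfolding pos_def_def by simp
  then show ?thesis by (simp add: transpose_def)
qed

lemma strongly_monotone:
  "z * ((x' - x) \<bullet> (x' - x)) \<le> (gradient W x' - gradient W x) \<bullet> (x' - x)"
proof -
  define d where "d = x' - x"
  have "\<exists>s. 0 < s \<and> s < 1 \<and> gradient W (x + 1 *\<^sub>R d) \<bullet> d - gradient W (x + 0 *\<^sub>R d) \<bullet> d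
      = (1 - 0) * (d \<bullet> (hessian W (x + s *\<^sub>R d) *v d))"
    by (rule MVT2) (auto intro!: has_real_derivative_gradient_along_line partials_differentiableD smooth)
  then obtain s where "gradient W x' \<bullet> d - gradient W x \<bullet> d = d \<bullet> (hessian W (x + s *\<^sub>R d) *v d)"
    unfolding d_def by auto
  moreover have "z * (d \<bullet> d) \<le> d \<bullet> (hessian W (x + s *\<^sub>R d) *v d)"
    using convex unfolding pos_def_def by blast
  ultimately show ?thesis unfolding d_def by (simp add: inner_diff_left)
qed

lemma quadratic_lower_bound:
  "W x + gradient W x \<bullet> (x' - x) + z / 2 * ((x' - x) \<bullet> (x' - x)) \<le> W x'"
proof -
  define d where "d = x' - x"
  \<comment> \<open>The mean value theorem is applied after subtracting the target quadratic s^2 z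
    |d|^2 / 2; strong monotonicity between x and x + s d then bounds the remaining derivative from
    below by the slope at x.\<close>
  have "\<exists>s. 0 < s \<and> s < 1 \<and> (W (x + 1 *\<^sub>R d) - 1\<^sup>2 * (z / 2 * (d \<bullet> d))) - (W (x + 0 *\<^sub>R d) - 0\<^sup>2 * (z / 2 * (d \<bullet> d)))
      = (1 - 0) * (gradient W (x + s *\<^sub>R d) \<bullet> d - 2 * s * (z / 2 * (d \<bullet> d)))"
    by (rule MVT2) (auto intro!: DERIV_diff has_real_derivative_along_line partials_differentiableD smooth derivative_eq_intros)
  then obtain s where s: "0 < s" "(W x' - z / 2 * (d \<bullet> d)) - W x = gradient W (x + s *\<^sub>R d) \<bullet> d - s * (z * (d \<bullet> d))"
    unfolding d_def by auto
  have "s * (s * (z * (d \<bullet> d))) \<le> s * (gradient W (x + s *\<^sub>R d) \<bullet> d - gradient W x \<bullet> d)"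
    using strongly_monotone[of "x + s *\<^sub>R d" x] by (simp add: inner_diff_left algebra_simps)
  then have "s * (z * (d \<bullet> d)) \<le> gradient W (x + s *\<^sub>R d) \<bullet> d - gradient W x \<bullet> d"
    using s(1) by (rule mult_left_le_imp_le)
  then show ?thesis using s(2) unfolding d_def[symmetric] by linarith
qed

text \<open>A minimizer of W x - x . y is a critical point with gradient y. The quadratic lower
  bound makes this function larger than its value at 0 outside the ball of radius R, so the minimum
  over the ball is global.\<close>

lemma gradient_surj: "\<exists>x. gradient W x = y"
proof -
  define \<phi> where "\<phi> = (\<lambda>x. W x - x \<bullet> y)"
  define b where "b = gradient W 0 - y"
  define R where "R = 2 * norm b / z + 1"
  have R: "R > 0" unfolding R_def using z_pos by (simp add: add_nonneg_pos)
  have out: "\<phi> 0 < \<phi> x" if "norm x \<ge> R" for x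
  proof -
    have n: "norm x > 0" using that R by linarith
    have "2 * norm b / z < norm x" using that unfolding R_def by simp
    then have "norm b < z / 2 * norm x" using z_pos by (simp add: field_simps)
    then have "norm b * norm x < z / 2 * norm x * norm x" using n by simp
    moreover have "- (norm b * norm x) \<le> b \<bullet> x" using Cauchy_Schwarz_ineq2[of b x] by linarith
    ultimately have "0 < b \<bullet> x + z / 2 * (x \<bullet> x)" by (simp add: dot_square_norm power2_eq_square)
    then show ?thesis using quadratic_lower_bound[of 0 x] unfolding \<phi>_def b_def
      by (simp add: inner_diff_left inner_diff_right inner_commute)
  qed
  have "continuous_on (cball 0 R) W"
    using partials_differentiableD(1)[OF smooth] by (simp add: continuous_at_imp_continuous_on differentiable_imp_continuous_within)
  then have "continuous_on (cball 0 R) \<phi>" unfolding \<phi>_def by (intro continuous_intros)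
  moreover have "cball (0 :: real^'n) R \<noteq> {}" using R by simp
  ultimately obtain p where p: "p \<in> cball 0 R" "\<And>x. x \<in> cball 0 R \<Longrightarrow> \<phi> p \<le> \<phi> x"
    using continuous_attains_inf[OF compact_cball] by metis
  have p0: "\<phi> p \<le> \<phi> 0" using p(2)[of 0] R by simp
  have pR: "norm p < R" using out[of p] p0 by force
  have min: "\<phi> p \<le> \<phi> x" for x
    using p(2)[of x] out[of x] p0 by (cases "norm x \<ge> R") auto
  have "partial i W p = y $ i" for i
  proof -
    have "((\<lambda>s. \<phi> (p + s *\<^sub>R axis i 1)) has_real_derivative partial i W (p + 0 *\<^sub>R axis i 1) - y $ i) (at 0)"
      unfolding \<phi>_def
      by (intro DERIV_diff has_real_derivative_along_axis partials_differentiableD smooth)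
         (auto intro!: derivative_eq_intros simp: inner_add_left inner_axis')
    from DERIV_local_min[OF this zero_less_one] min show ?thesis by simp
  qed
  then have "gradient W p = y" by (simp add: vec_eq_iff)
  then show ?thesis ..
qed

lemma gradient_grad_inv: "gradient W (grad_inv W y) = y"
  unfolding grad_inv_def using gradient_surj by (rule someI_ex)

lemma grad_inv_lipschitz: "norm (grad_inv W y' - grad_inv W y) \<le> norm (y' - y) / z"
proof -
  define d where "d = grad_inv W y' - grad_inv W y"
  have "z * (d \<bullet> d) \<le> (y' - y) \<bullet> d"
    using strongly_monotone[of "grad_inv W y'" "grad_inv W y"] unfolding gradient_grad_inv d_def .
  also have "\<dots> \<le> norm (y' - y) * norm d" by (rule norm_cauchy_schwarz)
  finally have "z * norm d * norm d \<le> norm (y' - y) * norm d" by (simp add: dot_square_norm power2_eq_square)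
  then have "z * norm d \<le> norm (y' - y)" by (cases "d = 0") auto
  then show ?thesis unfolding d_def using z_pos by (simp add: field_simps)
qed

lemma grad_inv_gradient: "grad_inv W (gradient W x) = x"
proof -
  have "z * ((grad_inv W (gradient W x) - x) \<bullet> (grad_inv W (gradient W x) - x)) \<le> 0"
    using strongly_monotone[of "grad_inv W (gradient W x)" x] unfolding gradient_grad_inv by simp
  then have "(grad_inv W (gradient W x) - x) \<bullet> (grad_inv W (gradient W x) - x) \<le> 0"
    using z_pos by (simp add: mult_le_0_iff)
  then show ?thesis using inner_ge_zero[of "grad_inv W (gradient W x) - x"] by (simp add: inner_eq_zero_iff order_antisym)
qed

lemma legendre_ge: "y \<bullet> x - W x \<le> legendre W y"
proof -
  have "0 \<le> z / 2 * ((x - grad_inv W y) \<bullet> (x - grad_inv W y))" using z_pos by simp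
  then have "W (grad_inv W y) + y \<bullet> (x - grad_inv W y) \<le> W x"
    using quadratic_lower_bound[of "grad_inv W y" x] unfolding gradient_grad_inv by linarith
  then show ?thesis unfolding legendre_def by (simp add: inner_diff_right)
qed

lemma gradient_has_derivative: "(gradient W has_derivative (\<lambda>h. hessian W x *v h)) (at x)"
proof -
  have "((\<lambda>x. \<chi> i. partial i W x) has_derivative (\<lambda>h. \<chi> i. gradient (partial i W) x \<bullet> h)) (at x)"
    unfolding has_derivative_componentwise_within[of "\<lambda>x. \<chi> i. partial i W x"]
    by (auto simp: Basis_vec_def inner_axis intro!: has_derivative_gradient partials_differentiableD smooth)
  \<comment> \<open>Symmetry enters here: differentiating the gradient gives the entries in the
    order opposite to that of \<open>hessian\<close>.\<close>
  moreover have "(\<lambda>h. \<chi> i. gradient (partial i W) x \<bullet> h) = (\<lambda>h. hessian W x *v h)"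
    by (simp add: fun_eq_iff vec_eq_iff inner_vec_def matrix_vector_mult_def hessian_sym)
  ultimately show ?thesis by (simp add: gradient_def[abs_def])
qed

text \<open>The inverse is already known globally, so its continuity, supplied by the Lipschitz
  bound, is all that the inverse derivative rule asks for besides invertibility of the
  Hessian.\<close>

lemma grad_inv_has_derivative:
  "(grad_inv W has_derivative (\<lambda>h. matrix_inv (hessian W (grad_inv W y)) *v h)) (at y)"
proof (rule has_derivative_inverse_basic[where T = UNIV])
  show "(gradient W has_derivative (\<lambda>h. hessian W (grad_inv W y) *v h)) (at (grad_inv W y))"
    by (rule gradient_has_derivative)
  show "(\<lambda>h. matrix_inv (hessian W (grad_inv W y)) *v h) \<circ> (\<lambda>h. hessian W (grad_inv W y) *v h) = id"
    using pos_def_inverse(4)[OF z_pos convex] by (auto simp: fun_eq_iff)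
  have "\<exists>d>0. \<forall>x. dist x y < d \<longrightarrow> dist (grad_inv W x) (grad_inv W y) < e" if "e > 0" for e
  proof (intro exI[of _ "z * e"] conjI allI impI)
    fix x assume "dist x y < z * e"
    then have "norm (x - y) / z < e" using z_pos by (simp add: dist_norm field_simps)
    then show "dist (grad_inv W x) (grad_inv W y) < e" using grad_inv_lipschitz[of x y] by (simp add: dist_norm)
  qed (use z_pos that in simp)
  then show "continuous (at y) (grad_inv W)" unfolding continuous_at_eps_delta by (auto simp: dist_norm)
qed (auto simp: gradient_grad_inv matrix_vector_mul_bounded_linear)

text \<open>Both terms containing the derivative of \<open>grad_inv\<close> cancel, because the
  gradient of W at \<open>grad_inv W y\<close> is y.\<close>

lemma legendre_has_derivative: "(legendre W has_derivative (\<lambda>h. grad_inv W y \<bullet> h)) (at y)"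
proof -
  let ?X = "\<lambda>h. matrix_inv (hessian W (grad_inv W y)) *v h"
  have 1: "((\<lambda>y. y \<bullet> grad_inv W y) has_derivative (\<lambda>h. y \<bullet> ?X h + h \<bullet> grad_inv W y)) (at y)"
    by (rule has_derivative_inner[OF has_derivative_ident grad_inv_has_derivative])
  have 2: "((\<lambda>y. W (grad_inv W y)) has_derivative (\<lambda>h. gradient W (grad_inv W y) \<bullet> ?X h)) (at y)"
    by (rule has_derivative_compose[OF grad_inv_has_derivative]) (intro has_derivative_gradient partials_differentiableD smooth)
  show ?thesis using has_derivative_diff[OF 1 2] unfolding gradient_grad_inv legendre_def[abs_def]
    by (simp add: inner_commute)
qed

lemma partial_legendre: "partial i (legendre W) = (\<lambda>y. grad_inv W y $ i)"
  using partial_eqI[OF legendre_has_derivative] by (auto simp: inner_axis)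

lemma grad_inv_nth_has_derivative:
  "((\<lambda>y. grad_inv W y $ i) has_derivative (\<lambda>h. (matrix_inv (hessian W (grad_inv W y)) *v h) $ i)) (at y)"
  using bounded_linear.has_derivative[OF bounded_linear_vec_nth grad_inv_has_derivative] .

lemma partial_partial_legendre:
  "partial i (partial j (legendre W)) = (\<lambda>y. matrix_inv (hessian W (grad_inv W y)) $ j $ i)"
proof
  fix y
  have "(matrix_inv (hessian W (grad_inv W y)) *v axis i 1) $ j = matrix_inv (hessian W (grad_inv W y)) $ j $ i"
    by (simp add: matrix_vector_mult_basis column_def)
  then show "partial i (partial j (legendre W)) y = matrix_inv (hessian W (grad_inv W y)) $ j $ i"
    unfolding partial_legendre using partial_eqI[OF grad_inv_nth_has_derivative] by metis
qed

text \<open>By Cramer's rule each entry of the inverse is a quotient of determinants of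
  differentiable entries.\<close>

lemma matrix_inv_hessian_differentiable:
  "(\<lambda>y. matrix_inv (hessian W (grad_inv W y)) $ a $ b) differentiable (at y)"
proof -
  define A where "A = (\<lambda>y. hessian W (grad_inv W y))"
  have inv: "invertible (A y)" for y
    using pos_def_inverse(2)[OF z_pos convex] unfolding A_def invertible_left_inverse by blast
  then have det: "det (A y) \<noteq> 0" for y by (simp add: invertible_det_nz)
  have cramer: "matrix_inv (A y) $ a $ b = det (\<chi> i j. if j = a then axis b 1 $ i else A y $ i $ j) / det (A y)" for y
  proof -
    have "A y *v (matrix_inv (A y) *v axis b 1) = axis b 1"
      unfolding A_def by (rule pos_def_inverse(3)[OF z_pos convex])
    then have "matrix_inv (A y) *v axis b 1 = (\<chi> k. det (\<chi> i j. if j = k then axis b 1 $ i else A y $ i $ j) / det (A y))"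
      using cramer[OF det] by blast
    then show ?thesis by (simp add: matrix_vector_mult_basis column_def vec_eq_iff)
  qed
  have "(\<lambda>y. A y $ i $ j) differentiable (at y)" for i j
  proof -
    have "grad_inv W differentiable (at y)" using grad_inv_has_derivative unfolding differentiable_def by blast
    moreover have "partial i (partial j W) differentiable (at (grad_inv W y))"
      by (intro partials_differentiableD smooth)
    ultimately show ?thesis unfolding A_def hessian_nth using differentiable_chain_at[of "grad_inv W" y "partial i (partial j W)"]
      by (simp add: comp_def)
  qed
  note Ad = this
  have "(\<lambda>y. det (\<chi> i j. if j = a then axis b 1 $ i else A y $ i $ j)) differentiable (at y)"
  proof (rule differentiable_det)
    show "(\<lambda>y. (\<chi> i j. if j = a then axis b 1 $ i else A y $ i $ j) $ i $ j) differentiable (at y)" for i j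
      using Ad[of i j] by (cases "j = a") simp_all
  qed
  moreover have "(\<lambda>y. det (A y)) differentiable (at y)" by (rule differentiable_det[OF Ad])
  ultimately have "(\<lambda>y. det (\<chi> i j. if j = a then axis b 1 $ i else A y $ i $ j) / det (A y)) differentiable (at y)"
    using det by (intro differentiable_divide) auto
  then have "(\<lambda>y. matrix_inv (A y) $ a $ b) differentiable (at y)" unfolding cramer .
  then show ?thesis unfolding A_def .
qed

text \<open>A one-element index set, as only differentiability is wanted here: the second partials
  of the Legendre transform are the generators q, hence differentiable to all orders.\<close>

lemma inverse_hessian_along_grad_inv:
  "inverse_hessian_family {()} (\<lambda>_. W) (\<lambda>_. grad_inv W) (\<lambda>_ a b y. matrix_inv (hessian W (grad_inv W y)) $ a $ b)"
proof
  fix e b c a y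
  let ?H = "hessian W (grad_inv W y)"
  note inv = pos_def_inverse(1,2)[OF z_pos convex, of "grad_inv W y"]
  show "(grad_inv W has_derivative (\<lambda>h. \<chi> a. \<Sum>c\<in>UNIV. matrix_inv ?H $ a $ c * h $ c)) (at y)"
    using grad_inv_has_derivative[of y] unfolding matrix_vector_mult_def .
  show "(\<Sum>a\<in>UNIV. matrix_inv ?H $ e $ a * partial a (partial b W) (grad_inv W y)) = (if e = b then 1 else 0)"
    using arg_cong[OF inv(2), of "\<lambda>M. M $ e $ b"] by (simp add: matrix_matrix_mult_def mat_def)
  show "(\<Sum>b\<in>UNIV. partial a (partial b W) (grad_inv W y) * matrix_inv ?H $ b $ c) = (if a = c then 1 else 0)"
    using arg_cong[OF inv(1), of "\<lambda>M. M $ a $ c"] by (simp add: matrix_matrix_mult_def mat_def)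
qed (rule smooth matrix_inv_hessian_differentiable)+

lemma partials_differentiable_legendre: "partials_differentiable (legendre W)"
  unfolding partials_differentiable_def
proof (intro allI)
  fix "is" :: "'n list" and y
  interpret F: inverse_hessian_family "{()}" "\<lambda>_. W" "\<lambda>_. grad_inv W"
    "\<lambda>_ a b y. matrix_inv (hessian W (grad_inv W y)) $ a $ b"
    by (rule inverse_hessian_along_grad_inv)
  consider "is = []" | i where "is = [i]" | js i j where "is = js @ [i, j]"
  proof (cases "is" rule: rev_cases)
    case (snoc ks j)
    then show ?thesis using that by (cases ks rule: rev_cases) auto
  qed (use that in auto)
  then show "iter_partial is (legendre W) differentiable (at y)"
  proof cases
    case 1
    then show ?thesis using legendre_has_derivative unfolding differentiable_def by auto
  next
    case 2
    then show ?thesis using grad_inv_nth_has_derivative unfolding differentiable_def by (auto simp: partial_legendre)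
  next
    case 3
    have "partials_differentiable (\<lambda>y. matrix_inv (hessian W (grad_inv W y)) $ j $ i)"
      using F.alg_partials_differentiable[OF F.alg_q] by simp
    then show ?thesis unfolding 3 iter_partial_append partials_differentiable_def
      by (simp add: partial_partial_legendre)
  qed
qed

text \<open>The same structure with the roles exchanged: f is the dual function, Y the gradient of
  W, and q the Hessian of W itself. In this direction bounds on the dual return to W.\<close>

lemma inverse_hessian_along_gradient:
  "partials_differentiable (legendre W)"
  "(gradient W has_derivative (\<lambda>h. \<chi> a. \<Sum>c\<in>UNIV. partial a (partial c W) x * h $ c)) (at x)"
  "partial a (partial b W) differentiable (at x)"
  "(\<Sum>a\<in>UNIV. partial e (partial a W) x * partial a (partial b (legendre W)) (gradient W x)) = (if e = b then 1 else 0)"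
  "(\<Sum>b\<in>UNIV. partial a (partial b (legendre W)) (gradient W x) * partial b (partial c W) x) = (if a = c then 1 else 0)"
proof -
  let ?H = "hessian W x"
  note inv = pos_def_inverse(1,2)[OF z_pos convex, of x]
  show "(gradient W has_derivative (\<lambda>h. \<chi> a. \<Sum>c\<in>UNIV. partial a (partial c W) x * h $ c)) (at x)"
    using gradient_has_derivative[of x] unfolding matrix_vector_mult_def by simp
  show "(\<Sum>a\<in>UNIV. partial e (partial a W) x * partial a (partial b (legendre W)) (gradient W x)) = (if e = b then 1 else 0)"
    using arg_cong[OF inv(1), of "\<lambda>M. M $ e $ b"] pos_def_inverse_symmetric[OF z_pos convex]
    by (simp add: matrix_matrix_mult_def mat_def partial_partial_legendre grad_inv_gradient)
  show "(\<Sum>b\<in>UNIV. partial a (partial b (legendre W)) (gradient W x) * partial b (partial c W) x) = (if a = c then 1 else 0)"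
    using arg_cong[OF inv(2), of "\<lambda>M. M $ a $ c"] pos_def_inverse_symmetric[OF z_pos convex]
    by (simp add: matrix_matrix_mult_def mat_def partial_partial_legendre grad_inv_gradient)
qed (intro partials_differentiable_legendre partials_differentiableD smooth)+

text \<open>The gradient of the dual is \<open>grad_inv W\<close>, which is Lipschitz with constant
  1 / z. This provides the order-two bound that starts the iteration for the heat equation.\<close>

lemma legendre_second_difference:
  "\<bar>foldr fdiff [d, e] (legendre W) y\<bar> \<le> 1 / z * \<bar>snd d\<bar> * \<bar>snd e\<bar>"
proof -
  obtain i a j b where de: "d = (i, a)" "e = (j, b)" by (cases d, cases e)
  let ?v = "axis i 1 :: real^'n" and ?w = "axis j 1 :: real^'n"
  let ?\<psi> = "\<lambda>s. legendre W (y + a *\<^sub>R ?v + s *\<^sub>R ?w) - legendre W (y + s *\<^sub>R ?w)"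
  let ?D = "\<lambda>s. grad_inv W (y + a *\<^sub>R ?v + s *\<^sub>R ?w) $ j - grad_inv W (y + s *\<^sub>R ?w) $ j"
  have D: "(?\<psi> has_real_derivative ?D s) (at s)" for s
    using DERIV_diff[OF has_real_derivative_along_axis[of "legendre W" "y + a *\<^sub>R ?v" s j] has_real_derivative_along_axis[of "legendre W" y s j]]
      partials_differentiableD(1)[OF partials_differentiable_legendre] by (simp add: partial_legendre)
  have bd: "\<bar>?D s\<bar> \<le> \<bar>a\<bar> / z" for s
    using component_le_norm_cart[of "grad_inv W (y + a *\<^sub>R ?v + s *\<^sub>R ?w) - grad_inv W (y + s *\<^sub>R ?w)" j]
      grad_inv_lipschitz[of "y + a *\<^sub>R ?v + s *\<^sub>R ?w" "y + s *\<^sub>R ?w"] by simp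
  have "norm (?\<psi> b - ?\<psi> 0) \<le> (\<bar>a\<bar> / z) * norm (b - 0)"
    by (rule field_differentiable_bound[OF convex_UNIV, where f' = ?D]) (use D bd in auto)
  then show ?thesis unfolding de by (simp add: fdiff_apply[of "(i,a)"] fdiff_apply[of "(j,b)"] algebra_simps)
qed

end

section \<open>Interior estimates of all orders\<close>

context
  fixes \<zeta> \<rho> :: real and v0 :: "real^'n \<Rightarrow> real" and v :: "real^'n \<Rightarrow> real \<Rightarrow> real"
  assumes sol: "is_solution \<zeta> \<rho> v0 v"
begin

lemma is_solution_has_derivative:
  assumes "0 < t"
  shows "((\<lambda>(x, t). v x t) has_derivative frechet_derivative (\<lambda>(x, t). v x t) (at (x, t))) (at (x, t))"
proof -
  have "Ck_on 1 (UNIV \<times> {0<..}) (\<lambda>(x, t). v x t)"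
    using sol unfolding is_solution_def smooth_on_def by blast
  then show ?thesis using assms by (simp add: frechet_derivative_works)
qed

lemma is_solution_frechet_continuous:
  "continuous_on (UNIV \<times> {0<..}) (\<lambda>p. frechet_derivative (\<lambda>(x, t). v x t) (at p) w)"
proof -
  have "Ck_on 1 (UNIV \<times> {0<..}) (\<lambda>(x, t). v x t)"
    using sol unfolding is_solution_def smooth_on_def by blast
  then show ?thesis by (cases w) simp
qed

lemma is_solution_partial_continuous: "continuous_on {0<..} (\<lambda>t. partial i (\<lambda>x. v x t) x)"
proof -
  have "partial i (\<lambda>x. v x t) x = frechet_derivative (\<lambda>(x, t). v x t) (at (x, t)) (axis i 1, 0)" if "0 < t" for t
  proof (rule partial_eqI)
    have "((\<lambda>x. (x, t)) has_derivative (\<lambda>h. (h, 0))) (at x)"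
      by (intro has_derivative_Pair has_derivative_ident has_derivative_const)
    from has_derivative_compose[OF this is_solution_has_derivative[OF that]]
    show "((\<lambda>x. v x t) has_derivative (\<lambda>h. frechet_derivative (\<lambda>(x, t). v x t) (at (x, t)) (h, 0))) (at x)" by simp
  qed
  moreover have "continuous_on {0<..} (\<lambda>t. frechet_derivative (\<lambda>(x, t). v x t) (at (x, t)) (axis i 1, 0))"
    by (rule continuous_on_compose2[OF is_solution_frechet_continuous]) (auto intro!: continuous_intros)
  ultimately show ?thesis using continuous_on_cong by (metis (no_types, lifting) greaterThan_iff)
qed

text \<open>By the equation, this expression is the space-time derivative of v in direction (0, 1),
  so its joint continuity comes from smoothness of v, with no study of how the operator depends on
  the matrix.\<close>

lemma is_solution_time_derivative_continuous:
  "continuous_on (UNIV \<times> {0<..}) (\<lambda>(x, t). F_pi4 (hessian (\<lambda>y. v y t) x))"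
proof -
  have "F_pi4 (hessian (\<lambda>y. v y t) x) = frechet_derivative (\<lambda>(x, t). v x t) (at (x, t)) (0, 1)" if "0 < t" for x t
  proof -
    let ?f = "frechet_derivative (\<lambda>(x, t). v x t) (at (x, t))"
    have "((\<lambda>t. (x, t)) has_derivative (\<lambda>h. (0, h))) (at t)"
      by (intro has_derivative_Pair has_derivative_ident has_derivative_const)
    from has_derivative_compose[OF this is_solution_has_derivative[OF that]]
    have D: "((\<lambda>s. v x s) has_derivative (\<lambda>h. ?f (0, h))) (at t)" by simp
    have lin: "linear ?f" using has_derivative_linear[OF is_solution_has_derivative[OF that]] .
    have "?f (0, h) = ?f (0, 1) * h" for h
      using linear_cmul[OF lin, of h "(0, 1)"] by (simp add: mult.commute)
    then have "(\<lambda>h. ?f (0, h)) = (*) (?f (0, 1))" by (rule ext)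
    then have "((\<lambda>s. v x s) has_real_derivative ?f (0, 1)) (at t)"
      using D unfolding has_field_derivative_def by (simp only:)
    then show ?thesis using is_solution_time[OF sol that] by (rule DERIV_unique[symmetric])
  qed
  then have "(\<lambda>(x, t). F_pi4 (hessian (\<lambda>y. v y t) x)) p = frechet_derivative (\<lambda>(x, t). v x t) (at p) (0, 1)"
    if "p \<in> UNIV \<times> {0<..}" for p using that by auto
  then show ?thesis using is_solution_frechet_continuous[of "(0, 1)"] continuous_on_cong[OF refl] by (metis (no_types, lifting))
qed

end

section \<open>The Legendre transform of a solution and its evolution in time\<close>

lemma second_partials_add_half_sq:
  assumes "partials_differentiable f"
  shows "partial i (partial j (\<lambda>x. f x + half_sq x)) = (\<lambda>x. partial i (partial j f) x + (if i = j then 1 else 0))"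
  using iter_partial_add[OF assms partials_differentiable_half_sq, of "[i, j]"]
  by (simp add: partial_half_sq partial_nth)

lemma hessian_add_half_sq:
  assumes "partials_differentiable f"
  shows "hessian (\<lambda>x. f x + half_sq x) x = mat 1 + hessian f x"
  by (simp add: vec_eq_iff second_partials_add_half_sq[OF assms] mat_def)

lemma is_solution_uniformly_convex:
  assumes "is_solution \<zeta> \<rho> v0 v" "0 < \<zeta>" "0 < t"
  shows "uniformly_convex \<zeta> (\<lambda>x. v x t + half_sq x)"
proof
  note p = is_solution_partials[OF assms(1,3)]
  show "partials_differentiable (\<lambda>x. v x t + half_sq x)"
    by (rule partials_differentiable_add[OF p partials_differentiable_half_sq])
  show "pos_def \<zeta> (hessian (\<lambda>x. v x t + half_sq x) x)" for x
    unfolding hessian_add_half_sq[OF p]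
    by (rule pos_def_shift[OF is_solution_sym[OF assms(1,3)] is_solution_lower[OF assms(1,3)]])
qed (rule assms)

text \<open>
  The Legendre transform linearizes the equation: with \<open>g\<close> the Hessian of \<open>v + |x|\<^sup>2 / 2\<close>, its Hessian is
  \<open>g\<^sup>-\<^sup>1\<close> and its time derivative is \<open>- \<partial>\<^sub>t v = sqrt 2 tr (g\<^sup>-\<^sup>1)\<close>.
\<close>

lemma legendre_heat_solution:
  fixes v :: "real^'n \<Rightarrow> real \<Rightarrow> real"
  assumes sol: "is_solution \<zeta> \<rho> v0 v" and \<zeta>: "0 < \<zeta>"
  shows "heat_solution (sqrt 2) (\<lambda>y t. legendre (\<lambda>x. v x t + half_sq x) y)"
proof -
  define W where "W = (\<lambda>t x. v x t + half_sq x)"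
  define V where "V = (\<lambda>y t. legendre (W t) y)"
  define X where "X = (\<lambda>y t. grad_inv (W t) y)"
  define M where "M = sqrt 2 * CARD('n) / \<zeta>"
  define D where "D = (\<lambda>x t. F_pi4 (hessian (\<lambda>y. v y t) x))"
  have uc: "uniformly_convex \<zeta> (W t)" if "0 < t" for t
    unfolding W_def by (rule is_solution_uniformly_convex[OF sol \<zeta> that])
  \<comment> \<open>The optimal point of time s is inserted into the supremum at time t; the linear
    and quadratic terms cancel and only the change of v at that point remains. Exchanging s and t
    gives the opposite inequality.\<close>
  have lower: "V y s - (v (X y s) t - v (X y s) s) \<le> V y t" if "0 < s" "0 < t" for y s t
    using uniformly_convex.legendre_ge[OF uc[OF that(2)], of y "X y s"] unfolding V_def X_def legendre_def W_def by simp
  have time: "\<bar>v x t - v x s\<bar> \<le> M * \<bar>t - s\<bar>" if "0 < s" "0 < t" for x s t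
    using is_solution_time_bound[OF sol \<zeta>, of s t x] is_solution_time_bound[OF sol \<zeta>, of t s x] that
    unfolding M_def by (cases "s \<le> t") (simp_all add: abs_minus_commute)
  have V_time: "\<bar>V y t - V y s\<bar> \<le> M * \<bar>t - s\<bar>" if "0 < s" "0 < t" for y s t
    using lower[OF that, of y] lower[OF that(2,1), of y] time[OF that, of "X y s"] time[OF that(2,1), of "X y t"]
    by (simp add: abs_le_iff abs_minus_commute)
  \<comment> \<open>Continuity in y at the fixed time t0 is combined with the Lipschitz bound in t,
    which is uniform in y.\<close>
  have V_cont: "continuous_on (UNIV \<times> {0<..}) (\<lambda>(y, t). V y t)"
    unfolding continuous_on_def
  proof
    fix p assume "p \<in> (UNIV :: (real^'n) set) \<times> {0 :: real<..}"
    then obtain y0 t0 where p: "p = (y0, t0)" and t0: "0 < t0" by auto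
    let ?S = "(UNIV :: (real^'n) set) \<times> {0 :: real<..}"
    have "isCont (\<lambda>y. V y t0) y0" unfolding V_def
      using has_derivative_continuous[OF uniformly_convex.legendre_has_derivative[OF uc[OF t0]]] .
    then have "((\<lambda>q. V (fst q) t0) \<longlongrightarrow> V (fst p) t0) (at p within ?S)"
      unfolding p by (intro isCont_tendsto_compose[of _ "\<lambda>y. V y t0"] tendsto_intros) simp_all
    then have "((\<lambda>q. M * \<bar>snd q - t0\<bar> + \<bar>V (fst q) t0 - V (fst p) t0\<bar>) \<longlongrightarrow> M * \<bar>snd p - t0\<bar> + \<bar>V (fst p) t0 - V (fst p) t0\<bar>) (at p within ?S)"
      by (intro tendsto_intros)
    then have "((\<lambda>q. M * \<bar>snd q - t0\<bar> + \<bar>V (fst q) t0 - V (fst p) t0\<bar>) \<longlongrightarrow> 0) (at p within ?S)"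
      unfolding p by simp
    moreover have "\<forall>\<^sub>F q in at p within ?S. norm (V (fst q) (snd q) - V y0 t0) \<le> M * \<bar>snd q - t0\<bar> + \<bar>V (fst q) t0 - V (fst p) t0\<bar>"
    proof (rule eventually_at_filter[THEN iffD2], rule always_eventually, intro allI impI)
      fix q assume "q \<in> ?S"
      then have "0 < snd q" by auto
      from V_time[OF t0 this, of "fst q"]
      show "norm (V (fst q) (snd q) - V y0 t0) \<le> M * \<bar>snd q - t0\<bar> + \<bar>V (fst q) t0 - V (fst p) t0\<bar>"
        unfolding p by simp
    qed
    ultimately have "((\<lambda>q. V (fst q) (snd q) - V y0 t0) \<longlongrightarrow> 0) (at p within ?S)"
      by (rule Lim_null_comparison[rotated])
    then show "((\<lambda>(y, t). V y t) \<longlongrightarrow> (\<lambda>(y, t). V y t) p) (at p within ?S)"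
      unfolding p by (simp add: case_prod_unfold LIM_zero_iff)
  qed
  have D_cont: "continuous_on (UNIV \<times> {0<..}) (\<lambda>(x, t). D x t)"
    unfolding D_def by (rule is_solution_time_derivative_continuous[OF sol])
  have mvt: "\<exists>\<theta>. \<bar>\<theta> - t\<bar> \<le> \<bar>s - t\<bar> \<and> v x s - v x t = (s - t) * D x \<theta>" if "0 < s" "0 < t" for x s t
  proof -
    have "\<exists>\<theta>. a \<le> \<theta> \<and> \<theta> \<le> b \<and> v x b - v x a = (b - a) * D x \<theta>" if "0 < a" "a \<le> b" for a b
    proof (cases "a = b")
      case False
      have "\<exists>\<theta>. a < \<theta> \<and> \<theta> < b \<and> v x b - v x a = (b - a) * D x \<theta>"
        unfolding D_def by (rule MVT2) (use that False is_solution_time[OF sol] in auto)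
      then show ?thesis by (meson less_imp_le)
    qed auto
    note between = this
    show ?thesis
    proof (cases "s \<le> t")
      case True
      obtain \<theta> where "s \<le> \<theta>" "\<theta> \<le> t" "v x t - v x s = (t - s) * D x \<theta>"
        using between[OF \<open>0 < s\<close> True] by blast
      then show ?thesis by (intro exI[of _ \<theta>]) (auto simp: left_diff_distrib)
    next
      case False
      obtain \<theta> where "t \<le> \<theta>" "\<theta> \<le> s" "v x s - v x t = (s - t) * D x \<theta>"
        using between[OF \<open>0 < t\<close>, of s] False by auto
      then show ?thesis by (intro exI[of _ \<theta>]) auto
    qed
  qed
  \<comment> \<open>The point X y t is the preimage under the gradient of \<open>W s\<close> of a
    vector ?G s that tends to y as s tends to t. The Lipschitz constant 1 / \<zeta> of
    \<open>grad_inv (W s)\<close> does not depend on s.\<close>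
  have X_cont: "\<exists>d>0. \<forall>s. \<bar>s - t\<bar> < d \<longrightarrow> 0 < s \<and> norm (X y s - X y t) < e" if t: "0 < t" and e: "0 < e" for y t e
  proof -
    let ?G = "\<lambda>s. gradient (W s) (X y t)"
    have part: "partial i (W s) x = partial i (\<lambda>x. v x s) x + x $ i" if "0 < s" for i s x
      unfolding W_def using partial_add[OF partials_differentiableD(1)[OF is_solution_partials[OF sol that]]
        partials_differentiableD(1)[OF partials_differentiable_half_sq]] by (simp add: partial_half_sq)
    have 1: "continuous_on {0<..} (\<lambda>s. \<chi> i. partial i (\<lambda>x. v x s) (X y t) + X y t $ i)"
      by (intro continuous_on_vec_lambda continuous_intros is_solution_partial_continuous[OF sol])
    have 2: "?G s = (\<chi> i. partial i (\<lambda>x. v x s) (X y t) + X y t $ i)" if "s \<in> {0<..}" for s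
      using part that by (simp add: vec_eq_iff)
    have "continuous_on {0<..} ?G" by (rule continuous_on_eq[OF 1 2[symmetric]])
    then have "isCont ?G t" using t by (simp add: continuous_on_eq_continuous_at)
    then obtain d where d: "d > 0" "\<And>s. \<bar>s - t\<bar> < d \<Longrightarrow> norm (?G s - ?G t) < \<zeta> * e"
      using \<zeta> e unfolding continuous_at_eps_delta by (metis mult_pos_pos dist_norm real_norm_def)
    show ?thesis
    proof (intro exI[of _ "min d t"] conjI allI impI)
      fix s assume s: "\<bar>s - t\<bar> < min d t"
      then show s0: "0 < s" by (auto simp: abs_less_iff)
      have "norm (X y s - X y t) = norm (grad_inv (W s) y - grad_inv (W s) (?G s))"
        using uniformly_convex.grad_inv_gradient[OF uc[OF s0]] unfolding X_def by simp
      also have "\<dots> \<le> norm (y - ?G s) / \<zeta>"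
        by (rule uniformly_convex.grad_inv_lipschitz[OF uc[OF s0]])
      also have "norm (y - ?G s) / \<zeta> < e"
      proof -
        have "?G t = y" unfolding X_def by (rule uniformly_convex.gradient_grad_inv[OF uc[OF t]])
        then show ?thesis using d(2)[of s] s \<zeta> by (simp add: norm_minus_commute pos_divide_less_eq mult.commute)
      qed
      finally show "norm (X y s - X y t) < e" .
    qed (use d t in simp)
  qed
  \<comment> \<open>Envelope argument: by \<open>lower\<close>, the increment of V lies between the
    negated increments of v at X y t and at X y s. Both are close to the linear one by continuity of
    D and of X, so X need not be differentiable in time.\<close>
  have V_dt: "((\<lambda>s. V y s) has_real_derivative - D (X y t) t) (at t)" if t: "0 < t" for y t
    unfolding has_field_derivative_def has_derivative_at_alt
  proof (intro conjI allI impI bounded_linear_mult_right)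
    fix e :: real assume e: "0 < e"
    have "\<exists>d>0. \<forall>q\<in>UNIV \<times> {0<..}. dist q (X y t, t) < d \<longrightarrow> dist ((\<lambda>(x, t). D x t) q) ((\<lambda>(x, t). D x t) (X y t, t)) < e"
      using D_cont t e unfolding continuous_on_iff by (metis SigmaI UNIV_I greaterThan_iff)
    then obtain d where d: "d > 0" and dD: "\<And>x s. 0 < s \<Longrightarrow> dist (x, s) (X y t, t) < d \<Longrightarrow> \<bar>D x s - D (X y t) t\<bar> < e"
      by (force simp: dist_real_def)
    obtain d' where d': "d' > 0" "\<And>s. \<bar>s - t\<bar> < d' \<Longrightarrow> 0 < s \<and> norm (X y s - X y t) < d / 2"
      using X_cont[OF t, of "d / 2" y] d by auto
    have near: "\<bar>v x s - v x t - (s - t) * D (X y t) t\<bar> \<le> e * \<bar>s - t\<bar>"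
      if s: "0 < s" "\<bar>s - t\<bar> < min (d / 2) t" and x: "norm (x - X y t) < d / 2" for x s
    proof -
      obtain \<theta> where \<theta>: "\<bar>\<theta> - t\<bar> \<le> \<bar>s - t\<bar>" "v x s - v x t = (s - t) * D x \<theta>" using mvt[OF s(1) t] by blast
      have "0 < \<theta>" using \<theta>(1) s by (auto simp: abs_le_iff abs_less_iff)
      moreover have "dist (x, \<theta>) (X y t, t) \<le> norm (x - X y t) + \<bar>\<theta> - t\<bar>"
        unfolding dist_norm using norm_triangle_ineq[of "(x - X y t, 0)" "(0, \<theta> - t)"] by simp
      then have "dist (x, \<theta>) (X y t, t) < d" using x \<theta>(1) s(2) by simp
      ultimately have "\<bar>D x \<theta> - D (X y t) t\<bar> < e" by (rule dD)
      then have "\<bar>s - t\<bar> * \<bar>D x \<theta> - D (X y t) t\<bar> \<le> \<bar>s - t\<bar> * e" by (intro mult_left_mono) auto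
      then show ?thesis unfolding \<theta>(2) right_diff_distrib[symmetric] abs_mult by (simp only: mult.commute)
    qed
    show "\<exists>d>0. \<forall>s. norm (s - t) < d \<longrightarrow> norm (V y s - V y t - - D (X y t) t * (s - t)) \<le> e * norm (s - t)"
    proof (intro exI[of _ "min d' (min (d / 2) t)"] conjI allI impI)
      fix s assume s: "norm (s - t) < min d' (min (d / 2) t)"
      then have s0: "0 < s" and Xs: "norm (X y s - X y t) < d / 2" using d'(2)[of s] by auto
      have "\<bar>v (X y t) s - v (X y t) t - (s - t) * D (X y t) t\<bar> \<le> e * \<bar>s - t\<bar>"
        using s d by (intro near[OF s0]) auto
      moreover have "\<bar>v (X y s) s - v (X y s) t - (s - t) * D (X y t) t\<bar> \<le> e * \<bar>s - t\<bar>"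
        using s by (intro near[OF s0 _ Xs]) auto
      ultimately show "norm (V y s - V y t - - D (X y t) t * (s - t)) \<le> e * norm (s - t)"
        using lower[OF t s0, of y] lower[OF s0 t, of y] by (simp add: abs_le_iff mult.commute)
    qed (use d d' t in simp)
  qed
  have D_eq: "- D (X y t) t = sqrt 2 * (\<Sum>i\<in>UNIV. matrix_inv (hessian (W t) (X y t)) $ i $ i)" if t: "0 < t" for y t
    unfolding D_def F_pi4_eq_trace_inv[OF \<zeta> is_solution_sym[OF sol t] is_solution_lower[OF sol t]] W_def
      hessian_add_half_sq[OF is_solution_partials[OF sol t]] by (simp add: trace_def)
  show ?thesis unfolding heat_solution_def
  proof (intro conjI exI allI impI)
    show "continuous_on (UNIV \<times> {0<..}) (\<lambda>(y, t). legendre (\<lambda>x. v x t + half_sq x) y)"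
      using V_cont unfolding V_def W_def .
    fix y :: "real^'n" and t :: real and i :: 'n
    assume t: "0 < t"
    note pd = uniformly_convex.partials_differentiable_legendre[OF uc[OF t]]
    show "((\<lambda>s. legendre (\<lambda>x. v x t + half_sq x) (y + s *\<^sub>R axis i 1)) has_real_derivative X y t $ i) (at 0)"
      using has_real_derivative_along_axis[OF partials_differentiableD(1)[OF pd], of y i 0]
      unfolding uniformly_convex.partial_legendre[OF uc[OF t]] X_def by (simp add: W_def)
    show "((\<lambda>s. X (y + s *\<^sub>R axis i 1) t $ i) has_real_derivative matrix_inv (hessian (W t) (X y t)) $ i $ i) (at 0)"
      using has_real_derivative_along_axis[OF partials_differentiableD(2)[OF pd], of i y i 0]
      unfolding uniformly_convex.partial_partial_legendre[OF uc[OF t]] unfolding uniformly_convex.partial_legendre[OF uc[OF t]] X_def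
      by simp
    show "((\<lambda>t. legendre (\<lambda>x. v x t + half_sq x) y) has_real_derivative
        sqrt 2 * (\<Sum>i\<in>UNIV. matrix_inv (hessian (W t) (X y t)) $ i $ i)) (at t)"
      using V_dt[OF t, of y] unfolding D_eq[OF t] V_def W_def .
  qed
qed

text \<open>Polarization: 4 H_ij is a difference of values of the quadratic form at the sum and the
  difference of two axis vectors, whose squared lengths add up to 4.\<close>

lemma hessian_entry_bound:
  fixes H :: "real^'n^'n"
  assumes sym: "transpose H = H" and "mat \<alpha> \<preceq>\<^sub>L H" "H \<preceq>\<^sub>L mat \<beta>"
  shows "\<bar>H $ i $ j\<bar> \<le> \<bar>\<alpha>\<bar> + \<bar>\<beta>\<bar>"
proof -
  define K where "K = \<bar>\<alpha>\<bar> + \<bar>\<beta>\<bar>"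
  have m: "mat c *v x = c *\<^sub>R x" for c and x :: "real^'n"
    by (simp add: vec_eq_iff matrix_vector_mult_def mat_def mult_delta_left)
  have b: "\<bar>x \<bullet> (H *v x)\<bar> \<le> K * (x \<bullet> x)" for x
  proof -
    have "\<alpha> * (x \<bullet> x) \<le> x \<bullet> (H *v x)" "x \<bullet> (H *v x) \<le> \<beta> * (x \<bullet> x)"
      using assms(2,3) unfolding loewner_le_def m by simp_all
    moreover have "- K * (x \<bullet> x) \<le> \<alpha> * (x \<bullet> x)" "\<beta> * (x \<bullet> x) \<le> K * (x \<bullet> x)"
      unfolding K_def by (intro mult_right_mono; simp)+
    ultimately show ?thesis by (simp add: abs_le_iff)
  qed
  let ?a = "axis i 1 :: real^'n" and ?b = "axis j 1 :: real^'n"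
  have ab: "?a \<bullet> (H *v ?b) = H $ i $ j" by (simp add: inner_axis' matrix_vector_mult_basis column_def)
  have ba: "?b \<bullet> (H *v ?a) = H $ i $ j"
    using symmetric_inner[OF sym, of ?b ?a] ab by (simp add: inner_commute)
  have "4 * H $ i $ j = (?a + ?b) \<bullet> (H *v (?a + ?b)) - (?a - ?b) \<bullet> (H *v (?a - ?b))"
    using ab ba by (simp add: matrix_vector_right_distrib matrix_vector_mult_diff_distrib inner_add_left inner_add_right inner_diff_left inner_diff_right)
  then have "\<bar>4 * H $ i $ j\<bar> \<le> K * ((?a + ?b) \<bullet> (?a + ?b)) + K * ((?a - ?b) \<bullet> (?a - ?b))"
    using b[of "?a + ?b"] b[of "?a - ?b"] by linarith
  also have "\<dots> = K * ((?a + ?b) \<bullet> (?a + ?b) + (?a - ?b) \<bullet> (?a - ?b))" by (simp add: distrib_left)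
  also have "(?a + ?b) \<bullet> (?a + ?b) + (?a - ?b) \<bullet> (?a - ?b) = 4"
    by (simp add: inner_add_left inner_add_right inner_diff_left inner_diff_right inner_axis inner_axis' inner_commute)
  finally show ?thesis unfolding K_def by simp
qed

text \<open>C precedes the solution: the index set I collects all members of the class at time one,
  so the algebra delivers constants common to all of them. Fixing time one loses nothing, since
  rescaling brings any positive time there.\<close>

theorem is_solution_derivative_bounds:
  fixes "is" :: "'n::finite list"
  assumes \<zeta>: "0 < \<zeta>" and "2 \<le> length is"
  shows "\<exists>C. \<forall>v0 v. is_solution \<zeta> \<rho> v0 v \<longrightarrow> (\<forall>x :: real^'n. \<bar>iter_partial is (\<lambda>x. v x 1) x\<bar> \<le> C)"
proof -
  obtain js a b where ijs: "is = js @ [a, b]"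
  proof (cases "is" rule: rev_cases)
    case (snoc ks j)
    then show ?thesis using that assms(2) by (cases ks rule: rev_cases) auto
  qed (use assms(2) in auto)
  define I where "I = {W :: real^'n \<Rightarrow> real. \<exists>v0 v. is_solution \<zeta> \<rho> v0 v \<and> W = (\<lambda>x. v x 1 + half_sq x)}"
  have uc: "uniformly_convex \<zeta> W" if "W \<in> I" for W
    using that is_solution_uniformly_convex[OF _ \<zeta> zero_less_one] unfolding I_def by auto
  \<comment> \<open>Here q is the Hessian of W, so derivatives of q are the ones to be bounded: q
    itself by the class, the dual derivatives by the heat equation.\<close>
  interpret F: inverse_hessian_family I legendre gradient "\<lambda>W a b. partial a (partial b W)"
    by unfold_locales (use uniformly_convex.inverse_hessian_along_gradient[OF uc] in auto)
  have "\<exists>C. \<forall>W\<in>I. \<forall>x. \<bar>iter_partial js (partial a (partial b W)) x\<bar> \<le> C"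
  proof (rule F.iter_partial_q_bounded)
    fix a b
    have "\<bar>partial a (partial b W) x\<bar> \<le> \<bar>- 1 + \<zeta>\<bar> + \<bar>\<rho>\<bar> + 1" if W: "W \<in> I" for W x
    proof -
      obtain v0 v where v: "is_solution \<zeta> \<rho> v0 v" "W = (\<lambda>x. v x 1 + half_sq x)" using W unfolding I_def by blast
      have "\<bar>partial a (partial b (\<lambda>x. v x 1)) x\<bar> \<le> \<bar>- 1 + \<zeta>\<bar> + \<bar>\<rho>\<bar>"
        using hessian_entry_bound[OF is_solution_sym[OF v(1) zero_less_one] is_solution_lower[OF v(1) zero_less_one]
          is_solution_upper[OF v(1) zero_less_one], of x a b] by simp
      then show ?thesis unfolding v(2) second_partials_add_half_sq[OF is_solution_partials[OF v(1) zero_less_one]] by auto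
    qed
    then show "\<exists>C. \<forall>W\<in>I. \<forall>x. \<bar>partial a (partial b W) x\<bar> \<le> C" by blast
  next
    fix ls :: "'n list" assume ls: "2 \<le> length ls"
    \<comment> \<open>The truncated subtraction is exact because \<open>ls\<close> has length at
      least two; the waiting time is one, and the bound is used at t = 1.\<close>
    obtain C where C: "\<And>h :: real^'n \<Rightarrow> real \<Rightarrow> real. heat_solution (sqrt 2) h \<Longrightarrow>
       (\<forall>t>0. \<forall>x d e. \<bar>foldr fdiff [d, e] (\<lambda>x. h x t) x\<bar> \<le> 1 / \<zeta> * \<bar>snd d\<bar> * \<bar>snd e\<bar>) \<Longrightarrow>
       (\<forall>t\<ge>1. \<forall>x ds. length ds = length ls - 2 + 2 \<longrightarrow> \<bar>foldr fdiff ds (\<lambda>x. h x t) x\<bar> \<le> C * (\<Prod>d\<leftarrow>ds. \<bar>snd d\<bar>))"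
      using heat_solution_iterated_difference_bound[where 'n = 'n, of "sqrt 2" "1 / \<zeta>" 1 "length ls - 2"] \<zeta> by (auto; blast)
    have "\<bar>iter_partial ls (legendre W) y\<bar> \<le> C" if W: "W \<in> I" for W y
    proof -
      obtain v0 v where v: "is_solution \<zeta> \<rho> v0 v" "W = (\<lambda>x. v x 1 + half_sq x)" using W unfolding I_def by blast
      have "\<forall>t>0. \<forall>x d e. \<bar>foldr fdiff [d, e] (\<lambda>y. legendre (\<lambda>x. v x t + half_sq x) y) x\<bar> \<le> 1 / \<zeta> * \<bar>snd d\<bar> * \<bar>snd e\<bar>"
        using uniformly_convex.legendre_second_difference[OF is_solution_uniformly_convex[OF v(1) \<zeta>]] by blast
      from C[OF legendre_heat_solution[OF v(1) \<zeta>] this]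
      have "\<bar>foldr fdiff ds (legendre W) x\<bar> \<le> C * (\<Prod>d\<leftarrow>ds. \<bar>snd d\<bar>)" if "length ds = length ls" for ds x
        using that ls unfolding v(2) by simp
      from iter_partial_bound_of_differences[OF uniformly_convex.partials_differentiable_legendre[OF uc[OF W]] this refl]
      show ?thesis .
    qed
    then show "\<exists>C. \<forall>W\<in>I. \<forall>y. \<bar>iter_partial ls (legendre W) (gradient W y)\<bar> \<le> C" by blast
  qed
  then obtain C where C: "\<And>W x. W \<in> I \<Longrightarrow> \<bar>iter_partial is W x\<bar> \<le> C"
    unfolding ijs iter_partial_append by auto
  have "\<bar>iter_partial is (\<lambda>x. v x 1) x\<bar> \<le> C + 1" if v: "is_solution \<zeta> \<rho> v0 v" for v0 v and x :: "real^'n"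
  proof -
    obtain c :: real where c: "c \<in> {0, 1}" "iter_partial is half_sq = (\<lambda>x :: real^'n. c)"
      using iter_partial_half_sq[OF assms(2)] by blast
    have "\<bar>iter_partial is (\<lambda>x. v x 1 + half_sq x) x\<bar> \<le> C"
      by (rule C) (use v in \<open>auto simp: I_def\<close>)
    then show ?thesis
      using c unfolding iter_partial_add[OF is_solution_partials[OF v zero_less_one] partials_differentiable_half_sq] by auto
  qed
  then show ?thesis by blast
qed

section \<open>Convergence\<close>

text \<open>Interpolation: Taylor expansion with step s bounds the difference of derivatives by 2
  sup |f - g| / s + 2 C s. The step is fixed from e and C, after which uniform convergence makes the
  first term small.\<close>

lemma uniform_limit_partial:
  fixes f :: "'b \<Rightarrow> real^'n \<Rightarrow> real" and g :: "real^'n \<Rightarrow> real"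
  assumes lim: "\<And>K. compact K \<Longrightarrow> uniform_limit K f g F"
    and f: "\<forall>\<^sub>F b in F. \<forall>x. f b differentiable (at x) \<and> partial i (f b) differentiable (at x) \<and>
        \<bar>partial i (partial i (f b)) x\<bar> \<le> C"
    and g: "\<And>x. g differentiable (at x)" "\<And>x. partial i g differentiable (at x)"
      "\<And>x. \<bar>partial i (partial i g) x\<bar> \<le> C"
    and K: "compact K"
  shows "uniform_limit K (\<lambda>b. partial i (f b)) (partial i g) F"
  unfolding uniform_limit_iff
proof (intro allI impI)
  fix e :: real assume e: "0 < e"
  let ?e = "axis i 1 :: real^'n"
  have C: "C \<ge> 0" using g(3)[of 0] by linarith
  have taylor: "\<bar>h (x + s *\<^sub>R ?e) - h x - s * partial i h x\<bar> \<le> s * (C * s)"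
    if h: "\<And>x. h differentiable (at x)" "\<And>x. partial i h differentiable (at x)"
      "\<And>x. \<bar>partial i (partial i h) x\<bar> \<le> C" and s: "0 < s" for h :: "real^'n \<Rightarrow> real" and x s
  proof -
    have "\<exists>a. 0 < a \<and> a < s \<and> h (x + s *\<^sub>R ?e) - h (x + 0 *\<^sub>R ?e) = (s - 0) * partial i h (x + a *\<^sub>R ?e)"
      by (rule MVT2[OF s]) (intro has_real_derivative_along_axis h)
    then obtain a where a: "0 < a" "a < s" "h (x + s *\<^sub>R ?e) - h x = s * partial i h (x + a *\<^sub>R ?e)" by auto
    have "\<exists>b. 0 < b \<and> b < a \<and> partial i h (x + a *\<^sub>R ?e) - partial i h (x + 0 *\<^sub>R ?e) = (a - 0) * partial i (partial i h) (x + b *\<^sub>R ?e)"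
      by (rule MVT2[OF a(1)]) (intro has_real_derivative_along_axis h)
    then obtain b where "partial i h (x + a *\<^sub>R ?e) - partial i h x = a * partial i (partial i h) (x + b *\<^sub>R ?e)" by auto
    then have "\<bar>partial i h (x + a *\<^sub>R ?e) - partial i h x\<bar> \<le> a * C"
      using a(1) h(3) by (simp add: abs_mult)
    also have "\<dots> \<le> C * s" using a C by (simp add: mult.commute mult_left_mono)
    finally have "s * \<bar>partial i h (x + a *\<^sub>R ?e) - partial i h x\<bar> \<le> s * (C * s)"
      using s by (intro mult_left_mono) auto
    moreover have "h (x + s *\<^sub>R ?e) - h x - s * partial i h x = s * (partial i h (x + a *\<^sub>R ?e) - partial i h x)"
      unfolding a(3) by (simp add: right_diff_distrib)
    ultimately show ?thesis using s by (simp only: abs_mult abs_of_pos)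
  qed
  define s where "s = e / (4 * (C + 1))"
  have s: "0 < s" unfolding s_def using e C by simp
  have Cs: "C * s < e / 4" unfolding s_def using e C by (simp add: field_simps)
  \<comment> \<open>Difference quotients based in K also evaluate the functions on the translate of
    K by s along the axis.\<close>
  have cK: "compact (K \<union> (\<lambda>x. s *\<^sub>R ?e + x) ` K)"
    using K compact_translation[OF K, of "s *\<^sub>R ?e"] by (simp add: compact_Un)
  have "\<forall>\<^sub>F b in F. \<forall>x\<in>K \<union> (\<lambda>x. s *\<^sub>R ?e + x) ` K. dist (f b x) (g x) < s * (e / 8)"
    by (rule uniform_limitD[OF lim[OF cK]]) (use s e in simp)
  then show "\<forall>\<^sub>F b in F. \<forall>x\<in>K. dist (partial i (f b) x) (partial i g x) < e"
    using f
  proof eventually_elim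
    case (elim b)
    show ?case
    proof
      fix x assume x: "x \<in> K"
      have 1: "\<bar>f b x - g x\<bar> < s * (e / 8)" using elim(1) x by (auto simp: dist_real_def)
      have 2: "\<bar>f b (x + s *\<^sub>R ?e) - g (x + s *\<^sub>R ?e)\<bar> < s * (e / 8)"
        using elim(1) x by (auto simp: dist_real_def add.commute)
      have 3: "\<bar>f b (x + s *\<^sub>R ?e) - f b x - s * partial i (f b) x\<bar> \<le> s * (C * s)"
        using elim(2) by (intro taylor s) auto
      have 4: "\<bar>g (x + s *\<^sub>R ?e) - g x - s * partial i g x\<bar> \<le> s * (C * s)"
        by (intro taylor g s)
      have "s * (C * s) < s * (e / 4)" using Cs s by simp
      moreover have "s * (e / 8) + s * (e / 8) + s * (e / 4) + s * (e / 4) < s * e" using s e by (simp add: field_simps)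
      ultimately have "\<bar>s * partial i (f b) x - s * partial i g x\<bar> < s * e"
        using 1 2 3 4 by linarith
      then have "s * \<bar>partial i (f b) x - partial i g x\<bar> < s * e"
        using s by (simp add: abs_mult flip: right_diff_distrib)
      then show "dist (partial i (f b) x) (partial i g x) < e" using s by (simp add: dist_real_def)
    qed
  qed
qed

section \<open>Blow-down of the initial value and convergence of the rescaled solutions\<close>

lemma homogeneous_limit:
  fixes u0 U0 :: "real^'n \<Rightarrow> real"
  assumes lim: "\<And>x. ((\<lambda>r. u0 (r *\<^sub>R x) / r\<^sup>2) \<longlongrightarrow> U0 x) at_top" and s: "0 < s"
  shows "U0 (s *\<^sub>R x) = s\<^sup>2 * U0 x"
proof (rule tendsto_unique[OF _ lim])
  have "filterlim (\<lambda>r. s * r) at_top at_top"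
    by (rule filterlim_tendsto_pos_mult_at_top[OF tendsto_const s filterlim_ident])
  from tendsto_mult_left[OF filterlim_compose[OF lim this], of "s\<^sup>2" x]
  show "((\<lambda>r. u0 (r *\<^sub>R s *\<^sub>R x) / r\<^sup>2) \<longlongrightarrow> s\<^sup>2 * U0 x) at_top"
    using s by (simp add: mult.commute power_mult_distrib)
qed simp

lemma norm_gradient_le:
  fixes f :: "real^'n \<Rightarrow> real" and L :: real
  assumes "\<And>i. \<bar>partial i f x\<bar> \<le> L"
  shows "norm (gradient f x) \<le> CARD('n) * L"
proof -
  have "norm (gradient f x) \<le> (\<Sum>i\<in>UNIV. \<bar>gradient f x $ i\<bar>)" by (rule norm_le_l1_cart)
  also have "\<dots> \<le> CARD('n) * L" using sum_bounded_above[of "UNIV :: 'n set" "\<lambda>i. \<bar>gradient f x $ i\<bar>" L] assms by simp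
  finally show ?thesis .
qed

lemma difference_le_gradient:
  fixes f :: "real^'n \<Rightarrow> real"
  assumes f: "\<And>x. f differentiable (at x)" and "convex S" "x \<in> S" "y \<in> S"
    and bd: "\<And>x. x \<in> S \<Longrightarrow> norm (gradient f x) \<le> B"
  shows "\<bar>f x - f y\<bar> \<le> B * norm (x - y)"
proof -
  have "norm (f x - f y) \<le> B * norm (x - y)"
  proof (rule differentiable_bound[OF assms(2)])
    show "(f has_derivative (\<lambda>v. gradient f z \<bullet> v)) (at z within S)" for z
      by (rule has_derivative_at_withinI[OF has_derivative_gradient[OF f]])
    show "onorm (\<lambda>v. gradient f z \<bullet> v) \<le> B" if "z \<in> S" for z
    proof (rule onorm_le)
      fix v
      have "norm (gradient f z \<bullet> v) \<le> norm (gradient f z) * norm v" using Cauchy_Schwarz_ineq2 by simp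
      also have "\<dots> \<le> B * norm v" using bd[OF that] by (rule mult_right_mono) simp
      finally show "norm (gradient f z \<bullet> v) \<le> B * norm v" .
    qed
  qed (use assms in auto)
  then show ?thesis by simp
qed

lemma gradient_linear_growth:
  fixes f :: "real^'n \<Rightarrow> real" and L :: real
  assumes C2: "Ck_on 2 UNIV f" and L: "\<And>i j x. \<bar>partial i (partial j f) x\<bar> \<le> L"
  obtains a b where "0 \<le> a" "0 \<le> b" "\<And>x. norm (gradient f x) \<le> a + b * norm x"
proof -
  have L0: "0 \<le> L" using L[of undefined undefined 0] by linarith
  have 1: "\<bar>partial j f x - partial j f 0\<bar> \<le> CARD('n) * L * norm x" for j x
    using difference_le_gradient[OF Ck_on_2D(2)[OF C2] convex_UNIV, of x 0] norm_gradient_le[OF L] by simp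
  define G where "G = (\<Sum>j\<in>UNIV. \<bar>partial j f 0\<bar>)"
  have G: "\<bar>partial j f 0\<bar> \<le> G" for j unfolding G_def by (rule member_le_sum) auto
  have G0: "0 \<le> G" unfolding G_def by (rule sum_nonneg) simp
  have "\<bar>partial j f x\<bar> \<le> G + CARD('n) * L * norm x" for j x using 1[of j x] G[of j] by linarith
  then have "norm (gradient f x) \<le> CARD('n) * (G + CARD('n) * L * norm x)" for x by (rule norm_gradient_le)
  then have "norm (gradient f x) \<le> CARD('n) * G + CARD('n) * (CARD('n) * L) * norm x" for x
    by (simp add: algebra_simps)
  then show thesis using L0 G0 by (intro that[of "CARD('n) * G" "CARD('n) * (CARD('n) * L)"]) simp_all
qed

text \<open>The pointwise limit becomes uniform on the unit sphere, because the rescaled functions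
  are equi-Lipschitz there and a finite net suffices. Homogeneity of U0 then turns this into an
  error e |x|^2 outside a ball, and C covers the ball by compactness.\<close>

lemma blowdown_close:
  fixes u0 U0 :: "real^'n \<Rightarrow> real"
  assumes C2: "Ck_on 2 UNIV u0" and U0: "continuous_on UNIV U0"
    and L: "\<And>i j x. \<bar>partial i (partial j u0) x\<bar> \<le> L"
    and lim: "\<And>x. ((\<lambda>r. u0 (r *\<^sub>R x) / r\<^sup>2) \<longlongrightarrow> U0 x) at_top" and e: "0 < e"
  shows "\<exists>C. \<forall>x. \<bar>u0 x - U0 x\<bar> \<le> e * (x \<bullet> x) + C"
proof -
  obtain a b where ab: "0 \<le> a" "0 \<le> b" "\<And>x. norm (gradient u0 x) \<le> a + b * norm x"
    using gradient_linear_growth[OF C2 L] by blast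
  define f where "f = (\<lambda>r x. u0 (r *\<^sub>R x) / r\<^sup>2)"
  have lip: "\<bar>f r x - f r y\<bar> \<le> (a + b) * norm (x - y)" if r: "1 \<le> r" and "norm x \<le> 1" "norm y \<le> 1" for r x y
  proof -
    have "\<bar>u0 (r *\<^sub>R x) - u0 (r *\<^sub>R y)\<bar> \<le> (a + b * r) * norm (r *\<^sub>R x - r *\<^sub>R y)"
    proof (rule difference_le_gradient[OF Ck_on_2D(1)[OF C2] convex_cball[of 0 r]])
      fix z assume "z \<in> cball (0 :: real^'n) r"
      then have "b * norm z \<le> b * r" using ab by (intro mult_left_mono) auto
      then show "norm (gradient u0 z) \<le> a + b * r" using ab(3)[of z] by linarith
    qed (use that in \<open>auto simp: mult_left_le\<close>)
    also have "norm (r *\<^sub>R x - r *\<^sub>R y) = r * norm (x - y)" using r by (simp flip: scaleR_diff_right)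
    also have "(a + b * r) * (r * norm (x - y)) \<le> ((a + b) * r) * (r * norm (x - y))"
    proof (rule mult_right_mono)
      have "a * 1 \<le> a * r" using ab r by (intro mult_left_mono) auto
      then show "a + b * r \<le> (a + b) * r" by (simp add: distrib_right)
    qed (use r in simp)
    finally have "\<bar>u0 (r *\<^sub>R x) - u0 (r *\<^sub>R y)\<bar> \<le> r\<^sup>2 * ((a + b) * norm (x - y))"
      by (simp add: power2_eq_square mult_ac)
    moreover have "\<bar>f r x - f r y\<bar> = \<bar>u0 (r *\<^sub>R x) - u0 (r *\<^sub>R y)\<bar> / r\<^sup>2"
      unfolding f_def by (simp flip: diff_divide_distrib)
    ultimately show ?thesis using r by (simp add: divide_le_eq mult.commute)
  qed
  have lipU: "\<bar>U0 x - U0 y\<bar> \<le> (a + b) * norm (x - y)" if "norm x \<le> 1" "norm y \<le> 1" for x y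
  proof (rule tendsto_upperbound)
    show "((\<lambda>r. \<bar>f r x - f r y\<bar>) \<longlongrightarrow> \<bar>U0 x - U0 y\<bar>) at_top"
      unfolding f_def by (intro tendsto_intros lim)
    show "\<forall>\<^sub>F r in at_top. \<bar>f r x - f r y\<bar> \<le> (a + b) * norm (x - y)"
      using eventually_ge_at_top[of 1] by eventually_elim (use lip that in auto)
  qed simp
  \<comment> \<open>Each of the two Lipschitz errors within a net cell, like the error at the net
    point, stays below e / 3.\<close>
  define \<delta> where "\<delta> = e / (3 * (a + b + 1))"
  have \<delta>: "0 < \<delta>" unfolding \<delta>_def using e ab by (simp add: add_nonneg_pos)
  have ab\<delta>: "(a + b) * \<delta> < e / 3"
    unfolding \<delta>_def using e ab by (simp add: pos_divide_less_eq add_nonneg_pos field_simps)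
  obtain N where N: "finite N" "N \<subseteq> sphere 0 1" "sphere (0 :: real^'n) 1 \<subseteq> (\<Union>x\<in>N. ball x \<delta>)"
    using seq_compact_imp_totally_bounded[of "sphere (0 :: real^'n) 1"] \<delta> compact_sphere[of "0 :: real^'n" 1]
    unfolding compact_eq_seq_compact_metric by blast
  have "\<forall>x\<in>N. \<forall>\<^sub>F r in at_top. \<bar>f r x - U0 x\<bar> < e / 3"
    using tendstoD[OF lim, of "e / 3"] e unfolding f_def by (simp add: dist_real_def)
  then have "\<forall>\<^sub>F r in at_top. \<forall>x\<in>N. \<bar>f r x - U0 x\<bar> < e / 3"
    using N(1) by (simp add: eventually_ball_finite)
  then obtain R0 where R0: "\<And>r x. R0 \<le> r \<Longrightarrow> x \<in> N \<Longrightarrow> \<bar>f r x - U0 x\<bar> < e / 3"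
    unfolding eventually_at_top_linorder by blast
  define R where "R = max R0 1"
  have sph: "\<bar>f r x - U0 x\<bar> < e" if r: "R \<le> r" and x: "norm x = 1" for r x
  proof -
    obtain y where y: "y \<in> N" "norm (y - x) < \<delta>" using N(3) x by (auto simp: dist_norm)
    have ny: "norm y = 1" using N(2) y by auto
    have "norm (x - y) \<le> \<delta>" using y(2) by (simp add: norm_minus_commute)
    then have "(a + b) * norm (x - y) \<le> (a + b) * \<delta>" using ab by (intro mult_left_mono) auto
    moreover have "\<bar>f r x - f r y\<bar> \<le> (a + b) * norm (x - y)" using lip[of r x y] r x ny unfolding R_def by simp
    moreover have "\<bar>U0 x - U0 y\<bar> \<le> (a + b) * norm (x - y)" using lipU[of x y] x ny by simp
    moreover have "\<bar>f r y - U0 y\<bar> < e / 3" using R0[OF _ y(1)] r unfolding R_def by simp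
    ultimately show ?thesis using ab\<delta> by linarith
  qed
  have far: "\<bar>u0 x - U0 x\<bar> \<le> e * (x \<bullet> x)" if x: "R \<le> norm x" for x
  proof -
    define r where "r = norm x"
    have r: "1 \<le> r" "R \<le> r" using x unfolding r_def R_def by auto
    define y where "y = (1 / r) *\<^sub>R x"
    have y: "norm y = 1" "x = r *\<^sub>R y" using r unfolding y_def r_def by auto
    have "u0 x - U0 x = r\<^sup>2 * (f r y - U0 y)"
      using homogeneous_limit[OF lim, of r y] r unfolding y(2) f_def by (simp add: right_diff_distrib)
    moreover have "r\<^sup>2 * \<bar>f r y - U0 y\<bar> \<le> r\<^sup>2 * e" using sph[OF r(2) y(1)] by (intro mult_left_mono) auto
    ultimately show ?thesis unfolding dot_square_norm r_def[symmetric] by (simp add: abs_mult mult.commute)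
  qed
  have "continuous_on (cball 0 R) (\<lambda>x. \<bar>u0 x - U0 x\<bar>)"
    using Ck_on_2D(1)[OF C2] U0
    by (intro continuous_intros) (auto intro: continuous_on_subset simp: continuous_at_imp_continuous_on differentiable_imp_continuous_within)
  then have "bounded ((\<lambda>x. \<bar>u0 x - U0 x\<bar>) ` cball 0 R)"
    by (intro compact_imp_bounded compact_continuous_image compact_cball)
  then obtain C where "\<forall>x\<in>cball 0 R. \<bar>u0 x - U0 x\<bar> \<le> C"
    unfolding bounded_iff by auto
  then have C: "\<bar>u0 x - U0 x\<bar> \<le> C" if "norm x \<le> R" for x
    using that by simp
  have "0 \<le> R" unfolding R_def by simp
  then have C0: "0 \<le> C" using C[of 0] by simp
  have "\<bar>u0 x - U0 x\<bar> \<le> e * (x \<bullet> x) + C" for x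
  proof (cases "norm x \<le> R")
    case True
    have "0 \<le> e * (x \<bullet> x)" using e by simp
    then show ?thesis using C[OF True] by linarith
  next
    case False
    then show ?thesis using far[of x] C0 by simp
  qed
  then show ?thesis by blast
qed

text \<open>At the point (sqrt t x, t) the comparison error is t times 2 \<epsilon> (|x|^2 + k),
  plus C, and U equals t U(x, 1) by self-similarity. Division by t leaves a term small with
  \<epsilon> and the vanishing term C / t.\<close>

lemma rescaled_uniform_limit:
  fixes u U :: "real^'n \<Rightarrow> real \<Rightarrow> real"
  assumes u: "is_solution \<zeta> \<rho> u0 u" and U: "is_solution \<zeta> \<rho> U0 U" and \<zeta>: "0 < \<zeta>"
    and close: "\<And>e. 0 < e \<Longrightarrow> \<exists>C. \<forall>x. \<bar>u0 x - U0 x\<bar> \<le> e * (x \<bullet> x) + C"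
    and hom: "\<And>r x. 0 < r \<Longrightarrow> U0 (r *\<^sub>R x) = r\<^sup>2 * U0 x"
    and K: "compact K"
  shows "uniform_limit K (\<lambda>t x. u (sqrt t *\<^sub>R x) t / t) (\<lambda>x. U x 1) at_top"
  unfolding uniform_limit_iff
proof (intro allI impI)
  fix e :: real assume e: "0 < e"
  define k where "k = 2 * sqrt 2 * CARD('n) / \<zeta>\<^sup>2 + 1"
  have k: "0 < k" unfolding k_def by (intro add_nonneg_pos) auto
  obtain B where B: "0 < B" "\<And>x. x \<in> K \<Longrightarrow> norm x \<le> B"
    using compact_imp_bounded[OF K] unfolding bounded_pos by blast
  \<comment> \<open>The barrier contribution over K becomes at most e / 2. Only afterwards is C
    fixed, since it depends on \<epsilon>, and large t disposes of it.\<close>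
  define \<epsilon> where "\<epsilon> = e / (4 * (B\<^sup>2 + k))"
  have Bk: "0 < B\<^sup>2 + k" using k by (simp add: add_nonneg_pos)
  have \<epsilon>: "0 < \<epsilon>" unfolding \<epsilon>_def using e Bk by simp
  obtain C where C: "\<And>x. \<bar>u0 x - U0 x\<bar> \<le> \<epsilon> * (x \<bullet> x) + C" using close[OF \<epsilon>] by blast
  have main: "\<bar>u y t - U y t\<bar> \<le> 2 * \<epsilon> * (y \<bullet> y + k * t) + C" if t: "0 \<le> t" for y t
  proof -
    have "u y t - U y t \<le> 2 * \<epsilon> * (y \<bullet> y + k * t) + C"
      unfolding k_def by (rule is_solution_comparison[OF u U \<zeta> \<epsilon> _ t]) (use C in \<open>auto simp: abs_le_iff\<close>)
    moreover have "U y t - u y t \<le> 2 * \<epsilon> * (y \<bullet> y + k * t) + C"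
      unfolding k_def
    proof (rule is_solution_comparison[OF U u \<zeta> \<epsilon> _ t])
      show "U0 x - u0 x \<le> \<epsilon> * (x \<bullet> x) + C" for x using C[of x] by linarith
    qed
    ultimately show ?thesis by (simp add: abs_le_iff)
  qed
  have "((\<lambda>t. C / t) \<longlongrightarrow> 0) at_top"
    by (rule real_tendsto_divide_at_top[OF tendsto_const filterlim_ident])
  then have "\<forall>\<^sub>F t in at_top. C / t < e / 2" using e by (intro order_tendstoD) auto
  then show "\<forall>\<^sub>F t in at_top. \<forall>x\<in>K. dist (u (sqrt t *\<^sub>R x) t / t) (U x 1) < e"
    using eventually_gt_at_top[of 0]
  proof eventually_elim
    case (elim t)
    show ?case
    proof
      fix x assume x: "x \<in> K"
      let ?y = "sqrt t *\<^sub>R x"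
      have "U ?y t = t * U x 1"
        using self_similar[OF U \<zeta> hom, of "sqrt t" 1 x] elim by simp
      then have "u ?y t / t - U x 1 = (u ?y t - U ?y t) / t" using elim by (simp add: diff_divide_distrib)
      then have "dist (u ?y t / t) (U x 1) = \<bar>u ?y t - U ?y t\<bar> / t" using elim by (simp add: dist_real_def)
      also have "\<dots> \<le> (2 * \<epsilon> * (?y \<bullet> ?y + k * t) + C) / t"
        using main[of t ?y] elim by (intro divide_right_mono) auto
      also have "?y \<bullet> ?y = t * (x \<bullet> x)" using elim by (simp flip: mult.assoc)
      also have "(2 * \<epsilon> * (t * (x \<bullet> x) + k * t) + C) / t = 2 * \<epsilon> * (x \<bullet> x + k) + C / t"
        using elim by (simp add: field_simps)
      also have "\<dots> \<le> 2 * \<epsilon> * (B\<^sup>2 + k) + C / t"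
      proof -
        have "x \<bullet> x \<le> B\<^sup>2" using B(2)[OF x] by (simp add: dot_square_norm power_mono)
        then show ?thesis using \<epsilon> by (intro add_mono mult_left_mono) auto
      qed
      also have "2 * \<epsilon> * (B\<^sup>2 + k) = e / 2" unfolding \<epsilon>_def using Bk by (simp add: field_simps)
      finally show "dist (u ?y t / t) (U x 1) < e" using elim(1) by linarith
    qed
  qed
qed

theorem theorem1p5:
  fixes u0 U0 :: "real ^ 'n \<Rightarrow> real"
    and u U :: "real ^ 'n \<Rightarrow> real \<Rightarrow> real"
    and \<zeta> \<rho> :: real
  assumes "\<rho> > 0" and "0 < \<zeta>" and "\<zeta> < \<rho> + 1"
    and "Ck_on 2 UNIV u0" and "hessian_bounds \<zeta> \<rho> u0"
    and "Ck_on 2 UNIV U0"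
    and "\<And>x. ((\<lambda>r. u0 (r *\<^sub>R x) / r\<^sup>2) \<longlongrightarrow> U0 x) at_top"
    and "is_solution \<zeta> \<rho> u0 u"
    and "is_solution \<zeta> \<rho> U0 U"
  shows "smooth_convergence_on_compacts (\<lambda>t x. u (sqrt t *\<^sub>R x) t / t) (\<lambda>x. U x 1) at_top
       \<and> self_expander (\<lambda>x. U x 1)"
proof
  note \<zeta> = assms(2) and u = assms(8) and U = assms(9)
  have hom: "U0 (r *\<^sub>R x) = r\<^sup>2 * U0 x" if "0 < r" for r x
    using homogeneous_limit[OF assms(7) that] .
  show "self_expander (\<lambda>x. U x 1)"
    by (rule self_expander_of_homogeneous(2)[OF U \<zeta> hom])
  have close: "\<exists>C. \<forall>x. \<bar>u0 x - U0 x\<bar> \<le> e * (x \<bullet> x) + C" if "0 < e" for e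
  proof (rule blowdown_close[OF assms(4) _ _ assms(7) that])
    show "continuous_on UNIV U0"
      using Ck_on_2D(1)[OF assms(6)] by (simp add: continuous_at_imp_continuous_on differentiable_imp_continuous_within)
    show "\<bar>partial i (partial j u0) x\<bar> \<le> \<bar>- 1 + \<zeta>\<bar> + \<bar>\<rho>\<bar>" for i j x
      using hessian_entry_bound[OF hessian_symmetric[OF assms(4)], of "- 1 + \<zeta>" x \<rho> i j] assms(5)
      unfolding hessian_bounds_def by simp
  qed
  define f where "f = (\<lambda>t x. u (sqrt t *\<^sub>R x) t / t)"
  \<comment> \<open>Each rescaled profile is the time-one slice of another solution in the same
    class, so the bounds at time one apply uniformly in t.\<close>
  have slice: "\<exists>v0 v. is_solution \<zeta> \<rho> v0 v \<and> f t = (\<lambda>x. v x 1)" if "0 < t" for t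
    using is_solution_scale[OF u, of "sqrt t"] that unfolding f_def by fastforce
  have "\<forall>K. compact K \<longrightarrow> uniform_limit K (\<lambda>t. iter_partial is (f t)) (iter_partial is (\<lambda>x. U x 1)) at_top" for "is"
  proof (induction "is")
    case Nil
    show ?case using rescaled_uniform_limit[OF u U \<zeta> close hom] unfolding f_def by simp
  next
    case (Cons i js)
    \<comment> \<open>The index list has length at least two even for empty \<open>js\<close>, so
      the second derivative needed for the interpolation is always within reach of the uniform
      bounds.\<close>
    obtain C where C: "\<And>v0 v x. is_solution \<zeta> \<rho> v0 v \<Longrightarrow> \<bar>iter_partial (i # i # js) (\<lambda>x. v x 1) x\<bar> \<le> C"
      using is_solution_derivative_bounds[OF \<zeta>, of "i # i # js" \<rho>] by auto
    have diff: "iter_partial ls (\<lambda>x. v x 1) differentiable (at x)" if "is_solution \<zeta> \<rho> v0 v" for v0 v ls x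
      using is_solution_partials[OF that zero_less_one] unfolding partials_differentiable_def by blast
    show ?case unfolding iter_partial_simps
    proof (intro allI impI uniform_limit_partial[where C = C])
      show "uniform_limit K (\<lambda>t. iter_partial js (f t)) (iter_partial js (\<lambda>x. U x 1)) at_top" if "compact K" for K
        using Cons that by blast
      show "\<forall>\<^sub>F t in at_top. \<forall>x. iter_partial js (f t) differentiable (at x) \<and>
          partial i (iter_partial js (f t)) differentiable (at x) \<and>
          \<bar>partial i (partial i (iter_partial js (f t))) x\<bar> \<le> C"
        using eventually_gt_at_top[of 0]
      proof eventually_elim
        case (elim t)
        obtain v0 v where v: "is_solution \<zeta> \<rho> v0 v" "f t = (\<lambda>x. v x 1)" using slice[OF elim] by blast
        show ?case using diff[OF v(1), of js] diff[OF v(1), of "i # js"] C[OF v(1)] unfolding v(2) by simp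
      qed
    qed (use diff[OF U, of js] diff[OF U, of "i # js"] C[OF U] in simp_all)
  qed
  then show "smooth_convergence_on_compacts (\<lambda>t x. u (sqrt t *\<^sub>R x) t / t) (\<lambda>x. U x 1) at_top"
    unfolding smooth_convergence_on_compacts_def f_def by blast
qed

end
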